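(* Let $\mathcal K$ be a tt-category and suppose $A$ is a ring that is quasi-Galois in $\mathcal K$ with group $\Gamma$. Then there is a homeomorphism $$\mathrm{supp}(A)\cong \mathrm{Spc}(A\text{-}\mathrm{Mod}_{\mathcal K})/\Gamma,$$ where $\mathrm{supp}(A)\subset\mathrm{Spc}(\mathcal K)$ carries the subspace topology and the right-hand side is the quotient space of $\Gamma$-orbits.
   Context: A tt-category $(\mathcal K,\otimes,\mathbb 1)$ is an essentially small, idempotent-complete triangulated category with a symmetric monoidal structure such that $x\otimes-$ is exact for every object $x$. A tt-functor is an exact (symmetric) monoidal functor. Spectrum. $\mathrm{Spc}(\mathcal K)$ is the set of prime thick $\otimes$-ideals $\mathcal P\subsetneq\mathcal K$; $\mathrm{supp}(x)=\{\mathcal P\mid x\notin\mathcal P\}$; the complements of the supports $\mathrm{supp}(x)$, $x\in\mathcal K$, form an open basis for the topology. A tt-functor $F:\mathcal K\to\mathcal L$ induces a continuous map $\mathrm{Spc}(F):\mathrm{Spc}(\mathcal L)\to\mathrm{Spc}(\mathcal K)$, $\mathcal Q\mapsto F^{-1}(\mathcal Q)$. Rings. A ring in $\mathcal K$ is a commutative monoid $(A,\mu,\eta)$ in $\mathcal K$; ring morphisms preserve multiplication and unit. $A$ is separable if $\mu$ has an $A,A$-bilinear section. For a nonzero ring $A$ and a finite group $\Gamma$ of ring automorphisms of $A$, $A$ is quasi-Galois in $\mathcal K$ with group $\Gamma$ if $\lambda_\Gamma:A\otimes A\to\prod_{\gamma\in\Gamma}A$, defined by $\mathrm{pr}_\gamma\lambda_\Gamma=\mu(1\otimes\gamma)$,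 is an isomorphism; such $A$ is automatically separable. Modules. For $A$ separable, $A\text{-}\mathrm{Mod}_{\mathcal K}$ is the category of left $A$-modules in $\mathcal K$, symmetric monoidal under $\otimes_A$ ($x\otimes_Ay$ being the coequaliser of the two action maps $x\otimes A\otimes y\rightrightarrows x\otimes y$) with unit $A$. By a theorem of Balmer recalled in the paper, $A\text{-}\mathrm{Mod}_{\mathcal K}$ is a tt-category such that extension-of-scalars $F_A:\mathcal K\to A\text{-}\mathrm{Mod}_{\mathcal K}$, $F_A(x)=A\otimes x$, is a tt-functor and the forgetful functor is exact. Action of $\Gamma$. A ring morphism $h:A\to B$ of separable rings induces a functor $F_h:A\text{-}\mathrm{Mod}_{\mathcal K}\to B\text{-}\mathrm{Mod}_{\mathcal K}$, $F_h(x)=B\otimes_Ax$ ($B$ an $A$-module via $h$, with $B$ acting on the left factor), and $F_{gh}\cong F_gF_h$. Thus $\Gamma$ acts on $A\text{-}\mathrm{Mod}_{\mathcal K}$ via the functors $F_\gamma$, and on $\mathrm{Spc}(A\text{-}\mathrm{Mod}_{\mathcal K})$ via the maps $\mathrm{Spc}(F_\gamma)$. *)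

theory Defs
  imports "HOL-Analysis.Abstract_Topology" "HOL-Algebra.Group_Action"
begin

section \<open>Categories and functors\<close>

text \<open>Objects and arrows form sets, so every category here is small; "essentially small" is
  therefore no further condition on a tt-category.\<close>

record ('o, 'm) category =
  Obj :: "'o set"
  Arr :: "'m set"
  Dom :: "'m \<Rightarrow> 'o"
  Cod :: "'m \<Rightarrow> 'o"
  Ident :: "'o \<Rightarrow> 'm"
  Comp :: "'m \<Rightarrow> 'm \<Rightarrow> 'm" (infixr "\<cdot>\<index>" 70)

definition Hom :: "('o, 'm, 'z) category_scheme \<Rightarrow> 'o \<Rightarrow> 'o \<Rightarrow> 'm set" where
  "Hom C x y = {f \<in> Arr C. Dom C f = x \<and> Cod C f = y}"

locale category =
  fixes C :: "('o, 'm, 'z) category_scheme" (structure)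
  assumes Dom_Obj: "f \<in> Arr C \<Longrightarrow> Dom C f \<in> Obj C"
    and Cod_Obj: "f \<in> Arr C \<Longrightarrow> Cod C f \<in> Obj C"
    and Ident_Hom: "x \<in> Obj C \<Longrightarrow> Ident C x \<in> Hom C x x"
    and Comp_Hom: "\<lbrakk>f \<in> Hom C x y; g \<in> Hom C y z\<rbrakk> \<Longrightarrow> g \<cdot> f \<in> Hom C x z"
    and Comp_assoc:
      "\<lbrakk>f \<in> Hom C w x; g \<in> Hom C x y; h \<in> Hom C y z\<rbrakk> \<Longrightarrow> (h \<cdot> g) \<cdot> f = h \<cdot> (g \<cdot> f)"
    and Ident_left: "f \<in> Hom C x y \<Longrightarrow> Ident C y \<cdot> f = f"
    and Ident_right: "f \<in> Hom C x y \<Longrightarrow> f \<cdot> Ident C x = f"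

definition inverse_arrows :: "('o, 'm, 'z) category_scheme \<Rightarrow> 'm \<Rightarrow> 'm \<Rightarrow> bool" where
  "inverse_arrows C f g \<longleftrightarrow> f \<in> Arr C \<and> g \<in> Hom C (Cod C f) (Dom C f) \<and>
     g \<cdot>\<^bsub>C\<^esub> f = Ident C (Dom C f) \<and> f \<cdot>\<^bsub>C\<^esub> g = Ident C (Cod C f)"

definition is_iso :: "('o, 'm, 'z) category_scheme \<Rightarrow> 'm \<Rightarrow> bool" where
  "is_iso C f \<longleftrightarrow> (\<exists>g. inverse_arrows C f g)"

definition inv_arr :: "('o, 'm, 'z) category_scheme \<Rightarrow> 'm \<Rightarrow> 'm" where
  "inv_arr C f = (THE g. inverse_arrows C f g)"

definition is_zero_obj :: "('o, 'm, 'z) category_scheme \<Rightarrow> 'o \<Rightarrow> bool" where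
  "is_zero_obj C z \<longleftrightarrow> z \<in> Obj C \<and>
     (\<forall>x\<in>Obj C. (\<exists>!f. f \<in> Hom C z x) \<and> (\<exists>!f. f \<in> Hom C x z))"

definition is_product ::
  "('o, 'm, 'z) category_scheme \<Rightarrow> 'i set \<Rightarrow> ('i \<Rightarrow> 'o) \<Rightarrow> 'o \<Rightarrow> ('i \<Rightarrow> 'm) \<Rightarrow> bool" where
  "is_product C I X P pr \<longleftrightarrow> P \<in> Obj C \<and> (\<forall>i\<in>I. pr i \<in> Hom C P (X i)) \<and>
     (\<forall>T\<in>Obj C. \<forall>t. (\<forall>i\<in>I. t i \<in> Hom C T (X i)) \<longrightarrow>
        (\<exists>!u. u \<in> Hom C T P \<and> (\<forall>i\<in>I. pr i \<cdot>\<^bsub>C\<^esub> u = t i)))"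

definition is_coequaliser ::
  "('o, 'm, 'z) category_scheme \<Rightarrow> 'm \<Rightarrow> 'm \<Rightarrow> 'm \<Rightarrow> bool" where
  "is_coequaliser C f g q \<longleftrightarrow>
     f \<in> Arr C \<and> g \<in> Hom C (Dom C f) (Cod C f) \<and> q \<in> Arr C \<and> Dom C q = Cod C f \<and>
     q \<cdot>\<^bsub>C\<^esub> f = q \<cdot>\<^bsub>C\<^esub> g \<and>
     (\<forall>t\<in>Arr C. Dom C t = Cod C f \<and> t \<cdot>\<^bsub>C\<^esub> f = t \<cdot>\<^bsub>C\<^esub> g \<longrightarrow>
        (\<exists>!u. u \<in> Hom C (Cod C q) (Cod C t) \<and> u \<cdot>\<^bsub>C\<^esub> q = t))"

text \<open>The factorisation of an arrow \<open>w\<close> through an epimorphism \<open>q\<close> with the same domain.\<close>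

definition factor :: "('o, 'm, 'z) category_scheme \<Rightarrow> 'm \<Rightarrow> 'm \<Rightarrow> 'm" where
  "factor C q w = (THE t. t \<in> Hom C (Cod C q) (Cod C w) \<and> t \<cdot>\<^bsub>C\<^esub> q = w)"

definition idempotent_complete :: "('o, 'm, 'z) category_scheme \<Rightarrow> bool" where
  "idempotent_complete C \<longleftrightarrow> (\<forall>x\<in>Obj C. \<forall>e\<in>Hom C x x. e \<cdot>\<^bsub>C\<^esub> e = e \<longrightarrow>
     (\<exists>y\<in>Obj C. \<exists>r\<in>Hom C x y. \<exists>s\<in>Hom C y x. s \<cdot>\<^bsub>C\<^esub> r = e \<and> r \<cdot>\<^bsub>C\<^esub> s = Ident C y))"

record ('o, 'm, 'p, 'n) funct =
  FObj :: "'o \<Rightarrow> 'p"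
  FArr :: "'m \<Rightarrow> 'n"

definition is_functor ::
  "('o, 'm, 'z) category_scheme \<Rightarrow> ('p, 'n, 'y) category_scheme \<Rightarrow>
     ('o, 'm, 'p, 'n) funct \<Rightarrow> bool" where
  "is_functor C D F \<longleftrightarrow>
     (\<forall>x\<in>Obj C. FObj F x \<in> Obj D \<and> FArr F (Ident C x) = Ident D (FObj F x)) \<and>
     (\<forall>f\<in>Arr C. FArr F f \<in> Hom D (FObj F (Dom C f)) (FObj F (Cod C f))) \<and>
     (\<forall>f\<in>Arr C. \<forall>g\<in>Arr C. Dom C g = Cod C f \<longrightarrow>
        FArr F (g \<cdot>\<^bsub>C\<^esub> f) = FArr F g \<cdot>\<^bsub>D\<^esub> FArr F f)"

definition is_equivalence ::
  "('o, 'm, 'z) category_scheme \<Rightarrow> ('p, 'n, 'y) category_scheme \<Rightarrow>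
     ('o, 'm, 'p, 'n) funct \<Rightarrow> bool" where
  "is_equivalence C D F \<longleftrightarrow> is_functor C D F \<and>
     (\<forall>x\<in>Obj C. \<forall>y\<in>Obj C. bij_betw (FArr F) (Hom C x y) (Hom D (FObj F x) (FObj F y))) \<and>
     (\<forall>z\<in>Obj D. \<exists>x\<in>Obj C. \<exists>f\<in>Hom D (FObj F x) z. is_iso D f)"


section \<open>Additive categories\<close>

record ('o, 'm) additive = "('o, 'm) category" +
  Add :: "'m \<Rightarrow> 'm \<Rightarrow> 'm"
  ZeroArr :: "'o \<Rightarrow> 'o \<Rightarrow> 'm"

definition hom_group :: "('o, 'm, 'z) additive_scheme \<Rightarrow> 'o \<Rightarrow> 'o \<Rightarrow> 'm monoid" where
  "hom_group C x y = \<lparr>carrier = Hom C x y, mult = Add C, one = ZeroArr C x y\<rparr>"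

definition neg_arr :: "('o, 'm, 'z) additive_scheme \<Rightarrow> 'm \<Rightarrow> 'm" where
  "neg_arr C f = m_inv (hom_group C (Dom C f) (Cod C f)) f"

definition is_biproduct ::
  "('o, 'm, 'z) additive_scheme \<Rightarrow> 'o \<Rightarrow> 'o \<Rightarrow> 'o \<Rightarrow> bool" where
  "is_biproduct C x y z \<longleftrightarrow> x \<in> Obj C \<and> y \<in> Obj C \<and> z \<in> Obj C \<and>
     (\<exists>i\<in>Hom C x z. \<exists>j\<in>Hom C y z. \<exists>p\<in>Hom C z x. \<exists>q\<in>Hom C z y.
        p \<cdot>\<^bsub>C\<^esub> i = Ident C x \<and> q \<cdot>\<^bsub>C\<^esub> j = Ident C y \<and>
        p \<cdot>\<^bsub>C\<^esub> j = ZeroArr C y x \<and> q \<cdot>\<^bsub>C\<^esub> i = ZeroArr C x y \<and>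
        Add C (i \<cdot>\<^bsub>C\<^esub> p) (j \<cdot>\<^bsub>C\<^esub> q) = Ident C z)"

locale additive_category = category C
  for C :: "('o, 'm, 'z) additive_scheme" (structure) +
  assumes hom_comm_group: "\<lbrakk>x \<in> Obj C; y \<in> Obj C\<rbrakk> \<Longrightarrow> comm_group (hom_group C x y)"
    and Comp_Add_right: "\<lbrakk>f \<in> Hom C x y; f' \<in> Hom C x y; g \<in> Hom C y z\<rbrakk>
      \<Longrightarrow> g \<cdot> Add C f f' = Add C (g \<cdot> f) (g \<cdot> f')"
    and Comp_Add_left: "\<lbrakk>f \<in> Hom C x y; g \<in> Hom C y z; g' \<in> Hom C y z\<rbrakk>
      \<Longrightarrow> Add C g g' \<cdot> f = Add C (g \<cdot> f) (g' \<cdot> f)"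
    and zero_obj_exists: "\<exists>z. is_zero_obj C z"
    and biproduct_exists: "\<lbrakk>x \<in> Obj C; y \<in> Obj C\<rbrakk> \<Longrightarrow> \<exists>z. is_biproduct C x y z"

definition additive_functor ::
  "('o, 'm, 'z) additive_scheme \<Rightarrow> ('p, 'n, 'y) additive_scheme \<Rightarrow>
     ('o, 'm, 'p, 'n) funct \<Rightarrow> bool" where
  "additive_functor C D F \<longleftrightarrow> is_functor C D F \<and>
     (\<forall>x\<in>Obj C. \<forall>y\<in>Obj C. \<forall>f\<in>Hom C x y. \<forall>g\<in>Hom C x y.
        FArr F (Add C f g) = Add D (FArr F f) (FArr F g))"


section \<open>Triangulated categories\<close>

text \<open>A triple \<open>(f, g, h)\<close> in \<open>Tri\<close> is an exact triangle \<open>x \<rightarrow> y \<rightarrow> z \<rightarrow> \<Sigma>x\<close>.\<close>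

record ('o, 'm) triang = "('o, 'm) additive" +
  Susp :: "('o, 'm, 'o, 'm) funct"
  Tri :: "('m \<times> 'm \<times> 'm) set"

abbreviation SuspO :: "('o, 'm, 'z) triang_scheme \<Rightarrow> 'o \<Rightarrow> 'o" where
  "SuspO C \<equiv> FObj (Susp C)"

abbreviation SuspA :: "('o, 'm, 'z) triang_scheme \<Rightarrow> 'm \<Rightarrow> 'm" where
  "SuspA C \<equiv> FArr (Susp C)"

definition is_triangle ::
  "('o, 'm, 'z) triang_scheme \<Rightarrow> 'o \<Rightarrow> 'o \<Rightarrow> 'o \<Rightarrow> 'm \<Rightarrow> 'm \<Rightarrow> 'm \<Rightarrow> bool" where
  "is_triangle C x y z f g h \<longleftrightarrow>
     x \<in> Obj C \<and> y \<in> Obj C \<and> z \<in> Obj C \<and>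
     f \<in> Hom C x y \<and> g \<in> Hom C y z \<and> h \<in> Hom C z (SuspO C x)"

definition is_exact_triangle ::
  "('o, 'm, 'z) triang_scheme \<Rightarrow> 'o \<Rightarrow> 'o \<Rightarrow> 'o \<Rightarrow> 'm \<Rightarrow> 'm \<Rightarrow> 'm \<Rightarrow> bool" where
  "is_exact_triangle C x y z f g h \<longleftrightarrow> is_triangle C x y z f g h \<and> (f, g, h) \<in> Tri C"

locale triangulated_category = additive_category C
  for C :: "('o, 'm, 'z) triang_scheme" (structure) +
  assumes Susp_equivalence: "is_equivalence C C (Susp C)"
    and Susp_additive: "additive_functor C C (Susp C)"
    and Tri_triangle: "(f, g, h) \<in> Tri C \<Longrightarrow> \<exists>x y z. is_triangle C x y z f g h"
    and TR1_iso: "\<lbrakk>is_exact_triangle C x y z f g h; is_triangle C x' y' z' f' g' h';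
        a \<in> Hom C x x'; b \<in> Hom C y y'; c \<in> Hom C z z';
        is_iso C a; is_iso C b; is_iso C c;
        b \<cdot> f = f' \<cdot> a; c \<cdot> g = g' \<cdot> b; SuspA C a \<cdot> h = h' \<cdot> c\<rbrakk> \<Longrightarrow> (f', g', h') \<in> Tri C"
    and TR1_id: "\<lbrakk>x \<in> Obj C; is_zero_obj C z\<rbrakk>
        \<Longrightarrow> (Ident C x, ZeroArr C x z, ZeroArr C z (SuspO C x)) \<in> Tri C"
    and TR1_cone: "f \<in> Hom C x y \<Longrightarrow> \<exists>z g h. is_exact_triangle C x y z f g h"
    and TR2: "is_triangle C x y z f g h
        \<Longrightarrow> (f, g, h) \<in> Tri C \<longleftrightarrow> (g, h, neg_arr C (SuspA C f)) \<in> Tri C"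
    and TR3: "\<lbrakk>is_exact_triangle C x y z f g h; is_exact_triangle C x' y' z' f' g' h';
        a \<in> Hom C x x'; b \<in> Hom C y y'; b \<cdot> f = f' \<cdot> a\<rbrakk>
        \<Longrightarrow> \<exists>c\<in>Hom C z z'. c \<cdot> g = g' \<cdot> b \<and> SuspA C a \<cdot> h = h' \<cdot> c"
    and TR4: "\<lbrakk>is_exact_triangle C x y u f f1 f2; is_exact_triangle C y z w g g1 g2;
        is_exact_triangle C x z v (g \<cdot> f) k1 k2\<rbrakk>
        \<Longrightarrow> \<exists>a\<in>Hom C u v. \<exists>b\<in>Hom C v w.
              is_exact_triangle C u v w a b (SuspA C f1 \<cdot> g2) \<and>
              a \<cdot> f1 = k1 \<cdot> g \<and> k2 \<cdot> a = f2 \<and> b \<cdot> k1 = g1 \<and> g2 \<cdot> b = SuspA C f \<cdot> k2"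

text \<open>\<open>F\<close> is exact via the comparison isomorphism \<open>e x : F (\<Sigma> x) \<rightarrow> \<Sigma> (F x)\<close>.\<close>

definition exact_functor ::
  "('o, 'm, 'z) triang_scheme \<Rightarrow> ('p, 'n, 'y) triang_scheme \<Rightarrow>
     ('o, 'm, 'p, 'n) funct \<Rightarrow> ('o \<Rightarrow> 'n) \<Rightarrow> bool" where
  "exact_functor C D F e \<longleftrightarrow> additive_functor C D F \<and>
     (\<forall>x\<in>Obj C. e x \<in> Hom D (FObj F (SuspO C x)) (SuspO D (FObj F x)) \<and> is_iso D (e x)) \<and>
     (\<forall>f\<in>Arr C. SuspA D (FArr F f) \<cdot>\<^bsub>D\<^esub> e (Dom C f) = e (Cod C f) \<cdot>\<^bsub>D\<^esub> FArr F (SuspA C f)) \<and>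
     (\<forall>(f, g, h)\<in>Tri C. (FArr F f, FArr F g, e (Dom C f) \<cdot>\<^bsub>D\<^esub> FArr F h) \<in> Tri D)"


section \<open>tt-categories\<close>

text \<open>The fields \<open>Assoc x y z : (x \<otimes> y) \<otimes> z \<rightarrow> x \<otimes> (y \<otimes> z)\<close>, \<open>LUnit x : 1 \<otimes> x \<rightarrow> x\<close>,
  \<open>RUnit x : x \<otimes> 1 \<rightarrow> x\<close> and \<open>Braid x y : x \<otimes> y \<rightarrow> y \<otimes> x\<close> are the coherence isomorphisms, and
  \<open>TenSusp x y : x \<otimes> \<Sigma>y \<rightarrow> \<Sigma>(x \<otimes> y)\<close> is the isomorphism through which \<open>x \<otimes> -\<close> is exact.\<close>

record ('o, 'm) tt = "('o, 'm) triang" +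
  TenO :: "'o \<Rightarrow> 'o \<Rightarrow> 'o" (infixr "\<boxtimes>\<index>" 75)
  TenA :: "'m \<Rightarrow> 'm \<Rightarrow> 'm" (infixr "\<odot>\<index>" 75)
  UnitO :: "'o"
  Assoc :: "'o \<Rightarrow> 'o \<Rightarrow> 'o \<Rightarrow> 'm"
  LUnit :: "'o \<Rightarrow> 'm"
  RUnit :: "'o \<Rightarrow> 'm"
  Braid :: "'o \<Rightarrow> 'o \<Rightarrow> 'm"
  TenSusp :: "'o \<Rightarrow> 'o \<Rightarrow> 'm"

definition iso_between :: "('o, 'm, 'z) category_scheme \<Rightarrow> 'm \<Rightarrow> 'o \<Rightarrow> 'o \<Rightarrow> bool" where
  "iso_between C f x y \<longleftrightarrow> f \<in> Hom C x y \<and> is_iso C f"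

locale symmetric_monoidal_category = category C
  for C :: "('o, 'm, 'z) tt_scheme" (structure) +
  assumes TenO_Obj: "\<lbrakk>x \<in> Obj C; y \<in> Obj C\<rbrakk> \<Longrightarrow> x \<boxtimes> y \<in> Obj C"
    and UnitO_Obj: "UnitO C \<in> Obj C"
    and TenA_Hom: "\<lbrakk>f \<in> Hom C x x'; g \<in> Hom C y y'\<rbrakk> \<Longrightarrow> f \<odot> g \<in> Hom C (x \<boxtimes> y) (x' \<boxtimes> y')"
    and TenA_Ident: "\<lbrakk>x \<in> Obj C; y \<in> Obj C\<rbrakk> \<Longrightarrow> Ident C x \<odot> Ident C y = Ident C (x \<boxtimes> y)"
    and TenA_Comp: "\<lbrakk>f \<in> Hom C x x'; f' \<in> Hom C x' x''; g \<in> Hom C y y'; g' \<in> Hom C y' y''\<rbrakk>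
        \<Longrightarrow> (f' \<cdot> f) \<odot> (g' \<cdot> g) = (f' \<odot> g') \<cdot> (f \<odot> g)"
    and Assoc_iso: "\<lbrakk>x \<in> Obj C; y \<in> Obj C; z \<in> Obj C\<rbrakk>
        \<Longrightarrow> iso_between C (Assoc C x y z) ((x \<boxtimes> y) \<boxtimes> z) (x \<boxtimes> (y \<boxtimes> z))"
    and LUnit_iso: "x \<in> Obj C \<Longrightarrow> iso_between C (LUnit C x) (UnitO C \<boxtimes> x) x"
    and RUnit_iso: "x \<in> Obj C \<Longrightarrow> iso_between C (RUnit C x) (x \<boxtimes> UnitO C) x"
    and Braid_iso: "\<lbrakk>x \<in> Obj C; y \<in> Obj C\<rbrakk>
        \<Longrightarrow> iso_between C (Braid C x y) (x \<boxtimes> y) (y \<boxtimes> x)"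
    and Assoc_natural: "\<lbrakk>f \<in> Hom C x x'; g \<in> Hom C y y'; h \<in> Hom C z z'\<rbrakk>
        \<Longrightarrow> Assoc C x' y' z' \<cdot> ((f \<odot> g) \<odot> h) = (f \<odot> (g \<odot> h)) \<cdot> Assoc C x y z"
    and LUnit_natural: "f \<in> Hom C x x'
        \<Longrightarrow> LUnit C x' \<cdot> (Ident C (UnitO C) \<odot> f) = f \<cdot> LUnit C x"
    and RUnit_natural: "f \<in> Hom C x x'
        \<Longrightarrow> RUnit C x' \<cdot> (f \<odot> Ident C (UnitO C)) = f \<cdot> RUnit C x"
    and Braid_natural: "\<lbrakk>f \<in> Hom C x x'; g \<in> Hom C y y'\<rbrakk>
        \<Longrightarrow> Braid C x' y' \<cdot> (f \<odot> g) = (g \<odot> f) \<cdot> Braid C x y"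
    and pentagon: "\<lbrakk>w \<in> Obj C; x \<in> Obj C; y \<in> Obj C; z \<in> Obj C\<rbrakk>
        \<Longrightarrow> Assoc C w x (y \<boxtimes> z) \<cdot> Assoc C (w \<boxtimes> x) y z =
            (Ident C w \<odot> Assoc C x y z) \<cdot> Assoc C w (x \<boxtimes> y) z \<cdot> (Assoc C w x y \<odot> Ident C z)"
    and unit_triangle: "\<lbrakk>x \<in> Obj C; y \<in> Obj C\<rbrakk>
        \<Longrightarrow> (Ident C x \<odot> LUnit C y) \<cdot> Assoc C x (UnitO C) y = RUnit C x \<odot> Ident C y"
    and hexagon: "\<lbrakk>x \<in> Obj C; y \<in> Obj C; z \<in> Obj C\<rbrakk>
        \<Longrightarrow> Assoc C y z x \<cdot> Braid C x (y \<boxtimes> z) \<cdot> Assoc C x y z =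
            (Ident C y \<odot> Braid C x z) \<cdot> Assoc C y x z \<cdot> (Braid C x y \<odot> Ident C z)"
    and symmetry: "\<lbrakk>x \<in> Obj C; y \<in> Obj C\<rbrakk>
        \<Longrightarrow> Braid C y x \<cdot> Braid C x y = Ident C (x \<boxtimes> y)"

definition ten_functor :: "('o, 'm, 'z) tt_scheme \<Rightarrow> 'o \<Rightarrow> ('o, 'm, 'o, 'm) funct" where
  "ten_functor C x = \<lparr>FObj = (\<lambda>y. x \<boxtimes>\<^bsub>C\<^esub> y), FArr = (\<lambda>f. Ident C x \<odot>\<^bsub>C\<^esub> f)\<rparr>"

text \<open>The last three axioms are the usual compatibility of the exactness isomorphisms with the
  monoidal structure. Without them the suspension of an \<open>A\<close>-module need not be an \<open>A\<close>-module.\<close>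

locale tt_category = triangulated_category C + symmetric_monoidal_category C
  for C :: "('o, 'm, 'z) tt_scheme" (structure) +
  assumes idempotent_complete: "idempotent_complete C"
    and ten_exact: "x \<in> Obj C \<Longrightarrow> exact_functor C C (ten_functor C x) (TenSusp C x)"
    and TenSusp_natural: "\<lbrakk>f \<in> Hom C x x'; y \<in> Obj C\<rbrakk>
        \<Longrightarrow> SuspA C (f \<odot> Ident C y) \<cdot> TenSusp C x y = TenSusp C x' y \<cdot> (f \<odot> Ident C (SuspO C y))"
    and TenSusp_unit: "y \<in> Obj C
        \<Longrightarrow> SuspA C (LUnit C y) \<cdot> TenSusp C (UnitO C) y = LUnit C (SuspO C y)"
    and TenSusp_assoc: "\<lbrakk>x \<in> Obj C; y \<in> Obj C; z \<in> Obj C\<rbrakk>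
        \<Longrightarrow> SuspA C (Assoc C x y z) \<cdot> TenSusp C (x \<boxtimes> y) z =
            TenSusp C x (y \<boxtimes> z) \<cdot> (Ident C x \<odot> TenSusp C y z) \<cdot> Assoc C x y (SuspO C z)"


section \<open>The spectrum\<close>

definition triangulated_subcat :: "('o, 'm, 'z) triang_scheme \<Rightarrow> 'o set \<Rightarrow> bool" where
  "triangulated_subcat C J \<longleftrightarrow> J \<subseteq> Obj C \<and> {z. is_zero_obj C z} \<subseteq> J \<and>
     (\<forall>x\<in>Obj C. SuspO C x \<in> J \<longleftrightarrow> x \<in> J) \<and>
     (\<forall>x y z f g h. is_exact_triangle C x y z f g h \<longrightarrow>
        (x \<in> J \<and> y \<in> J \<longrightarrow> z \<in> J) \<and> (y \<in> J \<and> z \<in> J \<longrightarrow> x \<in> J) \<and> (x \<in> J \<and> z \<in> J \<longrightarrow> y \<in> J))"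

definition thick :: "('o, 'm, 'z) triang_scheme \<Rightarrow> 'o set \<Rightarrow> bool" where
  "thick C J \<longleftrightarrow> triangulated_subcat C J \<and>
     (\<forall>x y z. is_biproduct C x y z \<and> z \<in> J \<longrightarrow> x \<in> J \<and> y \<in> J)"

definition thick_ideal :: "('o, 'm, 'z) tt_scheme \<Rightarrow> 'o set \<Rightarrow> bool" where
  "thick_ideal C J \<longleftrightarrow> thick C J \<and> (\<forall>x\<in>Obj C. \<forall>y\<in>J. x \<boxtimes>\<^bsub>C\<^esub> y \<in> J)"

definition primes :: "('o, 'm, 'z) tt_scheme \<Rightarrow> 'o set set" where
  "primes C = {P. thick_ideal C P \<and> P \<noteq> Obj C \<and>
     (\<forall>x\<in>Obj C. \<forall>y\<in>Obj C. x \<boxtimes>\<^bsub>C\<^esub> y \<in> P \<longrightarrow> x \<in> P \<or> y \<in> P)}"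

definition supp :: "('o, 'm, 'z) tt_scheme \<Rightarrow> 'o \<Rightarrow> 'o set set" where
  "supp C x = {P \<in> primes C. x \<notin> P}"

text \<open>The complements of supports are closed under finite intersection, by
  \<open>supp 0 = {}\<close> and \<open>supp (x \<oplus> y) = supp x \<union> supp y\<close>, so they form a basis of the topology
  that they generate.\<close>

definition Spc :: "('o, 'm, 'z) tt_scheme \<Rightarrow> 'o set topology" where
  "Spc C = topology_generated_by {primes C - supp C x | x. x \<in> Obj C}"

definition Spc_map ::
  "('o, 'm, 'z) tt_scheme \<Rightarrow> ('o, 'm, 'p, 'n) funct \<Rightarrow> 'p set \<Rightarrow> 'o set" where
  "Spc_map C F Q = {x \<in> Obj C. FObj F x \<in> Q}"


section \<open>Rings\<close>

record ('o, 'm) ring_obj =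
  RObj :: "'o"
  RMul :: "'m"
  ROne :: "'m"

definition is_ring :: "('o, 'm, 'z) tt_scheme \<Rightarrow> ('o, 'm) ring_obj \<Rightarrow> bool" where
  "is_ring K A \<longleftrightarrow> (let a = RObj A; \<mu> = RMul A; \<eta> = ROne A; i = Ident K a in
     a \<in> Obj K \<and> \<mu> \<in> Hom K (a \<boxtimes>\<^bsub>K\<^esub> a) a \<and> \<eta> \<in> Hom K (UnitO K) a \<and>
     \<mu> \<cdot>\<^bsub>K\<^esub> (\<mu> \<odot>\<^bsub>K\<^esub> i) = \<mu> \<cdot>\<^bsub>K\<^esub> (i \<odot>\<^bsub>K\<^esub> \<mu>) \<cdot>\<^bsub>K\<^esub> Assoc K a a a \<and>
     \<mu> \<cdot>\<^bsub>K\<^esub> (\<eta> \<odot>\<^bsub>K\<^esub> i) = LUnit K a \<and> \<mu> \<cdot>\<^bsub>K\<^esub> (i \<odot>\<^bsub>K\<^esub> \<eta>) = RUnit K a \<and>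
     \<mu> \<cdot>\<^bsub>K\<^esub> Braid K a a = \<mu>)"

definition is_ring_hom ::
  "('o, 'm, 'z) tt_scheme \<Rightarrow> ('o, 'm) ring_obj \<Rightarrow> ('o, 'm) ring_obj \<Rightarrow> 'm \<Rightarrow> bool" where
  "is_ring_hom K A B h \<longleftrightarrow> h \<in> Hom K (RObj A) (RObj B) \<and>
     h \<cdot>\<^bsub>K\<^esub> RMul A = RMul B \<cdot>\<^bsub>K\<^esub> (h \<odot>\<^bsub>K\<^esub> h) \<and> h \<cdot>\<^bsub>K\<^esub> ROne A = ROne B"

definition ring_aut :: "('o, 'm, 'z) tt_scheme \<Rightarrow> ('o, 'm) ring_obj \<Rightarrow> 'm monoid" where
  "ring_aut K A = \<lparr>carrier = {h. is_ring_hom K A A h \<and> is_iso K h},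
     mult = Comp K, one = Ident K (RObj A)\<rparr>"

definition quasi_Galois ::
  "('o, 'm, 'z) tt_scheme \<Rightarrow> ('o, 'm) ring_obj \<Rightarrow> 'm set \<Rightarrow> bool" where
  "quasi_Galois K A \<Gamma> \<longleftrightarrow>
     is_ring K A \<and> \<not> is_zero_obj K (RObj A) \<and> finite \<Gamma> \<and> subgroup \<Gamma> (ring_aut K A) \<and>
     (\<exists>P pr lam. is_product K \<Gamma> (\<lambda>_. RObj A) P pr \<and>
        lam \<in> Hom K (RObj A \<boxtimes>\<^bsub>K\<^esub> RObj A) P \<and>
        (\<forall>\<gamma>\<in>\<Gamma>. pr \<gamma> \<cdot>\<^bsub>K\<^esub> lam = RMul A \<cdot>\<^bsub>K\<^esub> (Ident K (RObj A) \<odot>\<^bsub>K\<^esub> \<gamma>)) \<and>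
        is_iso K lam)"


section \<open>Modules\<close>

text \<open>A left module is a pair of its underlying object and its action map; an arrow of modules
  is a triple of domain, underlying arrow and codomain.\<close>

type_synonym ('o, 'm) modl = "'o \<times> 'm"
type_synonym ('o, 'm) modl_arr = "('o, 'm) modl \<times> 'm \<times> ('o, 'm) modl"

definition is_module ::
  "('o, 'm, 'z) tt_scheme \<Rightarrow> ('o, 'm) ring_obj \<Rightarrow> ('o, 'm) modl \<Rightarrow> bool" where
  "is_module K A M \<longleftrightarrow> (let a = RObj A; x = fst M; \<rho> = snd M in
     x \<in> Obj K \<and> \<rho> \<in> Hom K (a \<boxtimes>\<^bsub>K\<^esub> x) x \<and>
     \<rho> \<cdot>\<^bsub>K\<^esub> (RMul A \<odot>\<^bsub>K\<^esub> Ident K x) = \<rho> \<cdot>\<^bsub>K\<^esub> (Ident K a \<odot>\<^bsub>K\<^esub> \<rho>) \<cdot>\<^bsub>K\<^esub> Assoc K a a x \<and>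
     \<rho> \<cdot>\<^bsub>K\<^esub> (ROne A \<odot>\<^bsub>K\<^esub> Ident K x) = LUnit K x)"

definition is_module_arr ::
  "('o, 'm, 'z) tt_scheme \<Rightarrow> ('o, 'm) ring_obj \<Rightarrow> ('o, 'm) modl_arr \<Rightarrow> bool" where
  "is_module_arr K A = (\<lambda>(M, f, N).
     is_module K A M \<and> is_module K A N \<and> f \<in> Hom K (fst M) (fst N) \<and>
     f \<cdot>\<^bsub>K\<^esub> snd M = snd N \<cdot>\<^bsub>K\<^esub> (Ident K (RObj A) \<odot>\<^bsub>K\<^esub> f))"

abbreviation und :: "('o, 'm) modl_arr \<Rightarrow> 'm" where
  "und t \<equiv> fst (snd t)"

text \<open>The (chosen) coequaliser \<open>x \<otimes> y \<rightarrow> x \<otimes>\<^sub>A y\<close> of the two action maps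
  \<open>(x \<otimes> A) \<otimes> y \<rightrightarrows> x \<otimes> y\<close>, the right action of \<open>A\<close> on \<open>x\<close> being the left one composed with
  the symmetry.\<close>

definition ten_proj ::
  "('o, 'm, 'z) tt_scheme \<Rightarrow> ('o, 'm) ring_obj \<Rightarrow> ('o, 'm) modl \<Rightarrow> ('o, 'm) modl \<Rightarrow> 'm" where
  "ten_proj K A M N = (let a = RObj A; x = fst M; y = fst N in
     SOME q. is_coequaliser K
       ((snd M \<cdot>\<^bsub>K\<^esub> Braid K x a) \<odot>\<^bsub>K\<^esub> Ident K y)
       ((Ident K x \<odot>\<^bsub>K\<^esub> snd N) \<cdot>\<^bsub>K\<^esub> Assoc K x a y) q)"

text \<open>Given a coequaliser \<open>q : x \<otimes> y \<rightarrow> z\<close> as above and a further action \<open>l : b \<otimes> x \<rightarrow> x\<close>,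
  the induced action \<open>b \<otimes> z \<rightarrow> z\<close>.\<close>

definition ten_action ::
  "('o, 'm, 'z) tt_scheme \<Rightarrow> 'o \<Rightarrow> 'm \<Rightarrow> 'o \<Rightarrow> 'o \<Rightarrow> 'm \<Rightarrow> 'm" where
  "ten_action K b l x y q =
     factor K (Ident K b \<odot>\<^bsub>K\<^esub> q) (q \<cdot>\<^bsub>K\<^esub> (l \<odot>\<^bsub>K\<^esub> Ident K y) \<cdot>\<^bsub>K\<^esub> inv_arr K (Assoc K b x y))"

definition mod_tenO ::
  "('o, 'm, 'z) tt_scheme \<Rightarrow> ('o, 'm) ring_obj \<Rightarrow>
     ('o, 'm) modl \<Rightarrow> ('o, 'm) modl \<Rightarrow> ('o, 'm) modl" where
  "mod_tenO K A M N = (let q = ten_proj K A M N in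
     (Cod K q, ten_action K (RObj A) (snd M) (fst M) (fst N) q))"

definition mod_tenA ::
  "('o, 'm, 'z) tt_scheme \<Rightarrow> ('o, 'm) ring_obj \<Rightarrow>
     ('o, 'm) modl_arr \<Rightarrow> ('o, 'm) modl_arr \<Rightarrow> ('o, 'm) modl_arr" where
  "mod_tenA K A = (\<lambda>(M, f, M') (N, g, N').
     (mod_tenO K A M N,
      factor K (ten_proj K A M N) (ten_proj K A M' N' \<cdot>\<^bsub>K\<^esub> (f \<odot>\<^bsub>K\<^esub> g)),
      mod_tenO K A M' N'))"

definition mod_susp ::
  "('o, 'm, 'z) tt_scheme \<Rightarrow> ('o, 'm) ring_obj \<Rightarrow> ('o, 'm) modl \<Rightarrow> ('o, 'm) modl" where
  "mod_susp K A M = (SuspO K (fst M), SuspA K (snd M) \<cdot>\<^bsub>K\<^esub> TenSusp K (RObj A) (fst M))"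

text \<open>A triangle of modules is exact if and only if its underlying triangle is; this is the
  triangulation for which extension of scalars and the forgetful functor are exact.
  The structure isomorphisms of \<open>\<otimes>\<^sub>A\<close> are those induced by the ones of \<open>\<otimes>\<close>.\<close>

definition ModCat ::
  "('o, 'm, 'z) tt_scheme \<Rightarrow> ('o, 'm) ring_obj \<Rightarrow> (('o, 'm) modl, ('o, 'm) modl_arr) tt" where
  "ModCat K A = \<lparr>
     Obj = {M. is_module K A M},
     Arr = {t. is_module_arr K A t},
     Dom = fst,
     Cod = (\<lambda>t. snd (snd t)),
     Ident = (\<lambda>M. (M, Ident K (fst M), M)),
     Comp = (\<lambda>(M', g, N) (M, f, N'). (M, g \<cdot>\<^bsub>K\<^esub> f, N)),
     Add = (\<lambda>(M, f, N) (M', g, N'). (M, Add K f g, N)),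
     ZeroArr = (\<lambda>M N. (M, ZeroArr K (fst M) (fst N), N)),
     Susp = \<lparr>FObj = mod_susp K A,
             FArr = (\<lambda>(M, f, N). (mod_susp K A M, SuspA K f, mod_susp K A N))\<rparr>,
     Tri = {(t, u, v). is_module_arr K A t \<and> is_module_arr K A u \<and> is_module_arr K A v \<and>
              snd (snd t) = fst u \<and> snd (snd u) = fst v \<and>
              snd (snd v) = mod_susp K A (fst t) \<and> (und t, und u, und v) \<in> Tri K},
     TenO = mod_tenO K A,
     TenA = mod_tenA K A,
     UnitO = (RObj A, RMul A),
     Assoc = (\<lambda>M N P. let MN = mod_tenO K A M N; NP = mod_tenO K A N P in
       (mod_tenO K A MN P,
        factor K (ten_proj K A MN P \<cdot>\<^bsub>K\<^esub> (ten_proj K A M N \<odot>\<^bsub>K\<^esub> Ident K (fst P)))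
          (ten_proj K A M NP \<cdot>\<^bsub>K\<^esub> (Ident K (fst M) \<odot>\<^bsub>K\<^esub> ten_proj K A N P) \<cdot>\<^bsub>K\<^esub>
             Assoc K (fst M) (fst N) (fst P)),
        mod_tenO K A M NP)),
     LUnit = (\<lambda>M. let U = (RObj A, RMul A) in
       (mod_tenO K A U M, factor K (ten_proj K A U M) (snd M), M)),
     RUnit = (\<lambda>M. let U = (RObj A, RMul A) in
       (mod_tenO K A M U,
        factor K (ten_proj K A M U) (snd M \<cdot>\<^bsub>K\<^esub> Braid K (fst M) (RObj A)), M)),
     Braid = (\<lambda>M N. (mod_tenO K A M N,
        factor K (ten_proj K A M N) (ten_proj K A N M \<cdot>\<^bsub>K\<^esub> Braid K (fst M) (fst N)),
        mod_tenO K A N M)),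
     TenSusp = (\<lambda>M N. (mod_tenO K A M (mod_susp K A N),
        factor K (ten_proj K A M (mod_susp K A N))
          (SuspA K (ten_proj K A M N) \<cdot>\<^bsub>K\<^esub> TenSusp K (fst M) (fst N)),
        mod_susp K A (mod_tenO K A M N)))\<rparr>"

definition restrict_scalars ::
  "('o, 'm, 'z) tt_scheme \<Rightarrow> ('o, 'm) ring_obj \<Rightarrow> 'm \<Rightarrow> ('o, 'm) modl" where
  "restrict_scalars K B h = (RObj B, RMul B \<cdot>\<^bsub>K\<^esub> (h \<odot>\<^bsub>K\<^esub> Ident K (RObj B)))"

text \<open>The functor \<open>F\<^sub>h : A-Mod \<rightarrow> B-Mod\<close>, \<open>M \<mapsto> B \<otimes>\<^sub>A M\<close>, for a ring morphism \<open>h : A \<rightarrow> B\<close>: the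
  tensor product over \<open>A\<close> uses \<open>B\<close> as an \<open>A\<close>-module via \<open>h\<close>, while \<open>B\<close> acts on the result
  through its own multiplication.\<close>

definition ext_scalars ::
  "('o, 'm, 'z) tt_scheme \<Rightarrow> ('o, 'm) ring_obj \<Rightarrow> ('o, 'm) ring_obj \<Rightarrow> 'm \<Rightarrow>
     (('o, 'm) modl, ('o, 'm) modl_arr, ('o, 'm) modl, ('o, 'm) modl_arr) funct" where
  "ext_scalars K A B h = (let b = RObj B; Bh = restrict_scalars K B h;
       q = (\<lambda>M. ten_proj K A Bh M);
       F = (\<lambda>M. (Cod K (q M), ten_action K b (RMul B) b (fst M) (q M))) in
     \<lparr>FObj = F,
      FArr = (\<lambda>(M, f, N). (F M, factor K (q M) (q N \<cdot>\<^bsub>K\<^esub> (Ident K b \<odot>\<^bsub>K\<^esub> f)), F N))\<rparr>)"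


section \<open>The orbit space\<close>

definition quotient_topology :: "'a topology \<Rightarrow> ('a \<Rightarrow> 'b) \<Rightarrow> 'b topology" where
  "quotient_topology X q =
     topology (\<lambda>U. U \<subseteq> q ` topspace X \<and> openin X {x \<in> topspace X. q x \<in> U})"

lemma openin_quotient_topology:
  "openin (quotient_topology X q) U \<longleftrightarrow>
     U \<subseteq> q ` topspace X \<and> openin X {x \<in> topspace X. q x \<in> U}"
proof -
  have "istopology (\<lambda>U. U \<subseteq> q ` topspace X \<and> openin X {x \<in> topspace X. q x \<in> U})"
    unfolding istopology_def
  proof (intro conjI allI impI)
    fix S T
    assume S: "S \<subseteq> q ` topspace X \<and> openin X {x \<in> topspace X. q x \<in> S}"
      and T: "T \<subseteq> q ` topspace X \<and> openin X {x \<in> topspace X. q x \<in> T}"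
    show "S \<inter> T \<subseteq> q ` topspace X" using S by blast
    have "{x \<in> topspace X. q x \<in> S \<inter> T} = {x \<in> topspace X. q x \<in> S} \<inter> {x \<in> topspace X. q x \<in> T}"
      by blast
    then show "openin X {x \<in> topspace X. q x \<in> S \<inter> T}"
      using S T by (simp only: openin_Int)
  next
    fix \<U>
    assume U: "\<forall>S\<in>\<U>. S \<subseteq> q ` topspace X \<and> openin X {x \<in> topspace X. q x \<in> S}"
    show "\<Union>\<U> \<subseteq> q ` topspace X" using U by blast
    have "{x \<in> topspace X. q x \<in> \<Union>\<U>} = \<Union>((\<lambda>S. {x \<in> topspace X. q x \<in> S}) ` \<U>)"
      by blast
    moreover have "openin X (\<Union>((\<lambda>S. {x \<in> topspace X. q x \<in> S}) ` \<U>))"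
      using U by (intro openin_Union) blast
    ultimately show "openin X {x \<in> topspace X. q x \<in> \<Union>\<U>}" by simp
  qed
  then show ?thesis by (simp add: quotient_topology_def)
qed

definition Spc_action ::
  "('o, 'm, 'z) tt_scheme \<Rightarrow> ('o, 'm) ring_obj \<Rightarrow> 'm \<Rightarrow>
     ('o, 'm) modl set \<Rightarrow> ('o, 'm) modl set" where
  "Spc_action K A \<gamma> = Spc_map (ModCat K A) (ext_scalars K A A \<gamma>)"

definition orbit_space ::
  "('o, 'm, 'z) tt_scheme \<Rightarrow> ('o, 'm) ring_obj \<Rightarrow> 'm set \<Rightarrow> ('o, 'm) modl set set topology" where
  "orbit_space K A \<Gamma> = quotient_topology (Spc (ModCat K A))
     (orbit ((ring_aut K A)\<lparr>carrier := \<Gamma>\<rparr>) (Spc_action K A))"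

end

theory Submission
  imports Defs "HOL-Algebra.FiniteProduct"
begin

text \<open>Let \<open>V\<close> be the forgetful functor and \<open>F\<close> extension of scalars,
  inducing \<open>\<phi>\<close> on spectra. Since \<open>A \<otimes> A\<close> is a product of copies of
  \<open>A\<close>, the ring is separable, every module is a retract of a free one, and \<open>F V x\<close>
  is the direct sum of the twists \<open>x\<^sup>\<gamma>\<close>; by separability
  \<open>\<otimes>\<^sub>A\<close> is a retract of \<open>\<otimes>\<close>, hence preserves exact triangles.
  So \<open>V x \<in> \<phi> Q\<close> if and only if \<open>x\<close> lies in all translates of
  \<open>Q\<close> under the group. If \<open>\<phi> Q = \<phi> Q'\<close>, the two intersections of
  translates agree, and as there are finitely many translates \<open>Q'\<close> contains a translate of
  \<open>Q\<close> and vice versa, whence \<open>Q\<close> and \<open>Q'\<close> are conjugate. Over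
  \<open>P\<close> in the support of \<open>A\<close> there is a prime by Zorn's lemma, applied to the ideals
  containing \<open>V\<^sup>-\<^sup>1 P\<close> and no \<open>F y\<close> with \<open>y \<notin> P\<close>.
  Finally, if an invariant open set contains \<open>Q\<close>, then tensor products over the group of modules
  cutting out neighbourhoods of the translates of \<open>Q\<close> descend along \<open>V\<close> to objects
  cutting out a neighbourhood of \<open>\<phi> Q\<close>, so \<open>\<phi>\<close> is a quotient map.\<close>

section \<open>Calculus of arrows\<close>

text \<open>The obstacle is that \<open>\<otimes>\<^sub>A\<close> is built from coequalisers picked
  by \<open>SOME\<close>, and that nothing about \<open>ModCat\<close> is given in advance. Only a
  fragment of its structure is established: it is preadditive with a zero object, idempotents split,
  and the split triangles and the triangles \<open>x -> 0 -> \<Sigma>x\<close> are exact. Statements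
  on \<open>\<otimes>\<^sub>A\<close> are made up to linear isomorphism (\<open>miso\<close>), to
  which thick subcategories are insensitive. The bimodule section of the multiplication is the
  inclusion of the component of \<open>A \<otimes> A\<close> at the identity of the group. For
  modules \<open>M\<close> and \<open>N\<close> it yields an idempotent \<open>te\<close> of
  \<open>M \<otimes> N\<close>, and every coequaliser that could have been picked splits this
  idempotent. Assertions on \<open>\<otimes>\<^sub>A\<close> thereby become identities between
  composites in the base category, checked after precomposition with a split epimorphism. Extension
  of scalars along \<open>\<gamma>\<close> is isomorphic to the twist by the inverse of
  \<open>\<gamma>\<close>. A twist leaves underlying objects and arrows alone, so the group action
  on primes can be computed without \<open>\<otimes>\<^sub>A\<close>.\<close>

declare Hom_def [simp]

context category
begin

lemma Dom_in_Obj [simp]: "f \<in> Arr C \<Longrightarrow> Dom C f \<in> Obj C"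
  by (rule Dom_Obj)

lemma Cod_in_Obj [simp]: "f \<in> Arr C \<Longrightarrow> Cod C f \<in> Obj C"
  by (rule Cod_Obj)

lemma Ident_simps [simp]:
  assumes "x \<in> Obj C"
  shows "Ident C x \<in> Arr C" "Dom C (Ident C x) = x" "Cod C (Ident C x) = x"
  using Ident_Hom[OF assms] by auto

lemma Comp_simps [simp]:
  assumes "f \<in> Arr C" "g \<in> Arr C" "Dom C g = Cod C f"
  shows "g \<cdot> f \<in> Arr C" "Dom C (g \<cdot> f) = Dom C f" "Cod C (g \<cdot> f) = Cod C g"
  using Comp_Hom[of f "Dom C f" "Cod C f" g "Cod C g"] assms by auto

lemma comp_assoc:
  "\<lbrakk>f \<in> Arr C; g \<in> Arr C; h \<in> Arr C; Dom C g = Cod C f; Dom C h = Cod C g\<rbrakk>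
    \<Longrightarrow> (h \<cdot> g) \<cdot> f = h \<cdot> (g \<cdot> f)"
  using Comp_assoc[of f "Dom C f" "Cod C f" g "Cod C g" h "Cod C h"] by auto

lemma Ident_comp [simp]: "\<lbrakk>f \<in> Arr C; Cod C f = y\<rbrakk> \<Longrightarrow> Ident C y \<cdot> f = f"
  using Ident_left[of f "Dom C f" y] by auto

lemma comp_Ident [simp]: "\<lbrakk>f \<in> Arr C; Dom C f = x\<rbrakk> \<Longrightarrow> f \<cdot> Ident C x = f"
  using Ident_right[of f x "Cod C f"] by auto

lemma comp_reassoc:
  assumes "g \<cdot> f = r" "f \<in> Arr C" "g \<in> Arr C" "k \<in> Arr C" "Dom C g = Cod C f" "Dom C f = Cod C k"
  shows "g \<cdot> (f \<cdot> k) = r \<cdot> k"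
  using assms by (simp flip: comp_assoc)

lemma section_epi:
  assumes "u \<cdot> q = v \<cdot> q" "q \<cdot> s = Ident C y" "s \<in> Arr C" "q \<in> Arr C" "Dom C q = Cod C s"
    "u \<in> Arr C" "v \<in> Arr C" "Dom C u = y" "Dom C v = y" "Cod C q = y"
  shows "u = v"
proof -
  have "u = u \<cdot> (q \<cdot> s)" using assms by simp
  also have "\<dots> = (u \<cdot> q) \<cdot> s" using assms(3-) by (simp add: comp_assoc)
  also have "\<dots> = (v \<cdot> q) \<cdot> s" by (simp add: assms(1))
  also have "\<dots> = v \<cdot> (q \<cdot> s)" using assms(3-) by (simp add: comp_assoc)
  also have "\<dots> = v" using assms by simp
  finally show ?thesis .
qed

lemma retraction_mono:
  assumes "i \<cdot> u = i \<cdot> v" "q \<cdot> i = Ident C y" "i \<in> Arr C" "q \<in> Arr C" "Dom C q = Cod C i"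
    "u \<in> Arr C" "v \<in> Arr C" "Cod C u = y" "Cod C v = y" "Dom C i = y"
  shows "u = v"
proof -
  have "u = (q \<cdot> i) \<cdot> u" using assms by simp
  also have "\<dots> = q \<cdot> (i \<cdot> u)" using assms(3-) by (simp add: comp_assoc)
  also have "\<dots> = q \<cdot> (i \<cdot> v)" by (simp add: assms(1))
  also have "\<dots> = (q \<cdot> i) \<cdot> v" using assms(3-) by (simp add: comp_assoc)
  also have "\<dots> = v" using assms by simp
  finally show ?thesis .
qed

lemma inverse_arrows_unique:
  assumes "inverse_arrows C f g" "inverse_arrows C f h"
  shows "g = h"
proof -
  have "g = g \<cdot> (f \<cdot> h)" using assms by (auto simp: inverse_arrows_def)
  also have "\<dots> = (g \<cdot> f) \<cdot> h"
    by (intro comp_assoc[symmetric]) (use assms in \<open>auto simp: inverse_arrows_def\<close>)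
  also have "\<dots> = h" using assms by (auto simp: inverse_arrows_def)
  finally show ?thesis .
qed

lemma inv_arr_inverse: "is_iso C f \<Longrightarrow> inverse_arrows C f (inv_arr C f)"
  unfolding is_iso_def inv_arr_def by (metis inverse_arrows_unique theI')

lemma inv_arr_simps:
  assumes "is_iso C f"
  shows "inv_arr C f \<in> Arr C" "Dom C (inv_arr C f) = Cod C f" "Cod C (inv_arr C f) = Dom C f"
    "inv_arr C f \<cdot> f = Ident C (Dom C f)" "f \<cdot> inv_arr C f = Ident C (Cod C f)"
  using inv_arr_inverse[OF assms] by (auto simp: inverse_arrows_def)

lemma is_isoI:
  "\<lbrakk>f \<in> Hom C x y; g \<in> Hom C y x; g \<cdot> f = Ident C x; f \<cdot> g = Ident C y\<rbrakk> \<Longrightarrow> is_iso C f"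
  by (auto simp: is_iso_def inverse_arrows_def)

text \<open>The section \<open>s\<close> makes an arrow \<open>t\<close> with
  \<open>t \<cdot> q = w\<close> unique, so the description operator in \<open>factor\<close> is
  evaluated by exhibiting any such \<open>t\<close>.\<close>

lemma factor_eq:
  assumes "q \<in> Arr C" "s \<in> Arr C" "Dom C q = Cod C s" "q \<cdot> s = Ident C (Cod C q)" "t \<in> Arr C"
    "Dom C t = Cod C q" "t \<cdot> q = w"
  shows "factor C q w = t"
  unfolding factor_def
proof (rule the_equality)
  show "t \<in> Hom C (Cod C q) (Cod C w) \<and> t \<cdot> q = w" using assms by auto
next
  fix u assume "u \<in> Hom C (Cod C q) (Cod C w) \<and> u \<cdot> q = w"
  then show "u = t" using section_epi[of u q t s "Cod C q"] assms by auto
qed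

end

text \<open>The part of \<open>additive_category\<close> without zero object and biproducts,
  isolated so that its lemmas serve the category of modules as soon as Hom groups and bilinear
  composition are known there.\<close>

locale preadditive_category = category C
  for C :: "('o, 'm, 'z) additive_scheme" (structure) +
  assumes hom_comm_group: "\<lbrakk>x \<in> Obj C; y \<in> Obj C\<rbrakk> \<Longrightarrow> comm_group (hom_group C x y)"
    and Comp_Add_right: "\<lbrakk>f \<in> Hom C x y; f' \<in> Hom C x y; g \<in> Hom C y z\<rbrakk>
      \<Longrightarrow> g \<cdot> Add C f f' = Add C (g \<cdot> f) (g \<cdot> f')"
    and Comp_Add_left: "\<lbrakk>f \<in> Hom C x y; g \<in> Hom C y z; g' \<in> Hom C y z\<rbrakk>
      \<Longrightarrow> Add C g g' \<cdot> f = Add C (g \<cdot> f) (g' \<cdot> f)"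

sublocale additive_category \<subseteq> preadditive_category
  by (rule preadditive_category.intro, rule category_axioms, rule preadditive_category_axioms.intro)
    (fact hom_comm_group Comp_Add_right Comp_Add_left)+

context preadditive_category
begin

lemma Add_simps [simp]:
  assumes "f \<in> Arr C" "g \<in> Arr C" "Dom C f = Dom C g" "Cod C f = Cod C g"
  shows "Add C f g \<in> Arr C" "Dom C (Add C f g) = Dom C g" "Cod C (Add C f g) = Cod C g"
proof -
  interpret G: comm_group "hom_group C (Dom C g) (Cod C g)"
    using assms by (simp add: hom_comm_group)
  show "Add C f g \<in> Arr C" "Dom C (Add C f g) = Dom C g" "Cod C (Add C f g) = Cod C g"
    using G.m_closed[of f g] assms by (auto simp: hom_group_def)
qed

lemma ZeroArr_simps [simp]:
  assumes "x \<in> Obj C" "y \<in> Obj C"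
  shows "ZeroArr C x y \<in> Arr C" "Dom C (ZeroArr C x y) = x" "Cod C (ZeroArr C x y) = y"
proof -
  interpret G: comm_group "hom_group C x y"
    using assms by (simp add: hom_comm_group)
  show "ZeroArr C x y \<in> Arr C" "Dom C (ZeroArr C x y) = x" "Cod C (ZeroArr C x y) = y"
    using G.one_closed by (auto simp: hom_group_def)
qed

lemma neg_arr_simps [simp]:
  assumes "f \<in> Arr C"
  shows "neg_arr C f \<in> Arr C" "Dom C (neg_arr C f) = Dom C f" "Cod C (neg_arr C f) = Cod C f"
    "Add C f (neg_arr C f) = ZeroArr C (Dom C f) (Cod C f)"
    "Add C (neg_arr C f) f = ZeroArr C (Dom C f) (Cod C f)"
proof -
  interpret G: comm_group "hom_group C (Dom C f) (Cod C f)"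
    using assms by (simp add: hom_comm_group)
  show "neg_arr C f \<in> Arr C" "Dom C (neg_arr C f) = Dom C f" "Cod C (neg_arr C f) = Cod C f"
    "Add C f (neg_arr C f) = ZeroArr C (Dom C f) (Cod C f)"
    "Add C (neg_arr C f) f = ZeroArr C (Dom C f) (Cod C f)"
    using G.inv_closed[of f] G.r_inv[of f] G.l_inv[of f] assms
    by (auto simp: hom_group_def neg_arr_def)
qed

lemma Add_zero [simp]:
  assumes "f \<in> Arr C" "Dom C f = x" "Cod C f = y"
  shows "Add C f (ZeroArr C x y) = f" "Add C (ZeroArr C x y) f = f"
proof -
  interpret G: comm_group "hom_group C x y"
    using assms by (auto simp: hom_comm_group)
  show "Add C f (ZeroArr C x y) = f" "Add C (ZeroArr C x y) f = f"
    using G.r_one[of f] G.l_one[of f] assms by (auto simp: hom_group_def)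
qed

lemma Add_assoc:
  assumes "f \<in> Hom C x y" "g \<in> Hom C x y" "h \<in> Hom C x y"
  shows "Add C (Add C f g) h = Add C f (Add C g h)"
proof -
  interpret G: comm_group "hom_group C x y"
    using assms by (auto simp: hom_comm_group)
  show ?thesis using G.m_assoc[of f g h] assms by (auto simp: hom_group_def)
qed

lemma Add_commute:
  assumes "f \<in> Hom C x y" "g \<in> Hom C x y"
  shows "Add C f g = Add C g f"
proof -
  interpret G: comm_group "hom_group C x y"
    using assms by (auto simp: hom_comm_group)
  show ?thesis using G.m_comm[of f g] assms by (auto simp: hom_group_def)
qed

lemma Add_idem_zero:
  assumes "f \<in> Hom C x y" "Add C f f = f"
  shows "f = ZeroArr C x y"
proof -
  interpret G: comm_group "hom_group C x y"
    using assms by (auto simp: hom_comm_group)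
  show ?thesis using G.l_cancel_one[of f f] assms by (auto simp: hom_group_def)
qed

lemma Add_neg_eq_zero:
  assumes "f \<in> Hom C x y" "g \<in> Hom C x y" "Add C f (neg_arr C g) = ZeroArr C x y"
  shows "f = g"
proof -
  have "f = Add C f (Add C (neg_arr C g) g)" using assms by auto
  also have "\<dots> = Add C (Add C f (neg_arr C g)) g"
    using assms Add_assoc[of f x y "neg_arr C g" g] by auto
  also have "\<dots> = g" using assms by auto
  finally show ?thesis .
qed

lemma Add_eq_zeroD:
  assumes "f \<in> Hom C x y" "g \<in> Hom C x y" "Add C f g = ZeroArr C x y"
  shows "f = neg_arr C g"
proof -
  have "f = Add C f (Add C g (neg_arr C g))" using assms(1,2) by auto
  also have "\<dots> = Add C (Add C f g) (neg_arr C g)"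
    using Add_assoc[of f x y g "neg_arr C g"] assms(1,2) by simp
  also have "\<dots> = neg_arr C g" unfolding assms(3) using assms(1,2) by auto
  finally show ?thesis .
qed

lemma comp_Add:
  "\<lbrakk>f \<in> Arr C; f' \<in> Arr C; g \<in> Arr C; Dom C f = Dom C f'; Cod C f = Cod C f'; Dom C g = Cod C f'\<rbrakk>
    \<Longrightarrow> g \<cdot> Add C f f' = Add C (g \<cdot> f) (g \<cdot> f')"
  using Comp_Add_right[of f "Dom C f" "Cod C f" f' g "Cod C g"] by auto

lemma Add_comp:
  "\<lbrakk>f \<in> Arr C; g \<in> Arr C; g' \<in> Arr C; Dom C g = Dom C g'; Cod C g = Cod C g'; Dom C g' = Cod C f\<rbrakk>
    \<Longrightarrow> Add C g g' \<cdot> f = Add C (g \<cdot> f) (g' \<cdot> f)"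
  using Comp_Add_left[of f "Dom C f" "Cod C f" g "Cod C g" g'] by auto

lemma comp_zero [simp]:
  assumes "g \<in> Arr C" "x \<in> Obj C" "Dom C g = y"
  shows "g \<cdot> ZeroArr C x y = ZeroArr C x (Cod C g)"
proof (rule Add_idem_zero)
  have y: "y \<in> Obj C" using assms by auto
  show "g \<cdot> ZeroArr C x y \<in> Hom C x (Cod C g)" using assms y by auto
  show "Add C (g \<cdot> ZeroArr C x y) (g \<cdot> ZeroArr C x y) = g \<cdot> ZeroArr C x y"
    using assms y by (simp flip: comp_Add)
qed

lemma zero_comp [simp]:
  assumes "g \<in> Arr C" "z \<in> Obj C" "Cod C g = y"
  shows "ZeroArr C y z \<cdot> g = ZeroArr C (Dom C g) z"
proof (rule Add_idem_zero)
  have y: "y \<in> Obj C" using assms by auto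
  show "ZeroArr C y z \<cdot> g \<in> Hom C (Dom C g) z" using assms y by auto
  show "Add C (ZeroArr C y z \<cdot> g) (ZeroArr C y z \<cdot> g) = ZeroArr C y z \<cdot> g"
    using assms y by (simp flip: Add_comp)
qed

lemma comp_neg:
  assumes "f \<in> Arr C" "g \<in> Arr C" "Dom C g = Cod C f"
  shows "g \<cdot> neg_arr C f = neg_arr C (g \<cdot> f)"
proof (rule Add_eq_zeroD)
  show "g \<cdot> neg_arr C f \<in> Hom C (Dom C f) (Cod C g)" "g \<cdot> f \<in> Hom C (Dom C f) (Cod C g)"
    using assms by auto
  show "Add C (g \<cdot> neg_arr C f) (g \<cdot> f) = ZeroArr C (Dom C f) (Cod C g)"
    using assms by (simp flip: comp_Add)
qed

lemma neg_comp:
  assumes "f \<in> Arr C" "g \<in> Arr C" "Dom C g = Cod C f"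
  shows "neg_arr C g \<cdot> f = neg_arr C (g \<cdot> f)"
proof (rule Add_eq_zeroD)
  show "neg_arr C g \<cdot> f \<in> Hom C (Dom C f) (Cod C g)" "g \<cdot> f \<in> Hom C (Dom C f) (Cod C g)"
    using assms by auto
  show "Add C (neg_arr C g \<cdot> f) (g \<cdot> f) = ZeroArr C (Dom C f) (Cod C g)"
    using assms by (simp flip: Add_comp)
qed

lemma neg_eqD:
  assumes "neg_arr C f = neg_arr C g" "f \<in> Hom C x y" "g \<in> Hom C x y"
  shows "f = g"
proof (rule Add_neg_eq_zero[OF assms(2,3)])
  show "Add C f (neg_arr C g) = ZeroArr C x y"
    unfolding assms(1)[symmetric] using assms(2) by auto
qed

lemma neg_zero [simp]:
  assumes "x \<in> Obj C" "y \<in> Obj C"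
  shows "neg_arr C (ZeroArr C x y) = ZeroArr C x y"
proof (rule sym, rule Add_eq_zeroD)
  show "Add C (ZeroArr C x y) (ZeroArr C x y) = ZeroArr C x y" using assms by simp
qed (use assms in auto)

text \<open>Replaces the universal property by an equation between arrows, which additive maps of
  Hom groups preserve and which for modules can be read off the underlying object.\<close>

lemma zero_obj_iff:
  "is_zero_obj C z \<longleftrightarrow> z \<in> Obj C \<and> Ident C z = ZeroArr C z z"
proof
  assume z: "is_zero_obj C z"
  then have "z \<in> Obj C" by (simp add: is_zero_obj_def)
  moreover have E: "\<exists>!f. f \<in> Hom C z z" using z unfolding is_zero_obj_def by blast
  have "Ident C z = ZeroArr C z z"
    by (rule trans[OF the1_equality[OF E, symmetric] the1_equality[OF E]]) (use \<open>z \<in> Obj C\<close> in auto)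
  ultimately show "z \<in> Obj C \<and> Ident C z = ZeroArr C z z" by simp
next
  assume z: "z \<in> Obj C \<and> Ident C z = ZeroArr C z z"
  then have [simp]: "z \<in> Obj C" by simp
  have 1: "f = ZeroArr C z x" if "f \<in> Hom C z x" for f x
  proof -
    have "f = f \<cdot> Ident C z" using that by auto
    also have "\<dots> = ZeroArr C z x" using that z by auto
    finally show ?thesis .
  qed
  have 2: "f = ZeroArr C x z" if "f \<in> Hom C x z" for f x
  proof -
    have "f = Ident C z \<cdot> f" using that by auto
    also have "\<dots> = ZeroArr C x z" using that z by auto
    finally show ?thesis .
  qed
  show "is_zero_obj C z"
    unfolding is_zero_obj_def
  proof (intro conjI ballI)
    fix x assume x: "x \<in> Obj C"
    show "\<exists>!f. f \<in> Hom C z x"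
      by (rule ex1I[of _ "ZeroArr C z x"]) (use x 1 in auto)
    show "\<exists>!f. f \<in> Hom C x z"
      by (rule ex1I[of _ "ZeroArr C x z"]) (use x 2 in auto)
  qed simp
qed

text \<open>A finite direct sum given by equations instead of a universal property, so that
  tensoring, retracts and the forgetful functor act on it by calculation. The sum of the
  \<open>inc i \<cdot> pr i\<close> appears as \<open>finprod\<close> because
  \<open>hom_group\<close> is a multiplicative structure.\<close>

definition bisum :: "'i set \<Rightarrow> ('i \<Rightarrow> 'o) \<Rightarrow> 'o \<Rightarrow> ('i \<Rightarrow> 'm) \<Rightarrow> ('i \<Rightarrow> 'm) \<Rightarrow> bool" where
  "bisum I X P pr inc \<longleftrightarrow> finite I \<and> P \<in> Obj C \<and>
     (\<forall>i\<in>I. X i \<in> Obj C \<and> pr i \<in> Hom C P (X i) \<and> inc i \<in> Hom C (X i) P) \<and>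
     (\<forall>i\<in>I. \<forall>j\<in>I. pr i \<cdot> inc j = (if i = j then Ident C (X i) else ZeroArr C (X j) (X i))) \<and>
     finprod (hom_group C P P) (\<lambda>i. inc i \<cdot> pr i) I = Ident C P"

lemma finprod_hom_closed:
  assumes "x \<in> Obj C" "y \<in> Obj C" "\<And>i. i \<in> I \<Longrightarrow> f i \<in> Hom C x y"
  shows "finprod (hom_group C x y) f I \<in> Hom C x y"
proof -
  interpret G: comm_group "hom_group C x y"
    using assms by (simp add: hom_comm_group)
  have "f \<in> I \<rightarrow> carrier (hom_group C x y)" using assms(3) by (auto simp: hom_group_def)
  from G.finprod_closed[OF this] show ?thesis by (simp add: hom_group_def)
qed

lemma finprod_hom_insert:
  assumes "x \<in> Obj C" "y \<in> Obj C" "finite I" "j \<notin> I" "\<And>i. i \<in> insert j I \<Longrightarrow> f i \<in> Hom C x y"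
  shows "finprod (hom_group C x y) f (insert j I) = Add C (f j) (finprod (hom_group C x y) f I)"
proof -
  interpret G: comm_group "hom_group C x y"
    using assms by (simp add: hom_comm_group)
  have "f \<in> I \<rightarrow> carrier (hom_group C x y)" "f j \<in> carrier (hom_group C x y)"
    using assms(5) by (auto simp: hom_group_def)
  from G.finprod_insert[OF assms(3,4) this] show ?thesis by (simp add: hom_group_def)
qed

lemma finprod_hom_empty:
  assumes "x \<in> Obj C" "y \<in> Obj C"
  shows "finprod (hom_group C x y) f {} = ZeroArr C x y"
proof -
  interpret G: comm_group "hom_group C x y"
    using assms by (simp add: hom_comm_group)
  show ?thesis using G.finprod_empty by (simp add: hom_group_def)
qed

lemma finprod_hom_cong:
  assumes "x \<in> Obj C" "y \<in> Obj C" "\<And>i. i \<in> I \<Longrightarrow> f i = g i" "\<And>i. i \<in> I \<Longrightarrow> g i \<in> Hom C x y"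
  shows "finprod (hom_group C x y) f I = finprod (hom_group C x y) g I"
proof -
  interpret G: comm_group "hom_group C x y"
    using assms by (simp add: hom_comm_group)
  have "g \<in> I \<rightarrow> carrier (hom_group C x y)" using assms(4) by (auto simp: hom_group_def)
  from G.finprod_cong'[OF refl this assms(3)] show ?thesis by simp
qed

text \<open>\<open>G\<close> need not come from a functor: it will be composition on either side,
  tensoring with an object followed by conjugation, and the passage from a linear arrow to its
  underlying arrow.\<close>

lemma finprod_hom_additive:
  fixes D :: "('p, 'n, 'y) additive_scheme"
  assumes D: "preadditive_category D"
    and ob: "x \<in> Obj C" "y \<in> Obj C" "x' \<in> Obj D" "y' \<in> Obj D"
    and f: "\<And>i. i \<in> I \<Longrightarrow> f i \<in> Hom C x y" and I: "finite I"
    and G: "\<And>g. g \<in> Hom C x y \<Longrightarrow> G g \<in> Hom D x' y'"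
    and G0: "G (ZeroArr C x y) = ZeroArr D x' y'"
    and GA: "\<And>g h. \<lbrakk>g \<in> Hom C x y; h \<in> Hom C x y\<rbrakk> \<Longrightarrow> G (Add C g h) = Add D (G g) (G h)"
  shows "G (finprod (hom_group C x y) f I) = finprod (hom_group D x' y') (\<lambda>i. G (f i)) I"
  using I f
proof (induction I rule: finite_induct)
  case empty
  then show ?case
    by (simp add: ob G0 finprod_hom_empty preadditive_category.finprod_hom_empty[OF D])
next
  case (insert j I)
  have "G (finprod (hom_group C x y) f (insert j I)) = G (Add C (f j) (finprod (hom_group C x y) f I))"
    using insert ob by (subst finprod_hom_insert) auto
  also have "\<dots> = Add D (G (f j)) (G (finprod (hom_group C x y) f I))"
    by (rule GA) (use insert.prems finprod_hom_closed[OF ob(1,2), of I f] in auto)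
  also have "\<dots> = Add D (G (f j)) (finprod (hom_group D x' y') (\<lambda>i. G (f i)) I)"
    using insert by simp
  also have "\<dots> = finprod (hom_group D x' y') (\<lambda>i. G (f i)) (insert j I)"
    using insert ob G by (subst preadditive_category.finprod_hom_insert[OF D]) auto
  finally show ?case .
qed

lemma finprod_hom_zero:
  assumes "x \<in> Obj C" "y \<in> Obj C" "\<And>i. i \<in> I \<Longrightarrow> f i = ZeroArr C x y"
  shows "finprod (hom_group C x y) f I = ZeroArr C x y"
proof -
  interpret G: comm_group "hom_group C x y"
    using assms by (simp add: hom_comm_group)
  from G.finprod_one_eqI[of I f] show ?thesis using assms(3) by (simp add: hom_group_def)
qed

lemma finprod_hom_single:
  assumes "x \<in> Obj C" "y \<in> Obj C" "finite I" "j \<in> I" "f j \<in> Hom C x y"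
    "\<And>i. i \<in> I \<Longrightarrow> i \<noteq> j \<Longrightarrow> f i = ZeroArr C x y"
  shows "finprod (hom_group C x y) f I = f j"
proof -
  have ty: "f i \<in> Hom C x y" if "i \<in> I" for i
    by (cases "i = j") (use assms that in auto)
  have "finprod (hom_group C x y) f (insert j (I - {j})) =
      Add C (f j) (finprod (hom_group C x y) f (I - {j}))"
    by (rule finprod_hom_insert) (use assms(1-4) ty in auto)
  moreover have "finprod (hom_group C x y) f (I - {j}) = ZeroArr C x y"
    by (rule finprod_hom_zero) (use assms in auto)
  moreover have "insert j (I - {j}) = I" using assms by auto
  ultimately show ?thesis using assms by simp
qed

lemma comp_finprod:
  assumes "x \<in> Obj C" "\<And>i. i \<in> I \<Longrightarrow> f i \<in> Hom C x y" "g \<in> Hom C y z" "finite I"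
  shows "g \<cdot> finprod (hom_group C x y) f I = finprod (hom_group C x z) (\<lambda>i. g \<cdot> f i) I"
  by (rule finprod_hom_additive[OF preadditive_category_axioms]) (use assms in \<open>auto simp: comp_Add\<close>)

lemma finprod_comp:
  assumes "z \<in> Obj C" "\<And>i. i \<in> I \<Longrightarrow> f i \<in> Hom C y z" "g \<in> Hom C x y" "finite I"
  shows "finprod (hom_group C y z) f I \<cdot> g = finprod (hom_group C x z) (\<lambda>i. f i \<cdot> g) I"
  by (rule finprod_hom_additive[OF preadditive_category_axioms, of _ _ _ _ _ _ "\<lambda>h. h \<cdot> g"])
    (use assms in \<open>auto simp: Add_comp\<close>)

text \<open>An arrow into \<open>P\<close> is recovered from its components as the sum of the
  \<open>inc i \<cdot> (pr i \<cdot> u)\<close>.\<close>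

lemma bisum_jointly_monic:
  assumes P: "bisum I X P pr inc" and u: "u \<in> Hom C t P" "v \<in> Hom C t P"
    and eq: "\<And>i. i \<in> I \<Longrightarrow> pr i \<cdot> u = pr i \<cdot> v"
  shows "u = v"
proof -
  have fin: "finite I" and PO: "P \<in> Obj C"
    and ty: "\<And>i. i \<in> I \<Longrightarrow> inc i \<cdot> pr i \<in> Hom C P P"
    using P by (auto simp: bisum_def)
  have *: "w = finprod (hom_group C t P) (\<lambda>i. inc i \<cdot> (pr i \<cdot> w)) I" if "w \<in> Hom C t P" for w
  proof -
    have "w = finprod (hom_group C P P) (\<lambda>i. inc i \<cdot> pr i) I \<cdot> w"
      using that P by (auto simp: bisum_def)
    also have "\<dots> = finprod (hom_group C t P) (\<lambda>i. (inc i \<cdot> pr i) \<cdot> w) I"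
      by (rule finprod_comp) (use that ty PO fin in auto)
    also have "\<dots> = finprod (hom_group C t P) (\<lambda>i. inc i \<cdot> (pr i \<cdot> w)) I"
      by (rule finprod_hom_cong) (use that P PO in \<open>auto simp: bisum_def comp_assoc\<close>)
    finally show ?thesis .
  qed
  have "u = finprod (hom_group C t P) (\<lambda>i. inc i \<cdot> (pr i \<cdot> u)) I" using * u by auto
  also have "\<dots> = finprod (hom_group C t P) (\<lambda>i. inc i \<cdot> (pr i \<cdot> v)) I"
    by (rule finprod_hom_cong) (use u P PO eq in \<open>auto simp: bisum_def\<close>)
  also have "\<dots> = v" using * u by auto
  finally show ?thesis .
qed

text \<open>The inclusions are the arrows whose components are Kronecker deltas; the sum of the
  \<open>inc i \<cdot> pr i\<close> then has the same components as the identity and equals it by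
  uniqueness.\<close>

lemma product_bisum:
  assumes P: "is_product C I X P pr" and I: "finite I" and X: "\<And>i. i \<in> I \<Longrightarrow> X i \<in> Obj C"
  obtains inc where "bisum I X P pr inc"
proof -
  let ?d = "\<lambda>j i. if i = j then Ident C (X i) else ZeroArr C (X j) (X i)"
  have PO: "P \<in> Obj C" and pr: "\<And>i. i \<in> I \<Longrightarrow> pr i \<in> Hom C P (X i)"
    using P by (auto simp: is_product_def)
  have ex: "\<exists>u. u \<in> Hom C (X j) P \<and> (\<forall>i\<in>I. pr i \<cdot> u = ?d j i)" if "j \<in> I" for j
  proof -
    have "\<forall>i\<in>I. ?d j i \<in> Hom C (X j) (X i)" using that X by auto
    then have "\<exists>!u. u \<in> Hom C (X j) P \<and> (\<forall>i\<in>I. pr i \<cdot> u = ?d j i)"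
      using that X
      by (intro P[unfolded is_product_def, THEN conjunct2, THEN conjunct2, rule_format]) auto
    then show ?thesis by (rule ex1_implies_ex)
  qed
  then obtain inc where inc: "\<And>j. j \<in> I \<Longrightarrow> inc j \<in> Hom C (X j) P"
      "\<And>i j. i \<in> I \<Longrightarrow> j \<in> I \<Longrightarrow> pr i \<cdot> inc j = ?d j i"
    by metis
  let ?s = "finprod (hom_group C P P) (\<lambda>i. inc i \<cdot> pr i) I"
  have s: "?s \<in> Hom C P P"
    by (rule finprod_hom_closed) (use PO pr inc in auto)
  have "pr i \<cdot> ?s = pr i" if i: "i \<in> I" for i
  proof -
    have "pr i \<cdot> ?s = finprod (hom_group C P (X i)) (\<lambda>j. pr i \<cdot> (inc j \<cdot> pr j)) I"
      by (rule comp_finprod) (use i PO pr inc I in auto)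
    also have "\<dots> = finprod (hom_group C P (X i)) (\<lambda>j. ?d j i \<cdot> pr j) I"
      by (rule finprod_hom_cong) (use i PO pr inc X in \<open>auto simp flip: comp_assoc\<close>)
    also have "\<dots> = ?d i i \<cdot> pr i"
      by (rule finprod_hom_single) (use i PO pr X I in auto)
    also have "\<dots> = pr i" using i pr by auto
    finally show ?thesis .
  qed
  then have 1: "?s \<in> Hom C P P \<and> (\<forall>i\<in>I. pr i \<cdot> ?s = pr i)"
    using s by (intro conjI ballI)
  have E: "\<exists>!u. u \<in> Hom C P P \<and> (\<forall>i\<in>I. pr i \<cdot> u = pr i)"
    using P[unfolded is_product_def, THEN conjunct2, THEN conjunct2, rule_format, OF PO, of pr] pr
    by simp
  have 2: "Ident C P \<in> Hom C P P \<and> (\<forall>i\<in>I. pr i \<cdot> Ident C P = pr i)"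
    using PO pr by auto
  have "?s = Ident C P"
    by (rule trans[OF the1_equality[OF E 1, symmetric] the1_equality[OF E 2]])
  then have "bisum I X P pr inc"
    using I PO pr inc X by (auto simp: bisum_def)
  then show ?thesis by (rule that)
qed

end

section \<open>Thick subcategories\<close>

text \<open>Besides tt-categories, this covers the category of modules over a separable ring, for which
  cones and the octahedral axiom are never needed.\<close>

locale thick_setting = preadditive_category C
  for C :: "('o, 'm, 'z) triang_scheme" (structure) +
  assumes zero_obj_ex: "\<exists>z. is_zero_obj C z"
    and idem_split: "idempotent_complete C"
    and split_exact: "\<lbrakk>i \<in> Hom C x z; j \<in> Hom C y z; p \<in> Hom C z x; q \<in> Hom C z y;
        p \<cdot> i = Ident C x; q \<cdot> j = Ident C y; p \<cdot> j = ZeroArr C y x; q \<cdot> i = ZeroArr C x y;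
        Add C (i \<cdot> p) (j \<cdot> q) = Ident C z\<rbrakk>
      \<Longrightarrow> is_exact_triangle C x z y i q (ZeroArr C y (SuspO C x))"
    and susp_exact: "x \<in> Obj C \<Longrightarrow>
        \<exists>z f g h. is_zero_obj C z \<and> is_exact_triangle C x z (SuspO C x) f g h"
begin

text \<open>\<open>s \<cdot> r\<close> is idempotent, hence so is
  \<open>e = 1 - s \<cdot> r\<close>; splitting \<open>e\<close> produces the other summand.\<close>

lemma complement:
  assumes "s \<in> Hom C y x" "r \<in> Hom C x y" "r \<cdot> s = Ident C y"
  obtains y' s' r' where "s' \<in> Hom C y' x" "r' \<in> Hom C x y'" "r' \<cdot> s' = Ident C y'"
    "r \<cdot> s' = ZeroArr C y' y" "r' \<cdot> s = ZeroArr C y y'"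
    "Add C (s \<cdot> r) (s' \<cdot> r') = Ident C x" "y' \<in> Obj C"
proof -
  have [simp]: "s \<in> Arr C" "r \<in> Arr C" "Dom C s = y" "Cod C s = x" "Dom C r = x" "Cod C r = y"
    "x \<in> Obj C" "y \<in> Obj C" using assms by auto
  define e where "e = Add C (Ident C x) (neg_arr C (s \<cdot> r))"
  have [simp]: "e \<in> Arr C" "Dom C e = x" "Cod C e = x" by (simp_all add: e_def)
  have rs: "r \<cdot> (s \<cdot> k) = k" if "k \<in> Arr C" "Cod C k = y" for k
    using comp_reassoc[OF assms(3), of k] that by simp
  have re: "r \<cdot> e = ZeroArr C x y"
    unfolding e_def by (subst comp_Add) (simp_all add: comp_neg rs)
  have es: "e \<cdot> s = ZeroArr C y x"
    unfolding e_def by (subst Add_comp) (simp_all add: neg_comp comp_assoc assms(3))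
  have "e \<cdot> e = Add C (Ident C x \<cdot> e) (neg_arr C (s \<cdot> r) \<cdot> e)"
    by (subst (1) e_def, rule Add_comp) simp_all
  also have "\<dots> = e" by (simp add: neg_comp comp_assoc re)
  finally have "e \<cdot> e = e" .
  have "\<exists>y'\<in>Obj C. \<exists>r\<in>Hom C x y'. \<exists>s\<in>Hom C y' x. s \<cdot> r = e \<and> r \<cdot> s = Ident C y'"
    by (rule idem_split[unfolded idempotent_complete_def, rule_format]) (use \<open>e \<cdot> e = e\<close> in auto)
  then obtain y' r' s' where y': "y' \<in> Obj C" "r' \<in> Hom C x y'" "s' \<in> Hom C y' x"
      "s' \<cdot> r' = e" "r' \<cdot> s' = Ident C y'"
    by blast
  have "r \<cdot> s' = ZeroArr C y' y"
  proof (rule section_epi[of _ r' _ s' y'])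
    show "(r \<cdot> s') \<cdot> r' = ZeroArr C y' y \<cdot> r'"
      using y' re by (simp add: comp_assoc)
  qed (use y' in auto)
  moreover have "r' \<cdot> s = ZeroArr C y y'"
  proof (rule retraction_mono[of s' _ _ r' y'])
    have "s' \<cdot> (r' \<cdot> s) = (s' \<cdot> r') \<cdot> s"
      using y'(1-3) by (intro comp_assoc[symmetric]) auto
    then show "s' \<cdot> (r' \<cdot> s) = s' \<cdot> ZeroArr C y y'"
      using y'(1-3) es by (simp add: y'(4))
  qed (use y' in auto)
  moreover have "Add C (s \<cdot> r) (s' \<cdot> r') = Ident C x"
  proof -
    have "Add C (s \<cdot> r) e = Add C (s \<cdot> r) (Add C (neg_arr C (s \<cdot> r)) (Ident C x))"
      unfolding e_def by (subst Add_commute[of "Ident C x" x x]) simp_all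
    also have "\<dots> = Add C (Add C (s \<cdot> r) (neg_arr C (s \<cdot> r))) (Ident C x)"
      by (rule Add_assoc[symmetric, of _ x x]) simp_all
    also have "\<dots> = Ident C x" by simp
    finally show ?thesis by (simp add: y')
  qed
  ultimately show ?thesis using y' by (intro that[of s' y' r']) auto
qed

text \<open>\<open>thick\<close> speaks of direct summands; a retract is one because the
  complementary idempotent splits.\<close>

lemma retract_closed:
  assumes J: "thick C J" and sr: "s \<in> Hom C y x" "r \<in> Hom C x y" "r \<cdot> s = Ident C y"
    and x: "x \<in> J"
  shows "y \<in> J"
proof -
  obtain y' s' r' where c: "s' \<in> Hom C y' x" "r' \<in> Hom C x y'" "r' \<cdot> s' = Ident C y'"
    "r \<cdot> s' = ZeroArr C y' y" "r' \<cdot> s = ZeroArr C y y'"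
    "Add C (s \<cdot> r) (s' \<cdot> r') = Ident C x" "y' \<in> Obj C"
    using complement[OF sr] by metis
  have "is_biproduct C y y' x"
    unfolding is_biproduct_def using c sr by (auto intro!: bexI[of _ s] bexI[of _ s'] bexI[of _ r] bexI[of _ r'])
  then show ?thesis using J x unfolding thick_def by blast
qed

lemma iso_closed:
  assumes "thick C J" "is_iso C f" "f \<in> Hom C x y" "x \<in> J"
  shows "y \<in> J"
  by (rule retract_closed[OF assms(1) _ assms(3) _ assms(4), of "inv_arr C f"])
    (use assms inv_arr_simps[OF assms(2)] in auto)

lemma bisum_member:
  assumes "thick C J" "bisum I X P pr inc" "P \<in> J" "i \<in> I"
  shows "X i \<in> J"
  by (rule retract_closed[OF assms(1), of "inc i" _ P "pr i"]) (use assms in \<open>auto simp: bisum_def\<close>)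

text \<open>Induction on the index set: \<open>X k\<close> is split off, its complement
  \<open>y\<close> is a direct sum of the remaining objects, and \<open>P\<close> is the middle term
  of the split triangle on \<open>X k\<close> and \<open>y\<close>. For the empty index set the
  identity of \<open>P\<close> is an empty sum, so \<open>P\<close> is zero.\<close>

lemma bisum_closed:
  assumes J: "thick C J" and "bisum I X P pr inc" "\<And>i. i \<in> I \<Longrightarrow> X i \<in> J"
  shows "P \<in> J"
proof -
  have "finite I" using assms by (simp add: bisum_def)
  then show ?thesis using assms(2,3)
  proof (induction I arbitrary: P pr inc rule: finite_induct)
    case empty
    then have "P \<in> Obj C" "finprod (hom_group C P P) (\<lambda>i. inc i \<cdot> pr i) {} = Ident C P"
      by (auto simp: bisum_def)
    then have "is_zero_obj C P"
      by (simp add: zero_obj_iff finprod_hom_empty)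
    then show ?case using J unfolding thick_def triangulated_subcat_def by blast
  next
    case (insert k I)
    note B = insert.prems(1)[unfolded bisum_def]
    have PO: "P \<in> Obj C" using B by blast
    have ty0: "X i \<in> Obj C \<and> pr i \<in> Hom C P (X i) \<and> inc i \<in> Hom C (X i) P" if "i \<in> insert k I" for i
      using B that by blast
    have ty: "X i \<in> Obj C" "pr i \<in> Arr C" "inc i \<in> Arr C" "Dom C (pr i) = P" "Cod C (pr i) = X i"
      "Dom C (inc i) = X i" "Cod C (inc i) = P" if "i \<in> insert k I" for i
      using ty0[OF that] by auto
    have orth: "pr i \<cdot> inc j = (if i = j then Ident C (X i) else ZeroArr C (X j) (X i))"
      if "i \<in> insert k I" "j \<in> insert k I" for i j
      using B that by blast
    have kk: "inc k \<in> Hom C (X k) P" "pr k \<in> Hom C P (X k)" "pr k \<cdot> inc k = Ident C (X k)"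
      using ty0[of k] orth[of k k] by simp_all
    obtain y s r where c: "s \<in> Hom C y P" "r \<in> Hom C P y" "r \<cdot> s = Ident C y"
      "pr k \<cdot> s = ZeroArr C y (X k)" "r \<cdot> inc k = ZeroArr C (X k) y"
      "Add C (inc k \<cdot> pr k) (s \<cdot> r) = Ident C P" "y \<in> Obj C"
      using complement[OF kk] by metis
    have [simp]: "s \<in> Arr C" "r \<in> Arr C" "Dom C s = y" "Cod C s = P" "Dom C r = P" "Cod C r = y"
      using c by auto
    \<comment> \<open>The inclusions with index in \<open>I\<close> already land in the complement,
      since \<open>pr k\<close> kills them.\<close>
    have sr: "s \<cdot> (r \<cdot> inc j) = inc j" if "j \<in> I" for j
    proof -
      have "inc j = Add C (inc k \<cdot> pr k) (s \<cdot> r) \<cdot> inc j" using c ty that by simp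
      also have "\<dots> = Add C ((inc k \<cdot> pr k) \<cdot> inc j) ((s \<cdot> r) \<cdot> inc j)"
        by (rule Add_comp) (use ty that in auto)
      also have "\<dots> = s \<cdot> (r \<cdot> inc j)"
        using insert.hyps orth[of k j] that by (auto simp: comp_assoc ty)
      finally show ?thesis ..
    qed
    have "bisum I X y (\<lambda>i. pr i \<cdot> s) (\<lambda>i. r \<cdot> inc i)"
      unfolding bisum_def
    proof (intro conjI ballI)
      fix i j assume ij: "i \<in> I" "j \<in> I"
      have "(pr i \<cdot> s) \<cdot> (r \<cdot> inc j) = pr i \<cdot> inc j"
        using ij by (simp add: comp_assoc ty sr)
      then show "(pr i \<cdot> s) \<cdot> (r \<cdot> inc j) = (if i = j then Ident C (X i) else ZeroArr C (X j) (X i))"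
        using orth ij by simp
    next
      let ?S = "finprod (hom_group C P P) (\<lambda>i. inc i \<cdot> pr i)"
      have ty': "inc i \<cdot> pr i \<in> Hom C P P" if "i \<in> insert k I" for i using ty[OF that] by simp
      have "?S (insert k I) = Add C (inc k \<cdot> pr k) (?S I)"
        by (rule finprod_hom_insert) (use PO insert.hyps ty' in auto)
      then have 1: "Add C (inc k \<cdot> pr k) (?S I) = Ident C P" using B by simp
      have S: "?S I \<in> Hom C P P" by (rule finprod_hom_closed) (use PO ty' in auto)
      have "finprod (hom_group C y y) (\<lambda>i. (r \<cdot> inc i) \<cdot> (pr i \<cdot> s)) I
          = finprod (hom_group C y y) (\<lambda>i. (r \<cdot> (inc i \<cdot> pr i)) \<cdot> s) I"
        by (rule finprod_hom_cong) (use c ty in \<open>auto simp: comp_assoc\<close>)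
      also have "\<dots> = finprod (hom_group C P y) (\<lambda>i. r \<cdot> (inc i \<cdot> pr i)) I \<cdot> s"
        by (rule finprod_comp[symmetric]) (use c ty insert.hyps in auto)
      also have "finprod (hom_group C P y) (\<lambda>i. r \<cdot> (inc i \<cdot> pr i)) I = r \<cdot> ?S I"
        by (rule comp_finprod[symmetric]) (use c PO ty insert.hyps in auto)
      \<comment> \<open>The added term is zero because \<open>r \<cdot> inc k\<close> is; it
        completes the sum over \<open>I\<close> to the full sum, which is the identity of
        \<open>P\<close>.\<close>
      also have "(r \<cdot> ?S I) \<cdot> s = Add C ((r \<cdot> (inc k \<cdot> pr k)) \<cdot> s) ((r \<cdot> ?S I) \<cdot> s)"
        using S ty[of k] c by (simp add: comp_assoc)
      also have "\<dots> = (r \<cdot> Add C (inc k \<cdot> pr k) (?S I)) \<cdot> s"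
        using S ty[of k] by (simp add: comp_Add Add_comp)
      also have "\<dots> = Ident C y" using 1 c by simp
      finally show "finprod (hom_group C y y) (\<lambda>i. (r \<cdot> inc i) \<cdot> (pr i \<cdot> s)) I = Ident C y" .
    qed (use c ty insert.hyps in auto)
    then have "y \<in> J" using insert.IH insert.prems(2) by blast
    moreover have "is_exact_triangle C (X k) P y (inc k) r (ZeroArr C y (SuspO C (X k)))"
      by (rule split_exact[of _ _ _ s y "pr k"]) (use c kk in auto)
    ultimately show ?case
      using J insert.prems(2)[of k] unfolding thick_def triangulated_subcat_def by blast
  qed
qed

text \<open>Suspension in both directions comes from a triangle \<open>x -> 0 -> \<Sigma>x\<close>,
  and summands are retracts; zero objects, retracts and triangles remain to be checked.\<close>

lemma thickI:
  assumes "J \<subseteq> Obj C" and zero: "\<And>z. is_zero_obj C z \<Longrightarrow> z \<in> J"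
    and ret: "\<And>x y r s. \<lbrakk>x \<in> J; s \<in> Hom C y x; r \<in> Hom C x y; r \<cdot> s = Ident C y\<rbrakk> \<Longrightarrow> y \<in> J"
    and tri: "\<And>x y z f g h. is_exact_triangle C x y z f g h \<Longrightarrow>
        (x \<in> J \<and> y \<in> J \<longrightarrow> z \<in> J) \<and> (y \<in> J \<and> z \<in> J \<longrightarrow> x \<in> J) \<and> (x \<in> J \<and> z \<in> J \<longrightarrow> y \<in> J)"
  shows "thick C J"
  unfolding thick_def triangulated_subcat_def
proof (intro conjI allI impI ballI)
  show "J \<subseteq> Obj C" by fact
  show "{z. is_zero_obj C z} \<subseteq> J" using zero by auto
next
  fix x assume "x \<in> Obj C"
  then obtain z f g h where "is_zero_obj C z" "is_exact_triangle C x z (SuspO C x) f g h"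
    using susp_exact by blast
  then show "SuspO C x \<in> J \<longleftrightarrow> x \<in> J" using tri zero by blast
next
  fix x y z assume b: "is_biproduct C x y z \<and> z \<in> J"
  then show "x \<in> J" "y \<in> J" unfolding is_biproduct_def using ret by blast+
qed (use tri in blast)+

end

section \<open>Exact triangles\<close>

context triangulated_category
begin

lemma SuspO_Obj [simp]: "x \<in> Obj C \<Longrightarrow> SuspO C x \<in> Obj C"
  using Susp_equivalence by (simp add: is_equivalence_def is_functor_def)

lemma SuspA_simps [simp]:
  assumes "f \<in> Arr C"
  shows "SuspA C f \<in> Arr C" "Dom C (SuspA C f) = SuspO C (Dom C f)"
    "Cod C (SuspA C f) = SuspO C (Cod C f)"
  using Susp_equivalence assms by (auto simp: is_equivalence_def is_functor_def)

lemma SuspA_Ident [simp]: "x \<in> Obj C \<Longrightarrow> SuspA C (Ident C x) = Ident C (SuspO C x)"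
  using Susp_equivalence by (simp add: is_equivalence_def is_functor_def)

lemma SuspA_comp:
  "\<lbrakk>f \<in> Arr C; g \<in> Arr C; Dom C g = Cod C f\<rbrakk> \<Longrightarrow> SuspA C (g \<cdot> f) = SuspA C g \<cdot> SuspA C f"
  using Susp_equivalence by (simp add: is_equivalence_def is_functor_def)

lemma SuspA_Add:
  "\<lbrakk>f \<in> Hom C x y; g \<in> Hom C x y\<rbrakk> \<Longrightarrow> SuspA C (Add C f g) = Add C (SuspA C f) (SuspA C g)"
  by (rule Susp_additive[unfolded additive_functor_def, THEN conjunct2, rule_format, of x y]) auto

lemma SuspA_inj:
  assumes "SuspA C f = SuspA C g" "f \<in> Hom C x y" "g \<in> Hom C x y"
  shows "f = g"
proof -
  have "x \<in> Obj C" "y \<in> Obj C" using assms by auto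
  then have "inj_on (SuspA C) (Hom C x y)"
    using Susp_equivalence unfolding is_equivalence_def bij_betw_def by blast
  then show ?thesis using assms by (meson inj_onD)
qed

lemma SuspA_full:
  assumes "x \<in> Obj C" "y \<in> Obj C" "c \<in> Hom C (SuspO C x) (SuspO C y)"
  obtains m where "m \<in> Hom C x y" "c = SuspA C m"
proof -
  have "SuspA C ` Hom C x y = Hom C (SuspO C x) (SuspO C y)"
    using Susp_equivalence assms unfolding is_equivalence_def bij_betw_def by blast
  then show ?thesis using that assms by blast
qed

lemma triangleD:
  assumes "is_triangle C x y z f g h"
  shows "x \<in> Obj C" "y \<in> Obj C" "z \<in> Obj C" "f \<in> Arr C" "g \<in> Arr C" "h \<in> Arr C"
    "Dom C f = x" "Cod C f = y" "Dom C g = y" "Cod C g = z" "Dom C h = z" "Cod C h = SuspO C x"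
  using assms by (auto simp: is_triangle_def)

lemma exact_triangleD: "is_exact_triangle C x y z f g h \<Longrightarrow> is_triangle C x y z f g h"
  by (simp add: is_exact_triangle_def)

lemma rotate:
  assumes "is_exact_triangle C x y z f g h"
  shows "is_exact_triangle C y z (SuspO C x) g h (neg_arr C (SuspA C f))"
proof -
  note [simp] = triangleD[OF exact_triangleD[OF assms]]
  show ?thesis
    using assms TR2[of x y z f g h] by (auto simp: is_exact_triangle_def is_triangle_def)
qed

lemma Ident_triangle:
  assumes "x \<in> Obj C" "is_zero_obj C z"
  shows "is_exact_triangle C x x z (Ident C x) (ZeroArr C x z) (ZeroArr C z (SuspO C x))"
  using TR1_id[OF assms] assms by (auto simp: is_exact_triangle_def is_triangle_def zero_obj_iff)

text \<open>The triangle on the identity of \<open>x\<close> has a zero object as third term; TR3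
  maps it to the given triangle and so factors \<open>g \<cdot> f\<close> through zero.\<close>

lemma exact_comp_zero:
  assumes "is_exact_triangle C x y z f g h"
  shows "g \<cdot> f = ZeroArr C x z"
proof -
  note [simp] = triangleD[OF exact_triangleD[OF assms]]
  obtain o' where o': "is_zero_obj C o'" using zero_obj_exists by blast
  then have [simp]: "o' \<in> Obj C" by (simp add: zero_obj_iff)
  have "\<exists>c\<in>Hom C o' z. c \<cdot> ZeroArr C x o' = g \<cdot> f \<and>
      SuspA C (Ident C x) \<cdot> ZeroArr C o' (SuspO C x) = h \<cdot> c"
    by (rule TR3[OF Ident_triangle[OF _ o'] assms]) auto
  then show ?thesis by auto
qed

text \<open>TR3 compares the rotated identity triangle \<open>w -> 0 -> \<Sigma>w\<close> with the
  rotation of the given one. The arrow \<open>\<Sigma>w -> \<Sigma>x\<close> that it yields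
  desuspends because suspension is fully faithful.\<close>

lemma exact_lift:
  assumes T: "is_exact_triangle C x y z f g h" and l: "l \<in> Hom C w y" "g \<cdot> l = ZeroArr C w z"
  obtains m where "m \<in> Hom C w x" "l = f \<cdot> m"
proof -
  note [simp] = triangleD[OF exact_triangleD[OF T]]
  obtain o' where o': "is_zero_obj C o'" using zero_obj_exists by blast
  have [simp]: "o' \<in> Obj C" "w \<in> Obj C" "l \<in> Arr C" "Dom C l = w" "Cod C l = y"
    using o' l by (auto simp: zero_obj_iff)
  have "\<exists>c\<in>Hom C (SuspO C w) (SuspO C x). c \<cdot> ZeroArr C o' (SuspO C w) = h \<cdot> ZeroArr C o' z \<and>
      SuspA C l \<cdot> neg_arr C (SuspA C (Ident C w)) = neg_arr C (SuspA C f) \<cdot> c"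
    by (rule TR3[OF rotate[OF Ident_triangle[OF _ o']] rotate[OF T]]) (use l in auto)
  then obtain c where c: "c \<in> Hom C (SuspO C w) (SuspO C x)"
      "SuspA C l \<cdot> neg_arr C (SuspA C (Ident C w)) = neg_arr C (SuspA C f) \<cdot> c"
    by blast
  then have "neg_arr C (SuspA C l) = neg_arr C (SuspA C f \<cdot> c)"
    by (simp add: comp_neg neg_comp)
  then have "SuspA C l = SuspA C f \<cdot> c"
    by (rule neg_eqD) (use c in auto)
  moreover obtain m where m: "m \<in> Hom C w x" "c = SuspA C m"
    using SuspA_full[of w x c] c by auto
  ultimately have "SuspA C l = SuspA C (f \<cdot> m)" by (simp add: SuspA_comp)
  then have "l = f \<cdot> m" by (rule SuspA_inj) (use m in auto)
  then show ?thesis using m that by blast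
qed

lemma exact_lift_susp:
  assumes T: "is_exact_triangle C x y z f g h"
    and t: "t \<in> Hom C w (SuspO C x)" "SuspA C f \<cdot> t = ZeroArr C w (SuspO C y)"
  obtains m where "m \<in> Hom C w z" "t = h \<cdot> m"
proof -
  note [simp] = triangleD[OF exact_triangleD[OF T]]
  have "neg_arr C (SuspA C f) \<cdot> t = ZeroArr C w (SuspO C y)"
    using t by (auto simp: neg_comp)
  then show ?thesis using exact_lift[OF rotate[OF rotate[OF T]] t(1)] that by blast
qed

text \<open>The five lemma: a triangle whose represented sequences are exact is exact as soon as it can be
  compared with the exact triangle on its first arrow.\<close>

lemma exact_by_comparison:
  assumes T: "is_triangle C x y z f g h"
    and y: "\<And>w l. \<lbrakk>l \<in> Hom C w y; g \<cdot> l = ZeroArr C w z\<rbrakk> \<Longrightarrow> \<exists>m\<in>Hom C w x. l = f \<cdot> m"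
    and z: "\<And>w l. \<lbrakk>l \<in> Hom C w z; h \<cdot> l = ZeroArr C w (SuspO C x)\<rbrakk> \<Longrightarrow> \<exists>m\<in>Hom C w y. l = g \<cdot> m"
    and fh: "SuspA C f \<cdot> h = ZeroArr C z (SuspO C y)"
    and E: "is_exact_triangle C x y c f g' h'"
    and u: "u \<in> Hom C c z" "u \<cdot> g' = g" "h \<cdot> u = h'"
  shows "is_exact_triangle C x y z f g h"
proof -
  note [simp] = triangleD[OF exact_triangleD[OF E]]
  note Ts [simp] = triangleD[OF T]
  have [simp]: "u \<in> Arr C" "Dom C u = c" "Cod C u = z" using u by auto
  \<comment> \<open>\<open>h\<close> is killed by \<open>\<Sigma>f\<close>, so it lifts through
    \<open>h'\<close>; \<open>t\<close> is a first approximation to an inverse of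
    \<open>u\<close>.\<close>
  obtain t where t: "t \<in> Hom C z c" "h = h' \<cdot> t"
    using exact_lift_susp[OF E, of h z] fh by auto
  have [simp]: "t \<in> Arr C" "Dom C t = z" "Cod C t = c" using t by auto
  have "h \<cdot> Add C (Ident C z) (neg_arr C (u \<cdot> t)) = Add C h (neg_arr C (h \<cdot> (u \<cdot> t)))"
    by (simp add: comp_Add comp_neg)
  also have "h \<cdot> (u \<cdot> t) = h" using comp_reassoc[OF u(3), of t] t by simp
  finally have "h \<cdot> Add C (Ident C z) (neg_arr C (u \<cdot> t)) = ZeroArr C z (SuspO C x)"
    by simp
  with z[of "Add C (Ident C z) (neg_arr C (u \<cdot> t))" z]
  obtain k where k: "k \<in> Hom C z y" "Add C (Ident C z) (neg_arr C (u \<cdot> t)) = g \<cdot> k"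
    by auto
  have [simp]: "k \<in> Arr C" "Dom C k = z" "Cod C k = y" using k by auto
  \<comment> \<open>The error \<open>1 - u \<cdot> t\<close> equals \<open>g \<cdot> k\<close> with
    \<open>g = u \<cdot> g'\<close>; adding \<open>g' \<cdot> k\<close> to \<open>t\<close> corrects
    it, so that \<open>u \<cdot> v = 1\<close>.\<close>
  define v where "v = Add C (g' \<cdot> k) t"
  have [simp]: "v \<in> Arr C" "Dom C v = z" "Cod C v = c" by (auto simp: v_def)
  have "u \<cdot> v = Add C (u \<cdot> (g' \<cdot> k)) (u \<cdot> t)" by (simp add: v_def comp_Add)
  also have "u \<cdot> (g' \<cdot> k) = g \<cdot> k" using comp_reassoc[OF u(2), of k] by simp
  also have "Add C (g \<cdot> k) (u \<cdot> t) = Add C (Ident C z) (Add C (neg_arr C (u \<cdot> t)) (u \<cdot> t))"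
    unfolding k(2)[symmetric] by (rule Add_assoc[of _ z z]) auto
  also have "\<dots> = Ident C z" by simp
  finally have uv: "u \<cdot> v = Ident C z" .
  \<comment> \<open>The other half of the five lemma: \<open>u\<close> has trivial kernel, so that
    \<open>u \<cdot> (v \<cdot> u - 1) = 0\<close> gives \<open>v \<cdot> u = 1\<close>.\<close>
  have inj: "d = ZeroArr C w c" if d: "d \<in> Hom C w c" "u \<cdot> d = ZeroArr C w z" for d w
  proof -
    have [simp]: "d \<in> Arr C" "Dom C d = w" "Cod C d = c" "w \<in> Obj C" using d by auto
    have "h' \<cdot> d = h \<cdot> (u \<cdot> d)" using comp_reassoc[OF u(3), of d] by simp
    then have "h' \<cdot> d = ZeroArr C w (SuspO C x)" using d by simp
    then obtain l where l: "l \<in> Hom C w y" "d = g' \<cdot> l"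
      using exact_lift[OF rotate[OF E] d(1)] by blast
    have [simp]: "l \<in> Arr C" "Dom C l = w" "Cod C l = y" using l by auto
    have "g \<cdot> l = u \<cdot> (g' \<cdot> l)" using comp_reassoc[OF u(2), of l] by simp
    then have "g \<cdot> l = ZeroArr C w z" using d l by simp
    then obtain m where m: "m \<in> Hom C w x" "l = f \<cdot> m" using y l by blast
    have "d = (g' \<cdot> f) \<cdot> m" unfolding l(2) m(2) by (rule comp_assoc[symmetric]) (use m in auto)
    then show ?thesis using exact_comp_zero[OF E] m by auto
  qed
  have "Add C (v \<cdot> u) (neg_arr C (Ident C c)) = ZeroArr C c c"
  proof (rule inj)
    have "u \<cdot> (v \<cdot> u) = u" using comp_reassoc[OF uv, of u] by simp
    then show "u \<cdot> Add C (v \<cdot> u) (neg_arr C (Ident C c)) = ZeroArr C c z"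
      by (simp add: comp_Add comp_neg)
  qed auto
  then have vu: "v \<cdot> u = Ident C c" by (rule Add_neg_eq_zero[rotated 2]) auto
  have iso: "is_iso C u" by (rule is_isoI[OF _ _ vu uv]) auto
  have idiso: "is_iso C (Ident C a)" if "a \<in> Obj C" for a
    by (rule is_isoI[of _ a a "Ident C a"]) (use that in auto)
  have "(f, g, h) \<in> Tri C"
    by (rule TR1_iso[OF E T, of "Ident C x" "Ident C y" u]) (use iso idiso u in auto)
  then show ?thesis using T by (simp add: is_exact_triangle_def)
qed

text \<open>The conditions of \<open>exact_by_comparison\<close> are transported from the larger
  triangle through the inclusions and retractions. The comparison arrow out of the cone of
  \<open>f\<close> is an arrow to \<open>z'\<close> supplied by TR3, followed by
  \<open>qz\<close>.\<close>

lemma retract_triangle: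
  assumes E: "is_exact_triangle C x' y' z' f' g' h'" and T: "is_triangle C x y z f g h"
    and i: "ix \<in> Hom C x x'" "iy \<in> Hom C y y'" "iz \<in> Hom C z z'"
    and q: "qx \<in> Hom C x' x" "qy \<in> Hom C y' y" "qz \<in> Hom C z' z"
    and qi: "qx \<cdot> ix = Ident C x" "qy \<cdot> iy = Ident C y" "qz \<cdot> iz = Ident C z"
    and ci: "iy \<cdot> f = f' \<cdot> ix" "iz \<cdot> g = g' \<cdot> iy" "SuspA C ix \<cdot> h = h' \<cdot> iz"
    and cq: "qy \<cdot> f' = f \<cdot> qx" "qz \<cdot> g' = g \<cdot> qy" "SuspA C qx \<cdot> h' = h \<cdot> qz"
  shows "is_exact_triangle C x y z f g h"
proof -
  note [simp] = triangleD[OF exact_triangleD[OF E]] triangleD[OF T]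
  have [simp]: "ix \<in> Arr C" "iy \<in> Arr C" "iz \<in> Arr C" "qx \<in> Arr C" "qy \<in> Arr C" "qz \<in> Arr C"
    "Dom C ix = x" "Cod C ix = x'" "Dom C iy = y" "Cod C iy = y'" "Dom C iz = z" "Cod C iz = z'"
    "Dom C qx = x'" "Cod C qx = x" "Dom C qy = y'" "Cod C qy = y" "Dom C qz = z'" "Cod C qz = z"
    using i q by auto
  have Sqi: "SuspA C qx \<cdot> SuspA C ix = Ident C (SuspO C x)"
    using qi by (simp flip: SuspA_comp)
  obtain c g1 h1 where E1: "is_exact_triangle C x y c f g1 h1"
    using TR1_cone[of f x y] by auto
  note [simp] = triangleD[OF exact_triangleD[OF E1]]
  obtain k where k: "k \<in> Hom C c z'" "k \<cdot> g1 = g' \<cdot> iy" "SuspA C ix \<cdot> h1 = h' \<cdot> k"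
    using TR3[OF E1 E, of ix iy] ci by auto
  have [simp]: "k \<in> Arr C" "Dom C k = c" "Cod C k = z'" using k by auto
  show ?thesis
  proof (rule exact_by_comparison[OF T _ _ _ E1])
    fix w l assume l: "l \<in> Hom C w y" "g \<cdot> l = ZeroArr C w z"
    then have [simp]: "l \<in> Arr C" "Dom C l = w" "Cod C l = y" "w \<in> Obj C" by auto
    have "g' \<cdot> (iy \<cdot> l) = iz \<cdot> (g \<cdot> l)"
      using comp_reassoc[OF ci(2), of l] by (simp add: comp_assoc)
    then have "g' \<cdot> (iy \<cdot> l) = ZeroArr C w z'" using l by simp
    then obtain m where m: "m \<in> Hom C w x'" "iy \<cdot> l = f' \<cdot> m"
      using exact_lift[OF E, of "iy \<cdot> l" w] by auto
    have "l = qy \<cdot> (iy \<cdot> l)" using comp_reassoc[OF qi(2), of l] by simp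
    also have "\<dots> = f \<cdot> (qx \<cdot> m)" using m comp_reassoc[OF cq(1), of m] by (auto simp: comp_assoc)
    finally show "\<exists>m\<in>Hom C w x. l = f \<cdot> m" by (rule bexI) (use m in auto)
  next
    fix w l assume l: "l \<in> Hom C w z" "h \<cdot> l = ZeroArr C w (SuspO C x)"
    then have [simp]: "l \<in> Arr C" "Dom C l = w" "Cod C l = z" "w \<in> Obj C" by auto
    have "h' \<cdot> (iz \<cdot> l) = SuspA C ix \<cdot> (h \<cdot> l)"
      using comp_reassoc[OF ci(3), of l] by (simp add: comp_assoc)
    then have "h' \<cdot> (iz \<cdot> l) = ZeroArr C w (SuspO C x')" using l by simp
    then obtain m where m: "m \<in> Hom C w y'" "iz \<cdot> l = g' \<cdot> m"
      using exact_lift[OF rotate[OF E], of "iz \<cdot> l" w] by auto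
    have "l = qz \<cdot> (iz \<cdot> l)" using comp_reassoc[OF qi(3), of l] by simp
    also have "\<dots> = g \<cdot> (qy \<cdot> m)" using m comp_reassoc[OF cq(2), of m] by (auto simp: comp_assoc)
    finally show "\<exists>m\<in>Hom C w y. l = g \<cdot> m" by (rule bexI) (use m in auto)
  next
    have "neg_arr C (SuspA C f') \<cdot> h' = ZeroArr C z' (SuspO C y')"
      using exact_comp_zero[OF rotate[OF rotate[OF E]]] by simp
    then have "neg_arr C (SuspA C f' \<cdot> h') = neg_arr C (ZeroArr C z' (SuspO C y'))"
      by (simp add: neg_comp)
    then have fh': "SuspA C f' \<cdot> h' = ZeroArr C z' (SuspO C y')"
      by (rule neg_eqD) auto
    have "SuspA C f \<cdot> h = (SuspA C f \<cdot> (SuspA C qx \<cdot> SuspA C ix)) \<cdot> h"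
      by (simp add: Sqi)
    also have "\<dots> = SuspA C (f \<cdot> qx) \<cdot> (SuspA C ix \<cdot> h)"
      by (simp add: comp_assoc SuspA_comp)
    also have "\<dots> = SuspA C (qy \<cdot> f') \<cdot> (h' \<cdot> iz)" by (simp only: ci(3) cq(1))
    also have "\<dots> = SuspA C qy \<cdot> ((SuspA C f' \<cdot> h') \<cdot> iz)" by (simp add: comp_assoc SuspA_comp)
    also have "\<dots> = ZeroArr C z (SuspO C y)" unfolding fh' by simp
    finally show "SuspA C f \<cdot> h = ZeroArr C z (SuspO C y)" .
  next
    show "qz \<cdot> k \<in> Hom C c z" by simp
    have "(qz \<cdot> k) \<cdot> g1 = (qz \<cdot> g') \<cdot> iy" by (simp add: comp_assoc k(2))
    also have "\<dots> = g \<cdot> (qy \<cdot> iy)" unfolding cq(2) by (rule comp_assoc) auto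
    also have "\<dots> = g" by (simp add: qi(2))
    finally show "(qz \<cdot> k) \<cdot> g1 = g" .
    have "h \<cdot> (qz \<cdot> k) = (SuspA C qx \<cdot> h') \<cdot> k" unfolding cq(3) by (rule comp_assoc[symmetric]) auto
    also have "\<dots> = SuspA C qx \<cdot> (SuspA C ix \<cdot> h1)" by (simp add: comp_assoc k(3))
    also have "\<dots> = (SuspA C qx \<cdot> SuspA C ix) \<cdot> h1" by (rule comp_assoc[symmetric]) auto
    also have "\<dots> = h1" by (simp add: Sqi)
    finally show "h \<cdot> (qz \<cdot> k) = h1" .
  qed
qed

text \<open>The cone of \<open>i\<close> has zero connecting arrow, since \<open>\<Sigma>i\<close>
  kills it and \<open>\<Sigma>p\<close> retracts \<open>\<Sigma>i\<close>. Hence its second arrow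
  \<open>g\<close> has a section \<open>l\<close>, and \<open>q \<cdot> l\<close> compares the cone
  with \<open>y\<close>.\<close>

lemma split_triangle:
  assumes ty: "i \<in> Hom C x z" "j \<in> Hom C y z" "p \<in> Hom C z x" "q \<in> Hom C z y"
    and eq: "p \<cdot> i = Ident C x" "q \<cdot> j = Ident C y" "p \<cdot> j = ZeroArr C y x" "q \<cdot> i = ZeroArr C x y"
        "Add C (i \<cdot> p) (j \<cdot> q) = Ident C z"
  shows "is_exact_triangle C x z y i q (ZeroArr C y (SuspO C x))"
proof -
  have [simp]: "i \<in> Arr C" "j \<in> Arr C" "p \<in> Arr C" "q \<in> Arr C" "Dom C i = x" "Dom C j = y"
    "Dom C p = z" "Dom C q = z" "Cod C i = z" "Cod C j = z" "Cod C p = x" "Cod C q = y"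
    "x \<in> Obj C" "y \<in> Obj C" "z \<in> Obj C" using ty by auto
  have T: "is_triangle C x z y i q (ZeroArr C y (SuspO C x))" by (simp add: is_triangle_def)
  obtain c g h where E: "is_exact_triangle C x z c i g h" using TR1_cone[of i x z] by auto
  note [simp] = triangleD[OF exact_triangleD[OF E]]
  have "SuspA C i \<cdot> h = ZeroArr C c (SuspO C z)"
  proof -
    have "neg_arr C (SuspA C i \<cdot> h) = neg_arr C (ZeroArr C c (SuspO C z))"
      using exact_comp_zero[OF rotate[OF rotate[OF E]]] by (simp add: neg_comp)
    then show ?thesis by (rule neg_eqD) auto
  qed
  have h: "h = ZeroArr C c (SuspO C x)"
  proof -
    have "h = SuspA C (p \<cdot> i) \<cdot> h" by (simp add: eq)
    also have "\<dots> = SuspA C p \<cdot> (SuspA C i \<cdot> h)" by (simp add: SuspA_comp comp_assoc)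
    also have "\<dots> = ZeroArr C c (SuspO C x)" by (simp add: \<open>SuspA C i \<cdot> h = _\<close>)
    finally show ?thesis .
  qed
  have "\<exists>l\<in>Hom C c z. Ident C c = g \<cdot> l"
    using exact_lift[OF rotate[OF E], of "Ident C c" c] h by auto
  then obtain l where l: "l \<in> Hom C c z" "g \<cdot> l = Ident C c" by auto
  have [simp]: "l \<in> Arr C" "Dom C l = c" "Cod C l = z" using l by auto
  define u where "u = q \<cdot> l"
  have ug: "u \<cdot> g = q"
  proof -
    \<comment> \<open>\<open>l \<cdot> g - 1\<close> dies under \<open>g\<close>, so it factors
      through \<open>i\<close>, which \<open>q\<close> kills.\<close>
    have "g \<cdot> Add C (l \<cdot> g) (neg_arr C (Ident C z)) = Add C (g \<cdot> (l \<cdot> g)) (neg_arr C g)"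
      by (simp add: comp_Add comp_neg)
    also have "g \<cdot> (l \<cdot> g) = g" using comp_reassoc[OF l(2), of g] by simp
    finally have "g \<cdot> Add C (l \<cdot> g) (neg_arr C (Ident C z)) = ZeroArr C z c" by simp
    then obtain m where m: "m \<in> Hom C z x" "Add C (l \<cdot> g) (neg_arr C (Ident C z)) = i \<cdot> m"
      using exact_lift[OF E, of "Add C (l \<cdot> g) (neg_arr C (Ident C z))" z] by auto
    have "q \<cdot> (i \<cdot> m) = (q \<cdot> i) \<cdot> m" by (rule comp_assoc[symmetric]) (use m in auto)
    then have "q \<cdot> (i \<cdot> m) = ZeroArr C z y" using m(1) by (auto simp: eq)
    then have "q \<cdot> Add C (l \<cdot> g) (neg_arr C (Ident C z)) = ZeroArr C z y" unfolding m(2) .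
    then have "Add C (q \<cdot> (l \<cdot> g)) (neg_arr C q) = ZeroArr C z y" by (simp add: comp_Add comp_neg)
    then have "q \<cdot> (l \<cdot> g) = q" by (rule Add_neg_eq_zero[rotated 2]) auto
    then show ?thesis by (simp add: u_def comp_assoc)
  qed
  show ?thesis
  proof (rule exact_by_comparison[OF T _ _ _ E])
    fix w l assume l: "l \<in> Hom C w z" "q \<cdot> l = ZeroArr C w y"
    then have [simp]: "l \<in> Arr C" "Dom C l = w" "Cod C l = z" "w \<in> Obj C" by auto
    have "l = Add C (i \<cdot> p) (j \<cdot> q) \<cdot> l" by (simp add: eq)
    also have "\<dots> = Add C (i \<cdot> (p \<cdot> l)) (j \<cdot> (q \<cdot> l))" by (simp add: Add_comp comp_assoc)
    also have "\<dots> = i \<cdot> (p \<cdot> l)" by (simp add: l(2))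
    finally show "\<exists>m\<in>Hom C w x. l = i \<cdot> m" by (rule bexI) simp
  next
    fix w l assume l: "l \<in> Hom C w y" "ZeroArr C y (SuspO C x) \<cdot> l = ZeroArr C w (SuspO C x)"
    then have "l = q \<cdot> (j \<cdot> l)" using comp_reassoc[OF eq(2), of l] by auto
    then show "\<exists>m\<in>Hom C w z. l = q \<cdot> m" by (rule bexI) (use l in auto)
  qed (use ug h in \<open>auto simp: u_def\<close>)
qed

end

section \<open>Coherence in symmetric monoidal categories\<close>

context symmetric_monoidal_category
begin

abbreviation lwhisker :: "'o \<Rightarrow> 'm \<Rightarrow> 'm" (infixr "\<triangleright>" 76) where
  "x \<triangleright> f \<equiv> Ident C x \<odot> f"

abbreviation rwhisker :: "'m \<Rightarrow> 'o \<Rightarrow> 'm" (infixl "\<triangleleft>" 76) where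
  "f \<triangleleft> y \<equiv> f \<odot> Ident C y"

abbreviation AssocI :: "'o \<Rightarrow> 'o \<Rightarrow> 'o \<Rightarrow> 'm" where
  "AssocI x y z \<equiv> inv_arr C (Assoc C x y z)"

abbreviation LUnitI :: "'o \<Rightarrow> 'm" where
  "LUnitI x \<equiv> inv_arr C (LUnit C x)"

declare TenO_Obj [simp] UnitO_Obj [simp] TenA_Ident [simp]

lemma TenA_simps [simp]:
  assumes "f \<in> Arr C" "g \<in> Arr C"
  shows "f \<odot> g \<in> Arr C" "Dom C (f \<odot> g) = Dom C f \<boxtimes> Dom C g" "Cod C (f \<odot> g) = Cod C f \<boxtimes> Cod C g"
  using TenA_Hom[of f "Dom C f" "Cod C f" g "Dom C g" "Cod C g"] assms by auto

lemma lwhisker_comp: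
  "\<lbrakk>x \<in> Obj C; f \<in> Arr C; g \<in> Arr C; Dom C g = Cod C f\<rbrakk> \<Longrightarrow> x \<triangleright> (g \<cdot> f) = (x \<triangleright> g) \<cdot> (x \<triangleright> f)"
  using TenA_Comp[of "Ident C x" x x "Ident C x" x f "Dom C f" "Cod C f" g "Cod C g"] by auto

lemma rwhisker_comp:
  "\<lbrakk>y \<in> Obj C; f \<in> Arr C; g \<in> Arr C; Dom C g = Cod C f\<rbrakk> \<Longrightarrow> (g \<cdot> f) \<triangleleft> y = (g \<triangleleft> y) \<cdot> (f \<triangleleft> y)"
  using TenA_Comp[of f "Dom C f" "Cod C f" g "Cod C g" "Ident C y" y y "Ident C y" y] by auto

lemma whisker_exchange:
  assumes "f \<in> Arr C" "g \<in> Arr C" "Dom C f = x" "Cod C f = x'" "Dom C g = y" "Cod C g = y'"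
  shows "(f \<triangleleft> y') \<cdot> (x \<triangleright> g) = (x' \<triangleright> g) \<cdot> (f \<triangleleft> y)"
proof -
  have ob: "x \<in> Obj C" "x' \<in> Obj C" "y \<in> Obj C" "y' \<in> Obj C" using assms by auto
  have "(f \<triangleleft> y') \<cdot> (x \<triangleright> g) = (f \<cdot> Ident C x) \<odot> (Ident C y' \<cdot> g)"
    by (rule TenA_Comp[symmetric, of _ x x _ x' _ y y' _ y']) (use assms ob in auto)
  also have "\<dots> = (Ident C x' \<cdot> f) \<odot> (g \<cdot> Ident C y)" using assms by simp
  also have "\<dots> = (x' \<triangleright> g) \<cdot> (f \<triangleleft> y)"
    by (rule TenA_Comp[of _ x x' _ x' _ y y _ y']) (use assms ob in auto)
  finally show ?thesis .
qed

lemma Assoc_simps [simp]: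
  assumes "x \<in> Obj C" "y \<in> Obj C" "z \<in> Obj C"
  shows "Assoc C x y z \<in> Arr C" "Dom C (Assoc C x y z) = (x \<boxtimes> y) \<boxtimes> z"
    "Cod C (Assoc C x y z) = x \<boxtimes> (y \<boxtimes> z)"
    "AssocI x y z \<in> Arr C" "Dom C (AssocI x y z) = x \<boxtimes> (y \<boxtimes> z)"
    "Cod C (AssocI x y z) = (x \<boxtimes> y) \<boxtimes> z"
    "AssocI x y z \<cdot> Assoc C x y z = Ident C ((x \<boxtimes> y) \<boxtimes> z)"
    "Assoc C x y z \<cdot> AssocI x y z = Ident C (x \<boxtimes> (y \<boxtimes> z))"
  using Assoc_iso[OF assms] inv_arr_simps[of "Assoc C x y z"] by (auto simp: iso_between_def)

lemma LUnit_simps [simp]: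
  assumes "x \<in> Obj C"
  shows "LUnit C x \<in> Arr C" "Dom C (LUnit C x) = UnitO C \<boxtimes> x" "Cod C (LUnit C x) = x"
    "LUnitI x \<in> Arr C" "Dom C (LUnitI x) = x" "Cod C (LUnitI x) = UnitO C \<boxtimes> x"
    "LUnitI x \<cdot> LUnit C x = Ident C (UnitO C \<boxtimes> x)" "LUnit C x \<cdot> LUnitI x = Ident C x"
  using LUnit_iso[OF assms] inv_arr_simps[of "LUnit C x"] by (auto simp: iso_between_def)

lemma RUnit_simps [simp]:
  assumes "x \<in> Obj C"
  shows "RUnit C x \<in> Arr C" "Dom C (RUnit C x) = x \<boxtimes> UnitO C" "Cod C (RUnit C x) = x"
  using RUnit_iso[OF assms] by (auto simp: iso_between_def)

lemma Braid_simps [simp]: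
  assumes "x \<in> Obj C" "y \<in> Obj C"
  shows "Braid C x y \<in> Arr C" "Dom C (Braid C x y) = x \<boxtimes> y" "Cod C (Braid C x y) = y \<boxtimes> x"
    "Braid C y x \<cdot> Braid C x y = Ident C (x \<boxtimes> y)"
  using Braid_iso[OF assms] symmetry[OF assms] by (auto simp: iso_between_def)

lemma inverse_cancel [simp]:
  assumes "x \<in> Obj C" "y \<in> Obj C" "z \<in> Obj C" "k \<in> Arr C"
  shows "Cod C k = (x \<boxtimes> y) \<boxtimes> z \<Longrightarrow> AssocI x y z \<cdot> (Assoc C x y z \<cdot> k) = k"
    "Cod C k = x \<boxtimes> (y \<boxtimes> z) \<Longrightarrow> Assoc C x y z \<cdot> (AssocI x y z \<cdot> k) = k"
  using assms by (simp_all flip: comp_assoc)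

lemma Braid_cancel [simp]:
  "\<lbrakk>x \<in> Obj C; y \<in> Obj C; k \<in> Arr C; Cod C k = x \<boxtimes> y\<rbrakk> \<Longrightarrow>
    Braid C y x \<cdot> (Braid C x y \<cdot> k) = k"
  by (simp flip: comp_assoc)

lemma LUnit_cancel [simp]:
  "\<lbrakk>x \<in> Obj C; k \<in> Arr C; Cod C k = UnitO C \<boxtimes> x\<rbrakk> \<Longrightarrow> LUnitI x \<cdot> (LUnit C x \<cdot> k) = k"
  "\<lbrakk>x \<in> Obj C; k \<in> Arr C; Cod C k = x\<rbrakk> \<Longrightarrow> LUnit C x \<cdot> (LUnitI x \<cdot> k) = k"
  by (simp_all flip: comp_assoc)

lemma whisker_inverse:
  assumes "g \<cdot> f = Ident C y" "f \<in> Arr C" "g \<in> Arr C" "Dom C g = Cod C f" "Dom C f = y" "x \<in> Obj C"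
  shows "(x \<triangleright> g) \<cdot> (x \<triangleright> f) = Ident C (x \<boxtimes> y)" "(g \<triangleleft> x) \<cdot> (f \<triangleleft> x) = Ident C (y \<boxtimes> x)"
  using assms by (auto simp flip: lwhisker_comp rwhisker_comp)

lemma whisker_Assoc_inverse [simp]:
  assumes "x \<in> Obj C" "y \<in> Obj C" "z \<in> Obj C" "w \<in> Obj C"
  shows "(w \<triangleright> AssocI x y z) \<cdot> (w \<triangleright> Assoc C x y z) = Ident C (w \<boxtimes> ((x \<boxtimes> y) \<boxtimes> z))"
    "(w \<triangleright> Assoc C x y z) \<cdot> (w \<triangleright> AssocI x y z) = Ident C (w \<boxtimes> (x \<boxtimes> (y \<boxtimes> z)))"
    "(AssocI x y z \<triangleleft> w) \<cdot> (Assoc C x y z \<triangleleft> w) = Ident C (((x \<boxtimes> y) \<boxtimes> z) \<boxtimes> w)"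
    "(Assoc C x y z \<triangleleft> w) \<cdot> (AssocI x y z \<triangleleft> w) = Ident C ((x \<boxtimes> (y \<boxtimes> z)) \<boxtimes> w)"
  using assms by (simp_all add: whisker_inverse)

lemma whisker_Assoc_cancel [simp]:
  assumes "x \<in> Obj C" "y \<in> Obj C" "z \<in> Obj C" "w \<in> Obj C" "k \<in> Arr C"
  shows
    "Cod C k = w \<boxtimes> ((x \<boxtimes> y) \<boxtimes> z) \<Longrightarrow> (w \<triangleright> AssocI x y z) \<cdot> ((w \<triangleright> Assoc C x y z) \<cdot> k) = k"
    "Cod C k = w \<boxtimes> (x \<boxtimes> (y \<boxtimes> z)) \<Longrightarrow> (w \<triangleright> Assoc C x y z) \<cdot> ((w \<triangleright> AssocI x y z) \<cdot> k) = k"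
    "Cod C k = ((x \<boxtimes> y) \<boxtimes> z) \<boxtimes> w \<Longrightarrow> (AssocI x y z \<triangleleft> w) \<cdot> ((Assoc C x y z \<triangleleft> w) \<cdot> k) = k"
    "Cod C k = (x \<boxtimes> (y \<boxtimes> z)) \<boxtimes> w \<Longrightarrow> (Assoc C x y z \<triangleleft> w) \<cdot> ((AssocI x y z \<triangleleft> w) \<cdot> k) = k"
  using assms by (simp_all add: whisker_inverse flip: comp_assoc)

lemma whisker_Braid_inverse [simp]:
  assumes "x \<in> Obj C" "y \<in> Obj C" "w \<in> Obj C"
  shows "(w \<triangleright> Braid C y x) \<cdot> (w \<triangleright> Braid C x y) = Ident C (w \<boxtimes> (x \<boxtimes> y))"
    "(Braid C y x \<triangleleft> w) \<cdot> (Braid C x y \<triangleleft> w) = Ident C ((x \<boxtimes> y) \<boxtimes> w)"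
  using assms by (simp_all add: whisker_inverse)

lemma whisker_Braid_cancel [simp]:
  assumes "x \<in> Obj C" "y \<in> Obj C" "w \<in> Obj C" "k \<in> Arr C"
  shows "Cod C k = w \<boxtimes> (x \<boxtimes> y) \<Longrightarrow> (w \<triangleright> Braid C y x) \<cdot> ((w \<triangleright> Braid C x y) \<cdot> k) = k"
    "Cod C k = (x \<boxtimes> y) \<boxtimes> w \<Longrightarrow> (Braid C y x \<triangleleft> w) \<cdot> ((Braid C x y \<triangleleft> w) \<cdot> k) = k"
  using assms by (simp_all add: whisker_inverse flip: comp_assoc)

lemma Assoc_nat1:
  "\<lbrakk>f \<in> Arr C; Dom C f = x; Cod C f = x'; y \<in> Obj C; z \<in> Obj C\<rbrakk> \<Longrightarrow>
    Assoc C x' y z \<cdot> ((f \<triangleleft> y) \<triangleleft> z) = (f \<triangleleft> (y \<boxtimes> z)) \<cdot> Assoc C x y z"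
  using Assoc_natural[of f x x' "Ident C y" y y "Ident C z" z z] by auto

lemma Assoc_nat2:
  "\<lbrakk>g \<in> Arr C; Dom C g = y; Cod C g = y'; x \<in> Obj C; z \<in> Obj C\<rbrakk> \<Longrightarrow>
    Assoc C x y' z \<cdot> ((x \<triangleright> g) \<triangleleft> z) = (x \<triangleright> (g \<triangleleft> z)) \<cdot> Assoc C x y z"
  using Assoc_natural[of "Ident C x" x x g y y' "Ident C z" z z] by auto

lemma Assoc_nat3:
  "\<lbrakk>h \<in> Arr C; Dom C h = z; Cod C h = z'; x \<in> Obj C; y \<in> Obj C\<rbrakk> \<Longrightarrow>
    Assoc C x y z' \<cdot> ((x \<boxtimes> y) \<triangleright> h) = (x \<triangleright> (y \<triangleright> h)) \<cdot> Assoc C x y z"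
  using Assoc_natural[of "Ident C x" x x "Ident C y" y y h z z'] by auto

lemma inverse_nat:
  assumes "g' \<cdot> f = h \<cdot> g" "i' \<cdot> g' = Ident C (Dom C g')" "g \<cdot> i = Ident C (Cod C g)"
    "f \<in> Arr C" "g \<in> Arr C" "g' \<in> Arr C" "h \<in> Arr C" "i \<in> Arr C" "i' \<in> Arr C"
    "Dom C f = Dom C g" "Cod C f = Dom C g'" "Cod C g = Dom C h" "Cod C g' = Cod C h"
    "Dom C i = Cod C g" "Cod C i = Dom C g" "Dom C i' = Cod C g'" "Cod C i' = Dom C g'"
  shows "i' \<cdot> h = f \<cdot> i"
proof -
  have "i' \<cdot> h = i' \<cdot> ((h \<cdot> g) \<cdot> i)" using assms(2-) by (simp add: comp_assoc)
  also have "\<dots> = i' \<cdot> ((g' \<cdot> f) \<cdot> i)" by (simp add: assms(1))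
  also have "\<dots> = (i' \<cdot> g') \<cdot> (f \<cdot> i)" using assms(4-) by (simp add: comp_assoc)
  also have "\<dots> = f \<cdot> i" using assms(2-) by simp
  finally show ?thesis .
qed

lemma AssocI_nat1:
  "\<lbrakk>f \<in> Arr C; Dom C f = x; Cod C f = x'; y \<in> Obj C; z \<in> Obj C\<rbrakk> \<Longrightarrow>
    AssocI x' y z \<cdot> (f \<triangleleft> (y \<boxtimes> z)) = ((f \<triangleleft> y) \<triangleleft> z) \<cdot> AssocI x y z"
  by (rule inverse_nat[OF Assoc_nat1]) auto

lemma AssocI_nat2:
  "\<lbrakk>g \<in> Arr C; Dom C g = y; Cod C g = y'; x \<in> Obj C; z \<in> Obj C\<rbrakk> \<Longrightarrow>
    AssocI x y' z \<cdot> (x \<triangleright> (g \<triangleleft> z)) = ((x \<triangleright> g) \<triangleleft> z) \<cdot> AssocI x y z"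
  by (rule inverse_nat[OF Assoc_nat2]) auto

lemma AssocI_nat3:
  "\<lbrakk>h \<in> Arr C; Dom C h = z; Cod C h = z'; x \<in> Obj C; y \<in> Obj C\<rbrakk> \<Longrightarrow>
    AssocI x y z' \<cdot> (x \<triangleright> (y \<triangleright> h)) = ((x \<boxtimes> y) \<triangleright> h) \<cdot> AssocI x y z"
  by (rule inverse_nat[OF Assoc_nat3]) auto

lemma Braid_nat1:
  "\<lbrakk>f \<in> Arr C; Dom C f = x; Cod C f = x'; y \<in> Obj C\<rbrakk> \<Longrightarrow>
    Braid C x' y \<cdot> (f \<triangleleft> y) = (y \<triangleright> f) \<cdot> Braid C x y"
  using Braid_natural[of f x x' "Ident C y" y y] by auto

lemma Braid_nat2:
  "\<lbrakk>g \<in> Arr C; Dom C g = y; Cod C g = y'; x \<in> Obj C\<rbrakk> \<Longrightarrow>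
    Braid C x y' \<cdot> (x \<triangleright> g) = (g \<triangleleft> x) \<cdot> Braid C x y"
  using Braid_natural[of "Ident C x" x x g y y'] by auto

lemma LUnit_nat:
  "\<lbrakk>f \<in> Arr C; Dom C f = x; Cod C f = x'\<rbrakk> \<Longrightarrow> LUnit C x' \<cdot> (UnitO C \<triangleright> f) = f \<cdot> LUnit C x"
  using LUnit_natural[of f x x'] by auto

lemma LUnitI_nat:
  "\<lbrakk>f \<in> Arr C; Dom C f = x; Cod C f = x'\<rbrakk> \<Longrightarrow> LUnitI x' \<cdot> f = (UnitO C \<triangleright> f) \<cdot> LUnitI x"
  by (rule inverse_nat[OF LUnit_nat]) auto

lemmas coherence_nat = Assoc_nat1 Assoc_nat2 Assoc_nat3 AssocI_nat1 AssocI_nat2 AssocI_nat3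
  Braid_nat1 Braid_nat2
lemmas coherence_nat' = coherence_nat[THEN comp_reassoc]

lemmas comp_norm = comp_assoc lwhisker_comp rwhisker_comp

text \<open>Kelly's argument from pentagon and unit triangle: both sides agree after tensoring with
  the unit on the left and precomposing with associators. Tensoring with the unit is faithful, being
  isomorphic to the identity through \<open>LUnit\<close>.\<close>

lemma LUnit_tensor:
  assumes [simp]: "x \<in> Obj C" "y \<in> Obj C"
  shows "LUnit C (x \<boxtimes> y) \<cdot> Assoc C (UnitO C) x y = LUnit C x \<triangleleft> y"
proof -
  let ?u = "UnitO C" and ?A = "Assoc C"
  let ?l = "LUnit C (x \<boxtimes> y) \<cdot> ?A ?u x y" and ?r = "LUnit C x \<triangleleft> y"
  let ?p = "?A ?u (?u \<boxtimes> x) y \<cdot> (?A ?u ?u x \<triangleleft> y)"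
  let ?s = "(AssocI ?u ?u x \<triangleleft> y) \<cdot> AssocI ?u (?u \<boxtimes> x) y"
  have tr: "RUnit C ?u \<triangleleft> z = (?u \<triangleright> LUnit C z) \<cdot> ?A ?u ?u z" if "z \<in> Obj C" for z
    using unit_triangle[of ?u z] that by simp
  have "(?u \<triangleright> ?l) \<cdot> ?p = (?u \<triangleright> LUnit C (x \<boxtimes> y)) \<cdot> ((?u \<triangleright> ?A ?u x y) \<cdot> ?p)"
    by (simp add: comp_norm)
  also have "\<dots> = (?u \<triangleright> LUnit C (x \<boxtimes> y)) \<cdot> (?A ?u ?u (x \<boxtimes> y) \<cdot> ?A (?u \<boxtimes> ?u) x y)"
    using pentagon[of ?u ?u x y] by simp
  also have "\<dots> = (RUnit C ?u \<triangleleft> (x \<boxtimes> y)) \<cdot> ?A (?u \<boxtimes> ?u) x y"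
    by (simp add: tr comp_assoc)
  also have "\<dots> = ?A ?u x y \<cdot> ((RUnit C ?u \<triangleleft> x) \<triangleleft> y)"
    by (simp add: Assoc_nat1)
  also have "\<dots> = ?A ?u x y \<cdot> ((?u \<triangleright> LUnit C x) \<triangleleft> y) \<cdot> (?A ?u ?u x \<triangleleft> y)"
    by (simp add: tr comp_norm)
  also have "\<dots> = (?u \<triangleright> ?r) \<cdot> ?p"
    by (simp add: coherence_nat' comp_assoc)
  finally have "?u \<triangleright> ?l = ?u \<triangleright> ?r"
    by (rule section_epi[of _ ?p _ ?s]) (auto simp: comp_assoc)
  then have "LUnit C y' \<cdot> (?u \<triangleright> ?l) = LUnit C y' \<cdot> (?u \<triangleright> ?r)" for y' by simp
  from this[of "x \<boxtimes> y"] have "?l \<cdot> LUnit C ((?u \<boxtimes> x) \<boxtimes> y) = ?r \<cdot> LUnit C ((?u \<boxtimes> x) \<boxtimes> y)"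
    by (subst (asm) (1 2) LUnit_nat) auto
  then show ?thesis
    by (rule section_epi[of _ "LUnit C ((?u \<boxtimes> x) \<boxtimes> y)" _ "LUnitI ((?u \<boxtimes> x) \<boxtimes> y)"]) auto
qed

lemma LUnit_tensor':
  assumes [simp]: "x \<in> Obj C" "y \<in> Obj C"
  shows "(LUnit C x \<triangleleft> y) \<cdot> AssocI (UnitO C) x y = LUnit C (x \<boxtimes> y)"
  by (simp add: comp_assoc flip: LUnit_tensor)

text \<open>The pentagon solved for the composite that arises when an associator is whiskered on the
  right; \<open>pentagon3\<close> is the variant for whiskered inverse associators.\<close>

lemma pentagon2:
  assumes [simp]: "w \<in> Obj C" "x \<in> Obj C" "y \<in> Obj C" "z \<in> Obj C"
  shows "(Assoc C w x y \<triangleleft> z) \<cdot> AssocI (w \<boxtimes> x) y z =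
    AssocI w (x \<boxtimes> y) z \<cdot> (w \<triangleright> AssocI x y z) \<cdot> Assoc C w x (y \<boxtimes> z)"
proof -
  have "AssocI w (x \<boxtimes> y) z \<cdot> (w \<triangleright> AssocI x y z) \<cdot> Assoc C w x (y \<boxtimes> z)
      = AssocI w (x \<boxtimes> y) z \<cdot> (w \<triangleright> AssocI x y z) \<cdot>
        ((Assoc C w x (y \<boxtimes> z) \<cdot> Assoc C (w \<boxtimes> x) y z) \<cdot> AssocI (w \<boxtimes> x) y z)"
    by (simp add: comp_assoc)
  also have "\<dots> = (Assoc C w x y \<triangleleft> z) \<cdot> AssocI (w \<boxtimes> x) y z"
    by (simp add: pentagon comp_assoc)
  finally show ?thesis ..
qed

lemma pentagon3:
  assumes [simp]: "w \<in> Obj C" "x \<in> Obj C" "y \<in> Obj C" "z \<in> Obj C"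
  shows "Assoc C (w \<boxtimes> x) y z \<cdot> (AssocI w x y \<triangleleft> z) \<cdot> AssocI w (x \<boxtimes> y) z =
    AssocI w x (y \<boxtimes> z) \<cdot> (w \<triangleright> Assoc C x y z)"
proof -
  have "Assoc C (w \<boxtimes> x) y z \<cdot> (AssocI w x y \<triangleleft> z) \<cdot> AssocI w (x \<boxtimes> y) z
      = AssocI w x (y \<boxtimes> z) \<cdot> ((Assoc C w x (y \<boxtimes> z) \<cdot> Assoc C (w \<boxtimes> x) y z) \<cdot>
        ((AssocI w x y \<triangleleft> z) \<cdot> AssocI w (x \<boxtimes> y) z))"
    by (simp add: comp_assoc)
  also have "\<dots> = AssocI w x (y \<boxtimes> z) \<cdot> (w \<triangleright> Assoc C x y z)"
    by (simp add: pentagon comp_assoc)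
  finally show ?thesis .
qed

text \<open>The second hexagon, which follows from the first because
  \<open>Braid C z (x \<boxtimes> y)\<close> is inverse to
  \<open>Braid C (x \<boxtimes> y) z\<close>.\<close>

lemma Braid_tensor_left:
  assumes [simp]: "x \<in> Obj C" "y \<in> Obj C" "z \<in> Obj C"
  shows "Braid C (x \<boxtimes> y) z = Assoc C z x y \<cdot> (Braid C x z \<triangleleft> y) \<cdot> AssocI x z y \<cdot>
    (x \<triangleright> Braid C y z) \<cdot> Assoc C x y z"
proof -
  let ?B = "Braid C" and ?A = "Assoc C"
  let ?g = "(?B x z \<triangleleft> y) \<cdot> AssocI x z y \<cdot> (x \<triangleright> ?B y z)"
  have "?A z x y \<cdot> ?g \<cdot> ?A x y z = ?A z x y \<cdot> ?g \<cdot> (?A x y z \<cdot> ?B z (x \<boxtimes> y) \<cdot> ?A z x y) \<cdot>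
      AssocI z x y \<cdot> ?B (x \<boxtimes> y) z"
    by (simp add: comp_assoc)
  also have "\<dots> = ?B (x \<boxtimes> y) z"
    by (simp add: hexagon comp_assoc)
  finally show ?thesis by (simp add: comp_assoc)
qed

lemma Braid_tensor_swap:
  assumes [simp]: "x \<in> Obj C" "y \<in> Obj C" "z \<in> Obj C"
  shows "(Braid C z x \<triangleleft> y) \<cdot> AssocI z x y \<cdot> Braid C (x \<boxtimes> y) z =
    AssocI x z y \<cdot> (x \<triangleright> Braid C y z) \<cdot> Assoc C x y z"
  by (simp add: Braid_tensor_left)

text \<open>Both sides reverse the order of three factors. Expanding the left one by the second
  hexagon and contracting by the first leaves naturality with respect to
  \<open>Braid C y z\<close>.\<close>

lemma yang_baxter:
  assumes [simp]: "x \<in> Obj C" "y \<in> Obj C" "z \<in> Obj C"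
  shows "AssocI z y x \<cdot> (z \<triangleright> Braid C x y) \<cdot> Braid C (x \<boxtimes> y) z =
    (Braid C y z \<triangleleft> x) \<cdot> Braid C x (y \<boxtimes> z) \<cdot> Assoc C x y z"
proof -
  let ?B = "Braid C" and ?A = "Assoc C"
  have "AssocI z y x \<cdot> (z \<triangleright> ?B x y) \<cdot> ?B (x \<boxtimes> y) z =
      AssocI z y x \<cdot> ((z \<triangleright> ?B x y) \<cdot> ?A z x y \<cdot> (?B x z \<triangleleft> y)) \<cdot> AssocI x z y \<cdot>
        (x \<triangleright> ?B y z) \<cdot> ?A x y z"
    by (simp add: Braid_tensor_left comp_assoc)
  also have "\<dots> = ?B x (z \<boxtimes> y) \<cdot> (x \<triangleright> ?B y z) \<cdot> ?A x y z"
    by (simp add: comp_assoc flip: hexagon)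
  also have "\<dots> = (?B y z \<triangleleft> x) \<cdot> ?B x (y \<boxtimes> z) \<cdot> ?A x y z"
    by (simp add: coherence_nat' comp_assoc)
  finally show ?thesis .
qed

end

section \<open>Additivity and suspension of tensor products\<close>

context tt_category
begin

lemma lwhisker_Add:
  assumes "x \<in> Obj C" "f \<in> Hom C y z" "g \<in> Hom C y z"
  shows "x \<triangleright> Add C f g = Add C (x \<triangleright> f) (x \<triangleright> g)"
proof -
  have "additive_functor C C (ten_functor C x)"
    using ten_exact[OF assms(1)] by (simp add: exact_functor_def)
  from this[unfolded additive_functor_def, THEN conjunct2, rule_format, OF _ _ assms(2,3)] assms(2)
  show ?thesis by (auto simp: ten_functor_def)
qed

lemma rwhisker_Add:
  assumes "x \<in> Obj C" "f \<in> Hom C y z" "g \<in> Hom C y z"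
  shows "Add C f g \<triangleleft> x = Add C (f \<triangleleft> x) (g \<triangleleft> x)"
proof -
  have [simp]: "f \<in> Arr C" "g \<in> Arr C" "Dom C f = y" "Dom C g = y" "Cod C f = z" "Cod C g = z"
    "x \<in> Obj C" "y \<in> Obj C" "z \<in> Obj C" using assms by auto
  \<comment> \<open>Additivity is given for tensoring on the left; conjugation by the braiding
    transfers it to the right.\<close>
  have *: "h \<triangleleft> x = Braid C x z \<cdot> (x \<triangleright> h) \<cdot> Braid C y x" if "h \<in> Arr C" "Dom C h = y" "Cod C h = z" for h
    using that by (simp add: Braid_nat2 coherence_nat' comp_assoc)
  show ?thesis
    by (simp add: * lwhisker_Add[of _ _ y z] Add_comp comp_Add)
qed

lemma lwhisker_zero [simp]:
  assumes "x \<in> Obj C" "y \<in> Obj C" "z \<in> Obj C"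
  shows "x \<triangleright> ZeroArr C y z = ZeroArr C (x \<boxtimes> y) (x \<boxtimes> z)"
  by (rule Add_idem_zero) (use assms lwhisker_Add[of x "ZeroArr C y z" y z "ZeroArr C y z"] in auto)

lemma rwhisker_zero [simp]:
  assumes "x \<in> Obj C" "y \<in> Obj C" "z \<in> Obj C"
  shows "ZeroArr C y z \<triangleleft> x = ZeroArr C (y \<boxtimes> x) (z \<boxtimes> x)"
  by (rule Add_idem_zero) (use assms rwhisker_Add[of x "ZeroArr C y z" y z "ZeroArr C y z"] in auto)

lemma zero_tensor:
  assumes "x \<in> Obj C" "is_zero_obj C z"
  shows "is_zero_obj C (x \<boxtimes> z)"
  using assms lwhisker_zero[of x z z] TenA_Ident[of x z] by (simp add: zero_obj_iff del: lwhisker_zero)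

lemma TenSusp_simps [simp]:
  assumes "x \<in> Obj C" "y \<in> Obj C"
  shows "TenSusp C x y \<in> Arr C" "Dom C (TenSusp C x y) = x \<boxtimes> SuspO C y"
    "Cod C (TenSusp C x y) = SuspO C (x \<boxtimes> y)" "is_iso C (TenSusp C x y)"
  using ten_exact[OF assms(1)] assms(2) by (auto simp: exact_functor_def ten_functor_def)

lemma TenSusp_nat1:
  "\<lbrakk>f \<in> Arr C; Dom C f = x; Cod C f = x'; y \<in> Obj C\<rbrakk> \<Longrightarrow>
    TenSusp C x' y \<cdot> (f \<triangleleft> SuspO C y) = SuspA C (f \<triangleleft> y) \<cdot> TenSusp C x y"
  using TenSusp_natural[of f x x' y] by simp

lemma TenSusp_nat2:
  "\<lbrakk>f \<in> Arr C; Dom C f = y; Cod C f = y'; x \<in> Obj C\<rbrakk> \<Longrightarrow>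
    TenSusp C x y' \<cdot> (x \<triangleright> SuspA C f) = SuspA C (x \<triangleright> f) \<cdot> TenSusp C x y"
  using ten_exact[of x] by (auto simp: exact_functor_def ten_functor_def)

lemma TenSusp_AssocI:
  assumes [simp]: "x \<in> Obj C" "y \<in> Obj C" "z \<in> Obj C"
  shows "TenSusp C (x \<boxtimes> y) z \<cdot> AssocI x y (SuspO C z) =
    SuspA C (AssocI x y z) \<cdot> TenSusp C x (y \<boxtimes> z) \<cdot> (x \<triangleright> TenSusp C y z)"
proof -
  have "SuspA C (AssocI x y z) \<cdot> SuspA C (Assoc C x y z) = Ident C (SuspO C ((x \<boxtimes> y) \<boxtimes> z))"
    by (simp flip: SuspA_comp)
  note c = comp_reassoc[OF this]
  have "SuspA C (AssocI x y z) \<cdot> TenSusp C x (y \<boxtimes> z) \<cdot> (x \<triangleright> TenSusp C y z)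
    = SuspA C (AssocI x y z) \<cdot> ((TenSusp C x (y \<boxtimes> z) \<cdot> (x \<triangleright> TenSusp C y z) \<cdot> Assoc C x y (SuspO C z))
       \<cdot> AssocI x y (SuspO C z))"
    by (simp add: comp_assoc)
  also have "\<dots> = TenSusp C (x \<boxtimes> y) z \<cdot> AssocI x y (SuspO C z)"
    by (simp add: comp_assoc c flip: TenSusp_assoc)
  finally show ?thesis ..
qed

lemma ten_triangle:
  assumes "x \<in> Obj C" "is_exact_triangle C y1 y2 y3 f g h"
  shows "is_exact_triangle C (x \<boxtimes> y1) (x \<boxtimes> y2) (x \<boxtimes> y3) (x \<triangleright> f) (x \<triangleright> g)
    (TenSusp C x y1 \<cdot> (x \<triangleright> h))"
proof -
  note [simp] = triangleD[OF exact_triangleD[OF assms(2)]]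
  have "(f, g, h) \<in> Tri C" using assms(2) by (simp add: is_exact_triangle_def)
  then have "(x \<triangleright> f, x \<triangleright> g, TenSusp C x y1 \<cdot> (x \<triangleright> h)) \<in> Tri C"
    using ten_exact[OF assms(1)] by (auto simp: exact_functor_def ten_functor_def)
  then show ?thesis using assms(1) by (simp add: is_exact_triangle_def is_triangle_def)
qed

sublocale thick_setting C
proof unfold_locales
  fix x assume x: "x \<in> Obj C"
  obtain z where z: "is_zero_obj C z" using zero_obj_exists by blast
  show "\<exists>z f g h. is_zero_obj C z \<and> is_exact_triangle C x z (SuspO C x) f g h"
    using z rotate[OF Ident_triangle[OF x z]] by blast
qed (use zero_obj_exists idempotent_complete split_triangle in auto)

end

section \<open>Modules over a ring\<close>

locale tt_ring = tt_category C
  for C :: "('o, 'm, 'z) tt_scheme" (structure) +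
  fixes A :: "('o, 'm) ring_obj"
  assumes ring: "is_ring C A"
begin

abbreviation R :: 'o where "R \<equiv> RObj A"
abbreviation mu :: 'm ("\<mu>") where "\<mu> \<equiv> RMul A"
abbreviation eta :: 'm ("\<eta>") where "\<eta> \<equiv> ROne A"
abbreviation U :: "('o, 'm) modl" where "U \<equiv> (R, \<mu>)"
abbreviation modl :: "('o, 'm) modl \<Rightarrow> bool" where "modl \<equiv> is_module C A"

text \<open>Below, \<open>z \<star> y\<close> is \<open>z \<otimes> y\<close> with the action on the left factor, so that \<open>U \<star> y\<close> is the free
  module on \<open>y\<close>; \<open>ract b\<close> is the right action \<open>m \<otimes> a \<mapsto> a m\<close>, \<open>al b y\<close> the map
  \<open>m \<otimes> (a \<otimes> n) \<mapsto> m a \<otimes> n\<close>, and \<open>tw \<gamma> z\<close> the restriction of \<open>z\<close> along \<open>\<gamma>\<close>.\<close>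

definition lin :: "('o, 'm) modl \<Rightarrow> 'm \<Rightarrow> ('o, 'm) modl \<Rightarrow> bool" where
  "lin z f w \<longleftrightarrow> is_module_arr C A (z, f, w)"

definition mten :: "('o, 'm) modl \<Rightarrow> 'o \<Rightarrow> ('o, 'm) modl" (infixl "\<star>" 77) where
  "z \<star> y = (fst z \<boxtimes> y, (snd z \<triangleleft> y) \<cdot> AssocI R (fst z) y)"

definition ract :: "('o, 'm) modl \<Rightarrow> 'm" where
  "ract b = snd b \<cdot> Braid C (fst b) R"

definition al :: "('o, 'm) modl \<Rightarrow> 'o \<Rightarrow> 'm" where
  "al b y = (ract b \<triangleleft> y) \<cdot> AssocI (fst b) R y"

definition tw :: "'m \<Rightarrow> ('o, 'm) modl \<Rightarrow> ('o, 'm) modl" where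
  "tw \<gamma> z = (fst z, snd z \<cdot> (\<gamma> \<triangleleft> fst z))"

lemma ring_simps [simp]:
  "R \<in> Obj C" "\<mu> \<in> Arr C" "Dom C \<mu> = R \<boxtimes> R" "Cod C \<mu> = R"
  "\<eta> \<in> Arr C" "Dom C \<eta> = UnitO C" "Cod C \<eta> = R"
  using ring by (auto simp: is_ring_def Let_def)

lemma ring_laws:
  "\<mu> \<cdot> (\<mu> \<triangleleft> R) = \<mu> \<cdot> (R \<triangleright> \<mu>) \<cdot> Assoc C R R R" "\<mu> \<cdot> (\<eta> \<triangleleft> R) = LUnit C R"
  "\<mu> \<cdot> Braid C R R = \<mu>"
  using ring unfolding is_ring_def Let_def by blast+

lemma module_U [simp]: "modl U"
  by (simp add: is_module_def ring_laws(1,2))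

lemma module_simps [simp]:
  assumes "modl z"
  shows "fst z \<in> Obj C" "snd z \<in> Arr C" "Dom C (snd z) = R \<boxtimes> fst z" "Cod C (snd z) = fst z"
  using assms by (auto simp: is_module_def Let_def)

lemma module_laws:
  assumes "modl z"
  shows "snd z \<cdot> (\<mu> \<triangleleft> fst z) = snd z \<cdot> (R \<triangleright> snd z) \<cdot> Assoc C R R (fst z)"
    "snd z \<cdot> (\<eta> \<triangleleft> fst z) = LUnit C (fst z)"
  using assms unfolding is_module_def Let_def by blast+

lemma module_assoc:
  assumes "modl z"
  shows "snd z \<cdot> (R \<triangleright> snd z) = snd z \<cdot> (\<mu> \<triangleleft> fst z) \<cdot> AssocI R R (fst z)"
proof -
  have "snd z \<cdot> (\<mu> \<triangleleft> fst z) \<cdot> AssocI R R (fst z) = (snd z \<cdot> (\<mu> \<triangleleft> fst z)) \<cdot> AssocI R R (fst z)"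
    using assms by (simp add: comp_assoc)
  also have "\<dots> = snd z \<cdot> (R \<triangleright> snd z)"
    unfolding module_laws(1)[OF assms] using assms by (simp add: comp_assoc)
  finally show ?thesis ..
qed

lemma moduleI:
  assumes "x \<in> Obj C" "\<rho> \<in> Arr C" "Dom C \<rho> = R \<boxtimes> x" "Cod C \<rho> = x"
    "\<rho> \<cdot> (\<mu> \<triangleleft> x) = \<rho> \<cdot> (R \<triangleright> \<rho>) \<cdot> Assoc C R R x" "\<rho> \<cdot> (\<eta> \<triangleleft> x) = LUnit C x"
  shows "modl (x, \<rho>)"
  using assms by (simp add: is_module_def)

lemma unit_section:
  assumes "modl z"
  shows "snd z \<cdot> ((\<eta> \<triangleleft> fst z) \<cdot> LUnitI (fst z)) = Ident C (fst z)"
  using assms comp_reassoc[OF module_laws(2)[OF assms], of "LUnitI (fst z)"] by simp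

text \<open>Inserting the unit of the ring splits the action in the base category. This splitting is
  not linear in general, and cancellation does not ask for that.\<close>

lemma action_epi:
  assumes "f \<cdot> snd z = g \<cdot> snd z" "modl z" "f \<in> Arr C" "g \<in> Arr C" "Dom C f = fst z" "Dom C g = fst z"
  shows "f = g"
  by (rule section_epi[OF assms(1) unit_section[OF assms(2)]]) (use assms(2-) in auto)

lemma linI:
  "\<lbrakk>modl z; modl w; f \<in> Arr C; Dom C f = fst z; Cod C f = fst w; f \<cdot> snd z = snd w \<cdot> (R \<triangleright> f)\<rbrakk>
    \<Longrightarrow> lin z f w"
  by (simp add: lin_def is_module_arr_def)

lemma linD:
  assumes "lin z f w"
  shows "modl z" "modl w" "f \<in> Arr C" "Dom C f = fst z" "Cod C f = fst w"
    "f \<cdot> snd z = snd w \<cdot> (R \<triangleright> f)"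
  using assms by (auto simp: lin_def is_module_arr_def)

lemma lin_Ident: "modl z \<Longrightarrow> lin z (Ident C (fst z)) z"
  by (rule linI) auto

lemma lin_comp:
  assumes "lin z f w" "lin w g v"
  shows "lin z (g \<cdot> f) v"
proof -
  note [simp] = linD(1-5)[OF assms(1)] linD(1-5)[OF assms(2)]
  have "(g \<cdot> f) \<cdot> snd z = g \<cdot> snd w \<cdot> (R \<triangleright> f)"
    by (simp add: comp_assoc linD(6)[OF assms(1)])
  also have "\<dots> = snd v \<cdot> (R \<triangleright> (g \<cdot> f))"
    using comp_reassoc[OF linD(6)[OF assms(2)], of "R \<triangleright> f"] by (simp add: comp_norm)
  finally show ?thesis by (intro linI) auto
qed

lemma lin_inverse:
  assumes f: "lin z f w" and g: "g \<in> Arr C" "Dom C g = fst w" "Cod C g = fst z"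
    "g \<cdot> f = Ident C (fst z)" "f \<cdot> g = Ident C (fst w)"
  shows "lin w g z"
proof -
  note [simp] = linD(1-5)[OF f] g(1-3)
  have "(R \<triangleright> f) \<cdot> (R \<triangleright> g) = Ident C (R \<boxtimes> fst w)"
    using whisker_inverse(1)[OF g(5)] by simp
  moreover have "g \<cdot> (f \<cdot> (snd z \<cdot> (R \<triangleright> g))) = snd z \<cdot> (R \<triangleright> g)"
    using comp_reassoc[OF g(4), of "snd z \<cdot> (R \<triangleright> g)"] by simp
  moreover have "f \<cdot> (snd z \<cdot> (R \<triangleright> g)) = snd w \<cdot> ((R \<triangleright> f) \<cdot> (R \<triangleright> g))"
    using comp_reassoc[OF linD(6)[OF f], of "R \<triangleright> g"] by (simp add: comp_assoc)
  ultimately show ?thesis by (intro linI) auto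
qed

text \<open>Linearity descends along a linear split epimorphism even if its section \<open>s\<close>
  is not linear, since \<open>R \<triangleright> q\<close> is split by
  \<open>R \<triangleright> s\<close>.\<close>

lemma lin_epi_cancel:
  assumes q: "lin z q w" and gq: "lin z (g \<cdot> q) v"
    and s: "q \<cdot> s = Ident C (fst w)" "s \<in> Arr C" "Dom C s = fst w" "Cod C s = fst z"
    and g: "g \<in> Arr C" "Dom C g = fst w" "Cod C g = fst v"
  shows "lin w g v"
proof (rule linI)
  note [simp] = linD(1-5)[OF q] linD(2)[OF gq] g s(2-4)
  show "g \<cdot> snd w = snd v \<cdot> (R \<triangleright> g)"
  proof (rule section_epi[of _ "R \<triangleright> q" _ "R \<triangleright> s"])
    have "(g \<cdot> snd w) \<cdot> (R \<triangleright> q) = (g \<cdot> q) \<cdot> snd z"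
      by (simp add: comp_assoc linD(6)[OF q])
    also have "\<dots> = (snd v \<cdot> (R \<triangleright> g)) \<cdot> (R \<triangleright> q)"
      unfolding linD(6)[OF gq] by (simp add: comp_norm)
    finally show "(g \<cdot> snd w) \<cdot> (R \<triangleright> q) = (snd v \<cdot> (R \<triangleright> g)) \<cdot> (R \<triangleright> q)" .
    show "(R \<triangleright> q) \<cdot> (R \<triangleright> s) = Ident C (R \<boxtimes> fst w)"
      by (rule whisker_inverse(1)[OF s(1)]) auto
  qed auto
qed (use q gq g in \<open>auto dest: linD\<close>)

lemma lin_zero: "\<lbrakk>modl z; modl w\<rbrakk> \<Longrightarrow> lin z (ZeroArr C (fst z) (fst w)) w"
  by (rule linI) auto

lemma lin_Add:
  assumes "lin z f w" "lin z g w"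
  shows "lin z (Add C f g) w"
proof -
  note [simp] = linD(1-5)[OF assms(1)] linD(1-5)[OF assms(2)]
  show ?thesis
    by (rule linI) (simp_all add: Add_comp comp_Add lwhisker_Add[of R _ "fst z" "fst w"]
      linD(6)[OF assms(1)] linD(6)[OF assms(2)])
qed

lemma lin_neg:
  assumes "lin z f w"
  shows "lin z (neg_arr C f) w"
proof -
  note [simp] = linD(1-5)[OF assms(1)]
  have "R \<triangleright> neg_arr C f = neg_arr C (R \<triangleright> f)"
  proof (rule Add_eq_zeroD)
    show "Add C (R \<triangleright> neg_arr C f) (R \<triangleright> f) = ZeroArr C (R \<boxtimes> fst z) (R \<boxtimes> fst w)"
      using lwhisker_Add[of R "neg_arr C f" "fst z" "fst w" f, symmetric] by simp
  qed auto
  then show ?thesis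
    by (intro linI) (simp_all add: neg_comp comp_neg linD(6)[OF assms])
qed

lemma mten_fst [simp]: "fst (z \<star> y) = fst z \<boxtimes> y"
  by (simp add: mten_def)

lemma mten_snd: "snd (z \<star> y) = (snd z \<triangleleft> y) \<cdot> AssocI R (fst z) y"
  by (simp add: mten_def)

lemma mten_module [simp]:
  assumes [simp]: "modl z" "y \<in> Obj C"
  shows "modl (z \<star> y)"
  unfolding mten_def
proof (rule moduleI)
  let ?r = "(snd z \<triangleleft> y) \<cdot> AssocI R (fst z) y"
  have "?r \<cdot> (\<mu> \<triangleleft> (fst z \<boxtimes> y)) = ((snd z \<cdot> (\<mu> \<triangleleft> fst z)) \<triangleleft> y) \<cdot> AssocI (R \<boxtimes> R) (fst z) y"
    by (simp add: comp_norm coherence_nat)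
  also have "\<dots> = (snd z \<triangleleft> y) \<cdot> ((R \<triangleright> snd z) \<triangleleft> y) \<cdot> (Assoc C R R (fst z) \<triangleleft> y) \<cdot>
      AssocI (R \<boxtimes> R) (fst z) y"
    unfolding module_laws(1)[OF assms(1)] by (simp add: comp_norm)
  also have "\<dots> = ?r \<cdot> (R \<triangleright> ?r) \<cdot> Assoc C R R (fst z \<boxtimes> y)"
    by (simp add: comp_norm coherence_nat' pentagon2)
  finally show "?r \<cdot> (\<mu> \<triangleleft> (fst z \<boxtimes> y)) = ?r \<cdot> (R \<triangleright> ?r) \<cdot> Assoc C R R (fst z \<boxtimes> y)" .
  have "?r \<cdot> (\<eta> \<triangleleft> (fst z \<boxtimes> y)) = ((snd z \<cdot> (\<eta> \<triangleleft> fst z)) \<triangleleft> y) \<cdot> AssocI (UnitO C) (fst z) y"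
    by (simp add: comp_norm coherence_nat)
  then show "?r \<cdot> (\<eta> \<triangleleft> (fst z \<boxtimes> y)) = LUnit C (fst z \<boxtimes> y)"
    unfolding module_laws(2)[OF assms(1)] by (simp add: LUnit_tensor')
qed auto

lemma mten_lin_right:
  assumes "modl z" "f \<in> Arr C" "Dom C f = y" "Cod C f = y'"
  shows "lin (z \<star> y) (fst z \<triangleright> f) (z \<star> y')"
proof (rule linI)
  have ob: "y \<in> Obj C" "y' \<in> Obj C" using assms by auto
  show "(fst z \<triangleright> f) \<cdot> snd (z \<star> y) = snd (z \<star> y') \<cdot> (R \<triangleright> (fst z \<triangleright> f))"
  proof -
    have "(fst z \<triangleright> f) \<cdot> snd (z \<star> y) = ((fst z \<triangleright> f) \<cdot> (snd z \<triangleleft> y)) \<cdot> AssocI R (fst z) y"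
      using assms ob by (simp add: mten_snd comp_assoc)
    also have "\<dots> = ((snd z \<triangleleft> y') \<cdot> ((R \<boxtimes> fst z) \<triangleright> f)) \<cdot> AssocI R (fst z) y"
      using assms whisker_exchange[of "snd z" f] by simp
    also have "\<dots> = snd (z \<star> y') \<cdot> (R \<triangleright> (fst z \<triangleright> f))"
      using assms ob by (simp add: mten_snd comp_assoc coherence_nat)
    finally show ?thesis .
  qed
qed (use assms in auto)

lemma mten_lin_left:
  assumes f: "lin z f w" and [simp]: "y \<in> Obj C"
  shows "lin (z \<star> y) (f \<triangleleft> y) (w \<star> y)"
proof (rule linI)
  note [simp] = linD(1-5)[OF f]
  have "(f \<triangleleft> y) \<cdot> snd (z \<star> y) = ((f \<cdot> snd z) \<triangleleft> y) \<cdot> AssocI R (fst z) y"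
    by (simp add: mten_snd comp_norm)
  also have "\<dots> = snd (w \<star> y) \<cdot> (R \<triangleright> (f \<triangleleft> y))"
    unfolding linD(6)[OF f] by (simp add: mten_snd comp_norm coherence_nat)
  finally show "(f \<triangleleft> y) \<cdot> snd (z \<star> y) = snd (w \<star> y) \<cdot> (R \<triangleright> (f \<triangleleft> y))" .
qed (use linD(1-5)[OF f] in auto)

lemma mten_Assoc_lin:
  assumes [simp]: "modl z" "y \<in> Obj C" "y' \<in> Obj C"
  shows "lin (z \<star> y \<star> y') (Assoc C (fst z) y y') (z \<star> (y \<boxtimes> y'))"
proof (rule linI)
  have "Assoc C (fst z) y y' \<cdot> snd (z \<star> y \<star> y') = (snd z \<triangleleft> (y \<boxtimes> y')) \<cdot>
      (Assoc C (R \<boxtimes> fst z) y y' \<cdot> (AssocI R (fst z) y \<triangleleft> y') \<cdot> AssocI R (fst z \<boxtimes> y) y')"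
    by (simp add: mten_snd comp_norm coherence_nat')
  also have "\<dots> = snd (z \<star> (y \<boxtimes> y')) \<cdot> (R \<triangleright> Assoc C (fst z) y y')"
    by (simp add: pentagon3 mten_snd comp_assoc)
  finally show "Assoc C (fst z) y y' \<cdot> snd (z \<star> y \<star> y') =
    snd (z \<star> (y \<boxtimes> y')) \<cdot> (R \<triangleright> Assoc C (fst z) y y')" .
qed auto

lemma mten_AssocI_lin:
  assumes [simp]: "modl z" "y \<in> Obj C" "y' \<in> Obj C"
  shows "lin (z \<star> (y \<boxtimes> y')) (AssocI (fst z) y y') (z \<star> y \<star> y')"
  by (rule lin_inverse[OF mten_Assoc_lin]) auto

lemma act_lin: "modl z \<Longrightarrow> lin (U \<star> fst z) (snd z) z"
  by (rule linI) (auto simp: mten_snd module_assoc)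

lemma ract_simps [simp]:
  assumes "modl b"
  shows "ract b \<in> Arr C" "Dom C (ract b) = fst b \<boxtimes> R" "Cod C (ract b) = fst b"
  using assms by (auto simp: ract_def)

text \<open>In elements \<open>(a m) a' = a (m a')\<close>. The right action being the left one
  after a swap, this rests on commutativity of the ring.\<close>

lemma ract_lin:
  assumes [simp]: "modl b"
  shows "lin (b \<star> R) (ract b) b"
proof (rule linI)
  let ?B = "Braid C"
  have "ract b \<cdot> snd (b \<star> R) = (snd b \<cdot> (R \<triangleright> snd b)) \<cdot> ?B (R \<boxtimes> fst b) R \<cdot> AssocI R (fst b) R"
    by (simp add: ract_def mten_snd comp_norm coherence_nat')
  also have "\<dots> = snd b \<cdot> ((\<mu> \<cdot> ?B R R) \<triangleleft> fst b) \<cdot> AssocI R R (fst b) \<cdot> ?B (R \<boxtimes> fst b) R \<cdot>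
      AssocI R (fst b) R"
    by (simp add: module_assoc ring_laws(3) comp_assoc)
  also have "\<dots> = snd b \<cdot> (\<mu> \<triangleleft> fst b) \<cdot> ((?B R R \<triangleleft> fst b) \<cdot> AssocI R R (fst b) \<cdot>
      ?B (R \<boxtimes> fst b) R) \<cdot> AssocI R (fst b) R"
    by (simp add: comp_norm)
  also have "\<dots> = (snd b \<cdot> (\<mu> \<triangleleft> fst b) \<cdot> AssocI R R (fst b)) \<cdot> (R \<triangleright> ?B (fst b) R)"
    by (simp add: Braid_tensor_swap comp_assoc)
  also have "\<dots> = snd b \<cdot> (R \<triangleright> ract b)"
    by (simp add: ract_def comp_norm flip: module_assoc)
  finally show "ract b \<cdot> snd (b \<star> R) = snd b \<cdot> (R \<triangleright> ract b)" .
qed auto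

text \<open>Swapping turns \<open>(m a) a'\<close> into \<open>a' (a m)\<close>, and commutativity
  restores the order of the product; \<open>yang_baxter\<close> matches the two ways of permuting
  the factors.\<close>

lemma ract_assoc:
  assumes [simp]: "modl b"
  shows "ract b \<cdot> (ract b \<triangleleft> R) = ract b \<cdot> (fst b \<triangleright> \<mu>) \<cdot> Assoc C (fst b) R R"
proof -
  let ?B = "Braid C"
  have "ract b \<cdot> (ract b \<triangleleft> R) = (snd b \<cdot> (R \<triangleright> snd b)) \<cdot> (R \<triangleright> ?B (fst b) R) \<cdot> ?B (fst b \<boxtimes> R) R"
    by (simp add: ract_def comp_norm coherence_nat coherence_nat')
  also have "\<dots> = snd b \<cdot> (\<mu> \<triangleleft> fst b) \<cdot> (AssocI R R (fst b) \<cdot> (R \<triangleright> ?B (fst b) R) \<cdot> ?B (fst b \<boxtimes> R) R)"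
    by (simp add: module_assoc comp_assoc)
  also have "\<dots> = snd b \<cdot> ((\<mu> \<cdot> ?B R R) \<triangleleft> fst b) \<cdot> ?B (fst b) (R \<boxtimes> R) \<cdot> Assoc C (fst b) R R"
    by (simp add: yang_baxter comp_norm)
  also have "\<dots> = ract b \<cdot> (fst b \<triangleright> \<mu>) \<cdot> Assoc C (fst b) R R"
    unfolding ring_laws(3) by (simp add: ract_def comp_norm coherence_nat')
  finally show ?thesis .
qed

lemma al_simps [simp]:
  assumes "modl b" "y \<in> Obj C"
  shows "al b y \<in> Arr C" "Dom C (al b y) = fst b \<boxtimes> (R \<boxtimes> y)" "Cod C (al b y) = fst b \<boxtimes> y"
  using assms by (auto simp: al_def)

lemma al_lin:
  assumes [simp]: "modl b" "y \<in> Obj C"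
  shows "lin (b \<star> (R \<boxtimes> y)) (al b y) (b \<star> y)"
  unfolding al_def
  by (rule lin_comp[OF mten_AssocI_lin mten_lin_left[OF ract_lin]]) auto

lemma al_nat:
  assumes "modl b" "f \<in> Arr C" "Dom C f = y" "Cod C f = y'"
  shows "al b y' \<cdot> (fst b \<triangleright> (R \<triangleright> f)) = (fst b \<triangleright> f) \<cdot> al b y"
proof -
  have ob: "y \<in> Obj C" "y' \<in> Obj C" using assms by auto
  have "al b y' \<cdot> (fst b \<triangleright> (R \<triangleright> f)) = ((ract b \<triangleleft> y') \<cdot> ((fst b \<boxtimes> R) \<triangleright> f)) \<cdot> AssocI (fst b) R y"
    using assms ob by (simp add: al_def comp_assoc coherence_nat)
  also have "\<dots> = ((fst b \<triangleright> f) \<cdot> (ract b \<triangleleft> y)) \<cdot> AssocI (fst b) R y"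
    using assms whisker_exchange[of "ract b" f] by simp
  also have "\<dots> = (fst b \<triangleright> f) \<cdot> al b y" using assms ob by (simp add: al_def comp_assoc)
  finally show ?thesis .
qed

text \<open>In elements \<open>(m a) a' \<otimes> n = m (a a') \<otimes> n\<close>: this is
  \<open>ract_assoc\<close> carried along a spectator \<open>y\<close>.\<close>

lemma al_al:
  assumes [simp]: "modl b" "y \<in> Obj C"
  shows "al b y \<cdot> al b (R \<boxtimes> y) = al b y \<cdot> (fst b \<triangleright> snd (U \<star> y))"
proof -
  have "al b y \<cdot> al b (R \<boxtimes> y) =
      ((ract b \<cdot> (ract b \<triangleleft> R)) \<triangleleft> y) \<cdot> AssocI (fst b \<boxtimes> R) R y \<cdot> AssocI (fst b) R (R \<boxtimes> y)"
    by (simp add: al_def comp_norm coherence_nat')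
  also have "\<dots> = (ract b \<triangleleft> y) \<cdot> ((fst b \<triangleright> \<mu>) \<triangleleft> y) \<cdot>
      ((Assoc C (fst b) R R \<triangleleft> y) \<cdot> AssocI (fst b \<boxtimes> R) R y) \<cdot> AssocI (fst b) R (R \<boxtimes> y)"
    unfolding ract_assoc[OF assms(1)] by (simp add: comp_norm)
  also have "\<dots> = al b y \<cdot> (fst b \<triangleright> snd (U \<star> y))"
    by (simp add: pentagon2 al_def mten_snd comp_norm coherence_nat')
  finally show ?thesis .
qed

lemma mod_susp_fst [simp]: "fst (mod_susp C A z) = SuspO C (fst z)"
  by (simp add: mod_susp_def)

lemma mod_susp_snd: "snd (mod_susp C A z) = SuspA C (snd z) \<cdot> TenSusp C R (fst z)"
  by (simp add: mod_susp_def)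

text \<open>The compatibilities \<open>TenSusp_assoc\<close> and \<open>TenSusp_unit\<close> turn
  the module laws of \<open>z\<close> into those of its suspension.\<close>

lemma mod_susp_module [simp]:
  assumes [simp]: "modl z"
  shows "modl (mod_susp C A z)"
  unfolding mod_susp_def
proof (rule moduleI)
  let ?T = "TenSusp C" and ?x = "fst z" and ?r = "SuspA C (snd z) \<cdot> TenSusp C R (fst z)"
  have "?r \<cdot> (\<mu> \<triangleleft> SuspO C ?x) = SuspA C (snd z \<cdot> (\<mu> \<triangleleft> ?x)) \<cdot> ?T (R \<boxtimes> R) ?x"
    by (simp add: comp_assoc SuspA_comp TenSusp_nat1)
  also have "\<dots> = SuspA C (snd z) \<cdot> SuspA C (R \<triangleright> snd z) \<cdot> (SuspA C (Assoc C R R ?x) \<cdot> ?T (R \<boxtimes> R) ?x)"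
    unfolding module_laws(1)[OF assms] by (simp add: comp_assoc SuspA_comp)
  also have "\<dots> = ?r \<cdot> (R \<triangleright> ?r) \<cdot> Assoc C R R (SuspO C ?x)"
    by (simp add: TenSusp_assoc comp_norm TenSusp_nat2[THEN comp_reassoc])
  finally show "?r \<cdot> (\<mu> \<triangleleft> SuspO C ?x) = ?r \<cdot> (R \<triangleright> ?r) \<cdot> Assoc C R R (SuspO C ?x)" .
  have "?r \<cdot> (\<eta> \<triangleleft> SuspO C ?x) = SuspA C (snd z \<cdot> (\<eta> \<triangleleft> ?x)) \<cdot> ?T (UnitO C) ?x"
    by (simp add: comp_assoc SuspA_comp TenSusp_nat1)
  then show "?r \<cdot> (\<eta> \<triangleleft> SuspO C ?x) = LUnit C (SuspO C ?x)"
    unfolding module_laws(2)[OF assms] by (simp add: TenSusp_unit)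
qed auto

lemma lin_susp:
  assumes f: "lin z f w"
  shows "lin (mod_susp C A z) (SuspA C f) (mod_susp C A w)"
proof (rule linI)
  note [simp] = linD(1-5)[OF f]
  have "SuspA C f \<cdot> snd (mod_susp C A z) = SuspA C (f \<cdot> snd z) \<cdot> TenSusp C R (fst z)"
    by (simp add: mod_susp_snd comp_assoc SuspA_comp)
  also have "\<dots> = snd (mod_susp C A w) \<cdot> (R \<triangleright> SuspA C f)"
    unfolding linD(6)[OF f] by (simp add: mod_susp_snd comp_assoc SuspA_comp TenSusp_nat2)
  finally show "SuspA C f \<cdot> snd (mod_susp C A z) = snd (mod_susp C A w) \<cdot> (R \<triangleright> SuspA C f)" .
qed (use linD(1-5)[OF f] in auto)

lemma TenSusp_lin:
  assumes [simp]: "modl b" "y \<in> Obj C"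
  shows "lin (b \<star> SuspO C y) (TenSusp C (fst b) y) (mod_susp C A (b \<star> y))"
proof (rule linI)
  have "TenSusp C (fst b) y \<cdot> snd (b \<star> SuspO C y) =
      SuspA C (snd b \<triangleleft> y) \<cdot> (TenSusp C (R \<boxtimes> fst b) y \<cdot> AssocI R (fst b) (SuspO C y))"
    by (simp add: mten_snd comp_assoc TenSusp_nat1[THEN comp_reassoc])
  also have "\<dots> = snd (mod_susp C A (b \<star> y)) \<cdot> (R \<triangleright> TenSusp C (fst b) y)"
    by (simp add: TenSusp_AssocI mod_susp_snd mten_snd comp_assoc SuspA_comp)
  finally show "TenSusp C (fst b) y \<cdot> snd (b \<star> SuspO C y) =
      snd (mod_susp C A (b \<star> y)) \<cdot> (R \<triangleright> TenSusp C (fst b) y)" .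
qed auto

lemma al_susp:
  assumes [simp]: "modl b" "y \<in> Obj C"
  shows "SuspA C (al b y) \<cdot> TenSusp C (fst b) (R \<boxtimes> y) \<cdot> (fst b \<triangleright> TenSusp C R y) =
    TenSusp C (fst b) y \<cdot> al b (SuspO C y)"
proof -
  have "TenSusp C (fst b) y \<cdot> al b (SuspO C y) = SuspA C (ract b \<triangleleft> y) \<cdot>
      (TenSusp C (fst b \<boxtimes> R) y \<cdot> AssocI (fst b) R (SuspO C y))"
    by (simp add: al_def comp_assoc TenSusp_nat1[THEN comp_reassoc])
  then show ?thesis
    by (simp add: TenSusp_AssocI al_def comp_assoc SuspA_comp)
qed

section \<open>Twists by ring endomorphisms\<close>

lemma ring_homD:
  assumes "is_ring_hom C A A \<gamma>"
  shows "\<gamma> \<in> Arr C" "Dom C \<gamma> = R" "Cod C \<gamma> = R" "\<gamma> \<cdot> \<mu> = \<mu> \<cdot> (\<gamma> \<odot> \<gamma>)" "\<gamma> \<cdot> \<eta> = \<eta>"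
  using assms by (auto simp: is_ring_hom_def)

lemma tw_fst [simp]: "fst (tw \<gamma> z) = fst z"
  by (simp add: tw_def)

lemma tw_snd: "snd (tw \<gamma> z) = snd z \<cdot> (\<gamma> \<triangleleft> fst z)"
  by (simp add: tw_def)

lemma tw_module [simp]:
  assumes \<gamma>: "is_ring_hom C A A \<gamma>" and [simp]: "modl z"
  shows "modl (tw \<gamma> z)"
  unfolding tw_def
proof (rule moduleI)
  note [simp] = ring_homD(1-3)[OF \<gamma>]
  let ?x = "fst z" and ?r = "snd z \<cdot> (\<gamma> \<triangleleft> fst z)"
  have gg: "\<gamma> \<odot> \<gamma> = (R \<triangleright> \<gamma>) \<cdot> (\<gamma> \<triangleleft> R)"
    using TenA_Comp[of \<gamma> R R "Ident C R" R "Ident C R" R R \<gamma> R] by simp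
  have "?r \<cdot> (\<mu> \<triangleleft> ?x) = snd z \<cdot> ((\<gamma> \<cdot> \<mu>) \<triangleleft> ?x)" by (simp add: comp_norm)
  also have "\<dots> = (snd z \<cdot> (\<mu> \<triangleleft> ?x)) \<cdot> ((R \<triangleright> \<gamma>) \<triangleleft> ?x) \<cdot> ((\<gamma> \<triangleleft> R) \<triangleleft> ?x)"
    unfolding ring_homD(4)[OF \<gamma>] gg by (simp add: comp_norm)
  also have "\<dots> = snd z \<cdot> (R \<triangleright> snd z) \<cdot> (R \<triangleright> (\<gamma> \<triangleleft> ?x)) \<cdot> (\<gamma> \<triangleleft> (R \<boxtimes> ?x)) \<cdot> Assoc C R R ?x"
    by (simp add: module_laws(1) comp_norm coherence_nat coherence_nat')
  also have "(R \<triangleright> (\<gamma> \<triangleleft> ?x)) \<cdot> (\<gamma> \<triangleleft> (R \<boxtimes> ?x)) \<cdot> Assoc C R R ?x =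
      ((\<gamma> \<triangleleft> (R \<boxtimes> ?x)) \<cdot> (R \<triangleright> (\<gamma> \<triangleleft> ?x))) \<cdot> Assoc C R R ?x"
    using whisker_exchange[of \<gamma> "\<gamma> \<triangleleft> ?x"] by (simp add: comp_assoc)
  also have "(R \<triangleright> snd z) \<cdot> \<dots> = ((R \<triangleright> snd z) \<cdot> (\<gamma> \<triangleleft> (R \<boxtimes> ?x))) \<cdot> (R \<triangleright> (\<gamma> \<triangleleft> ?x)) \<cdot> Assoc C R R ?x"
    by (simp add: comp_assoc)
  also have "(R \<triangleright> snd z) \<cdot> (\<gamma> \<triangleleft> (R \<boxtimes> ?x)) = (\<gamma> \<triangleleft> ?x) \<cdot> (R \<triangleright> snd z)"
    using whisker_exchange[of \<gamma> "snd z"] by simp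
  also have "snd z \<cdot> ((\<gamma> \<triangleleft> ?x) \<cdot> (R \<triangleright> snd z)) \<cdot> (R \<triangleright> (\<gamma> \<triangleleft> ?x)) \<cdot> Assoc C R R ?x =
      ?r \<cdot> (R \<triangleright> ?r) \<cdot> Assoc C R R ?x"
    by (simp add: comp_norm)
  finally show "?r \<cdot> (\<mu> \<triangleleft> ?x) = ?r \<cdot> (R \<triangleright> ?r) \<cdot> Assoc C R R ?x" .
  have "?r \<cdot> (\<eta> \<triangleleft> ?x) = snd z \<cdot> ((\<gamma> \<cdot> \<eta>) \<triangleleft> ?x)" by (simp add: comp_norm)
  then show "?r \<cdot> (\<eta> \<triangleleft> ?x) = LUnit C ?x"
    unfolding ring_homD(5)[OF \<gamma>] by (simp add: module_laws(2))
qed (use ring_homD(1-3)[OF \<gamma>] in auto)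

lemma tw_lin:
  assumes \<gamma>: "is_ring_hom C A A \<gamma>" and f: "lin z f w"
  shows "lin (tw \<gamma> z) f (tw \<gamma> w)"
proof (rule linI)
  note [simp] = ring_homD(1-3)[OF \<gamma>] linD(1-5)[OF f]
  have "f \<cdot> snd (tw \<gamma> z) = (f \<cdot> snd z) \<cdot> (\<gamma> \<triangleleft> fst z)" by (simp add: tw_snd comp_assoc)
  also have "\<dots> = snd w \<cdot> ((R \<triangleright> f) \<cdot> (\<gamma> \<triangleleft> fst z))"
    unfolding linD(6)[OF f] by (simp add: comp_assoc)
  also have "(R \<triangleright> f) \<cdot> (\<gamma> \<triangleleft> fst z) = (\<gamma> \<triangleleft> fst w) \<cdot> (R \<triangleright> f)"
    using whisker_exchange[of \<gamma> f] by simp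
  also have "snd w \<cdot> \<dots> = snd (tw \<gamma> w) \<cdot> (R \<triangleright> f)" by (simp add: tw_snd comp_assoc)
  finally show "f \<cdot> snd (tw \<gamma> z) = snd (tw \<gamma> w) \<cdot> (R \<triangleright> f)" .
qed (use \<gamma> f in \<open>auto dest: linD\<close>)

lemma tw_mten:
  assumes \<gamma>: "is_ring_hom C A A \<gamma>" and [simp]: "modl z" "y \<in> Obj C"
  shows "tw \<gamma> (z \<star> y) = tw \<gamma> z \<star> y"
  using ring_homD(1-3)[OF \<gamma>]
  by (intro prod_eqI) (simp_all add: tw_snd mten_snd comp_norm coherence_nat)

lemma tw_susp:
  assumes \<gamma>: "is_ring_hom C A A \<gamma>" and [simp]: "modl z"
  shows "tw \<gamma> (mod_susp C A z) = mod_susp C A (tw \<gamma> z)"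
  using ring_homD(1-3)[OF \<gamma>]
  by (intro prod_eqI) (simp_all add: tw_snd mod_susp_snd comp_assoc SuspA_comp TenSusp_nat1)

lemma tw_tw:
  assumes \<gamma>: "is_ring_hom C A A \<gamma>" and \<delta>: "is_ring_hom C A A \<delta>" and [simp]: "modl z"
  shows "tw \<gamma> (tw \<delta> z) = tw (\<delta> \<cdot> \<gamma>) z"
  using ring_homD(1-3)[OF \<gamma>] ring_homD(1-3)[OF \<delta>]
  by (intro prod_eqI) (simp_all add: tw_snd comp_norm)

lemma tw_Ident [simp]: "modl z \<Longrightarrow> tw (Ident C R) z = z"
  by (intro prod_eqI) (simp_all add: tw_snd)

text \<open>Reduces balancing over a twisted module to balancing over the original one, with
  \<open>\<gamma>\<close> applied to the scalar in the middle.\<close>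

lemma al_tw:
  assumes \<gamma>: "is_ring_hom C A A \<gamma>" and [simp]: "modl b" "y \<in> Obj C"
  shows "al (tw \<gamma> b) y = al b y \<cdot> (fst b \<triangleright> (\<gamma> \<triangleleft> y))"
proof -
  note [simp] = ring_homD(1-3)[OF \<gamma>]
  have "ract (tw \<gamma> b) = ract b \<cdot> (fst b \<triangleright> \<gamma>)"
    by (simp add: ract_def tw_snd comp_assoc coherence_nat)
  then show ?thesis by (simp add: al_def comp_norm coherence_nat)
qed

lemma al_U:
  assumes [simp]: "y \<in> Obj C"
  shows "al U y = snd (U \<star> y)"
  by (simp add: al_def ract_def mten_snd ring_laws(3))

section \<open>Splitting idempotents of modules\<close>

text \<open>The idempotent is split in the base category; the laws for the action transported to its
  image are checked after precomposition with tensor multiples of the split epimorphism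
  \<open>q\<close>. The last claim gives the action in the shape in which \<open>ten_action\<close>
  defines it.\<close>

lemma split_module:
  assumes e: "lin v e v" and q: "q \<in> Arr C" "Dom C q = fst v" "Cod C q = x"
    and i: "i \<in> Arr C" "Dom C i = x" "Cod C i = fst v"
    and qi: "q \<cdot> i = Ident C x" "i \<cdot> q = e"
  defines "w \<equiv> (x, q \<cdot> snd v \<cdot> (R \<triangleright> i))"
  shows "modl w" "lin v q w" "lin w i v" "factor C (R \<triangleright> q) (q \<cdot> snd v) = snd w"
proof -
  note [simp] = linD(1-5)[OF e] q i
  have [simp]: "x \<in> Obj C" using Cod_in_Obj[OF q(1)] by (simp only: q(3))
  have Rqi: "(R \<triangleright> q) \<cdot> (R \<triangleright> i) = Ident C (R \<boxtimes> x)"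
    by (rule whisker_inverse(1)[OF qi(1)]) auto
  have qe: "q \<cdot> e = q"
  proof -
    have "q \<cdot> e = (q \<cdot> i) \<cdot> q" unfolding qi(2)[symmetric] by (rule comp_assoc[symmetric]) auto
    then show ?thesis by (simp add: qi(1))
  qed
  have [simp]: "fst w = x" "snd w \<in> Arr C" "Dom C (snd w) = R \<boxtimes> x" "Cod C (snd w) = x"
    by (auto simp: w_def)
  have wq: "snd w \<cdot> (R \<triangleright> q) = q \<cdot> snd v"
  proof -
    have "snd w \<cdot> (R \<triangleright> q) = q \<cdot> (snd v \<cdot> (R \<triangleright> (i \<cdot> q)))" by (simp add: w_def comp_norm)
    also have "\<dots> = q \<cdot> (e \<cdot> snd v)" by (simp add: qi(2) linD(6)[OF e])
    also have "\<dots> = (q \<cdot> e) \<cdot> snd v" by (rule comp_assoc[symmetric]) auto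
    finally show ?thesis by (simp add: qe)
  qed
  note wq' = comp_reassoc[OF wq]
  have "modl (x, snd w)"
  proof (rule moduleI)
    show "snd w \<cdot> (\<mu> \<triangleleft> x) = snd w \<cdot> (R \<triangleright> snd w) \<cdot> Assoc C R R x"
    proof (rule section_epi[of _ "(R \<boxtimes> R) \<triangleright> q" _ "(R \<boxtimes> R) \<triangleright> i"])
      have "(snd w \<cdot> (\<mu> \<triangleleft> x)) \<cdot> ((R \<boxtimes> R) \<triangleright> q) = snd w \<cdot> ((\<mu> \<triangleleft> x) \<cdot> ((R \<boxtimes> R) \<triangleright> q))"
        by (simp add: comp_assoc)
      also have "(\<mu> \<triangleleft> x) \<cdot> ((R \<boxtimes> R) \<triangleright> q) = (R \<triangleright> q) \<cdot> (\<mu> \<triangleleft> fst v)"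
        using whisker_exchange[of \<mu> q] by simp
      also have "snd w \<cdot> \<dots> = q \<cdot> (snd v \<cdot> (\<mu> \<triangleleft> fst v))" by (simp add: wq' comp_assoc)
      also have "\<dots> = (q \<cdot> snd v) \<cdot> (R \<triangleright> snd v) \<cdot> Assoc C R R (fst v)"
        by (simp add: module_laws(1) comp_assoc)
      also have "\<dots> = snd w \<cdot> (R \<triangleright> (q \<cdot> snd v)) \<cdot> Assoc C R R (fst v)"
        by (simp add: wq' comp_norm)
      also have "\<dots> = (snd w \<cdot> (R \<triangleright> snd w) \<cdot> Assoc C R R x) \<cdot> ((R \<boxtimes> R) \<triangleright> q)"
        unfolding wq[symmetric] by (simp add: comp_norm coherence_nat)
      finally show "(snd w \<cdot> (\<mu> \<triangleleft> x)) \<cdot> ((R \<boxtimes> R) \<triangleright> q) =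
        (snd w \<cdot> (R \<triangleright> snd w) \<cdot> Assoc C R R x) \<cdot> ((R \<boxtimes> R) \<triangleright> q)" .
      show "((R \<boxtimes> R) \<triangleright> q) \<cdot> ((R \<boxtimes> R) \<triangleright> i) = Ident C ((R \<boxtimes> R) \<boxtimes> x)"
        by (rule whisker_inverse(1)[OF qi(1)]) auto
    qed auto
    show "snd w \<cdot> (\<eta> \<triangleleft> x) = LUnit C x"
    proof (rule section_epi[of _ "UnitO C \<triangleright> q" _ "UnitO C \<triangleright> i"])
      have "(snd w \<cdot> (\<eta> \<triangleleft> x)) \<cdot> (UnitO C \<triangleright> q) = snd w \<cdot> ((\<eta> \<triangleleft> x) \<cdot> (UnitO C \<triangleright> q))"
        by (simp add: comp_assoc)
      also have "(\<eta> \<triangleleft> x) \<cdot> (UnitO C \<triangleright> q) = (R \<triangleright> q) \<cdot> (\<eta> \<triangleleft> fst v)"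
        using whisker_exchange[of \<eta> q] by simp
      also have "snd w \<cdot> \<dots> = q \<cdot> (snd v \<cdot> (\<eta> \<triangleleft> fst v))" by (simp add: wq' comp_assoc)
      also have "\<dots> = LUnit C x \<cdot> (UnitO C \<triangleright> q)" by (simp add: module_laws(2) LUnit_nat)
      finally show "(snd w \<cdot> (\<eta> \<triangleleft> x)) \<cdot> (UnitO C \<triangleright> q) = LUnit C x \<cdot> (UnitO C \<triangleright> q)" .
      show "(UnitO C \<triangleright> q) \<cdot> (UnitO C \<triangleright> i) = Ident C (UnitO C \<boxtimes> x)"
        by (rule whisker_inverse(1)[OF qi(1)]) auto
    qed auto
  qed auto
  then show m: "modl w" by (simp add: w_def)
  show q: "lin v q w" by (rule linI) (use m wq in auto)
  show "lin w i v"
    by (rule lin_epi_cancel[OF q, of _ _ i]) (use e qi in auto)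
  show "factor C (R \<triangleright> q) (q \<cdot> snd v) = snd w"
    by (rule factor_eq[of _ "R \<triangleright> i"]) (use Rqi wq in auto)
qed

end

section \<open>Separable rings\<close>

text \<open>Write \<open>\<sigma> 1\<close> as a sum of terms \<open>c \<otimes> d\<close>. The two
  expressions for \<open>\<sigma> \<cdot> \<mu>\<close> say that the sums of
  \<open>a c \<otimes> d\<close> and of \<open>c \<otimes> d a\<close> coincide, so
  \<open>\<sigma> 1\<close> is a separability idempotent.\<close>

locale separable_ring = tt_ring C A
  for C :: "('o, 'm, 'z) tt_scheme" (structure) and A :: "('o, 'm) ring_obj" +
  fixes \<sigma> :: 'm
  assumes section_Hom: "\<sigma> \<in> Hom C R (R \<boxtimes> R)"
    and section_mu: "\<mu> \<cdot> \<sigma> = Ident C R"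
    and section_left: "\<sigma> \<cdot> \<mu> = (\<mu> \<triangleleft> R) \<cdot> AssocI R R R \<cdot> (R \<triangleright> \<sigma>)"
    and section_right: "\<sigma> \<cdot> \<mu> = (R \<triangleright> \<mu>) \<cdot> Assoc C R R R \<cdot> (\<sigma> \<triangleleft> R)"
begin

text \<open>Writing \<open>\<sigma> 1 = \<Sum>\<^sub>i c\<^sub>i \<otimes> d\<^sub>i\<close>, the map \<open>sg z\<close> is \<open>n \<mapsto> \<Sum>\<^sub>i c\<^sub>i \<otimes> d\<^sub>i n\<close>; it exhibits every module as a
  retract of a free one.\<close>

definition cosec :: "'o \<Rightarrow> 'm" where
  "cosec y = Assoc C R R y \<cdot> (\<sigma> \<triangleleft> y)"

definition sg :: "('o, 'm) modl \<Rightarrow> 'm" where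
  "sg z = (R \<triangleright> snd z) \<cdot> cosec (fst z) \<cdot> (\<eta> \<triangleleft> fst z) \<cdot> LUnitI (fst z)"

lemma section_simps [simp]: "\<sigma> \<in> Arr C" "Dom C \<sigma> = R" "Cod C \<sigma> = R \<boxtimes> R"
  using section_Hom by auto

lemma section_lin: "lin U \<sigma> (U \<star> R)"
  by (rule linI) (auto simp: mten_snd section_left comp_assoc)

lemma cosec_simps [simp]:
  assumes "y \<in> Obj C"
  shows "cosec y \<in> Arr C" "Dom C (cosec y) = R \<boxtimes> y" "Cod C (cosec y) = R \<boxtimes> (R \<boxtimes> y)"
  using assms by (auto simp: cosec_def)

lemma cosec_lin:
  assumes "y \<in> Obj C"
  shows "lin (U \<star> y) (cosec y) (U \<star> (R \<boxtimes> y))"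
  unfolding cosec_def
  by (rule lin_comp[OF mten_lin_left[OF section_lin assms]])
    (use mten_Assoc_lin[of U R y] assms in simp)

lemma cosec_nat:
  assumes "f \<in> Arr C" "Dom C f = y" "Cod C f = y'"
  shows "cosec y' \<cdot> (R \<triangleright> f) = (R \<triangleright> (R \<triangleright> f)) \<cdot> cosec y"
proof -
  have ob: "y \<in> Obj C" "y' \<in> Obj C" using assms by auto
  have "cosec y' \<cdot> (R \<triangleright> f) = Assoc C R R y' \<cdot> ((\<sigma> \<triangleleft> y') \<cdot> (R \<triangleright> f))"
    using assms ob by (simp add: cosec_def comp_assoc)
  also have "(\<sigma> \<triangleleft> y') \<cdot> (R \<triangleright> f) = ((R \<boxtimes> R) \<triangleright> f) \<cdot> (\<sigma> \<triangleleft> y)"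
    using assms by (intro whisker_exchange) auto
  finally show ?thesis
    using assms ob by (simp add: cosec_def comp_assoc coherence_nat coherence_nat')
qed

lemma act_cosec:
  assumes [simp]: "y \<in> Obj C"
  shows "snd (U \<star> y) \<cdot> cosec y = Ident C (R \<boxtimes> y)"
  using section_mu by (simp add: mten_snd cosec_def comp_assoc flip: rwhisker_comp)

text \<open>Right linearity of \<open>\<sigma>\<close>, carried along the spectator
  \<open>y\<close>.\<close>

lemma cosec_right:
  assumes [simp]: "y \<in> Obj C"
  shows "(R \<triangleright> snd (U \<star> y)) \<cdot> cosec (R \<boxtimes> y) = cosec y \<cdot> snd (U \<star> y)"
proof -
  have "cosec y \<cdot> snd (U \<star> y) = Assoc C R R y \<cdot> ((\<sigma> \<cdot> \<mu>) \<triangleleft> y) \<cdot> AssocI R R y"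
    by (simp add: cosec_def mten_snd comp_norm)
  also have "\<dots> = (R \<triangleright> (\<mu> \<triangleleft> y)) \<cdot> Assoc C R (R \<boxtimes> R) y \<cdot> (Assoc C R R R \<triangleleft> y) \<cdot>
      ((\<sigma> \<triangleleft> R) \<triangleleft> y) \<cdot> AssocI R R y"
    unfolding section_right by (simp add: comp_norm coherence_nat')
  also have "\<dots> = (R \<triangleright> (\<mu> \<triangleleft> y)) \<cdot> Assoc C R (R \<boxtimes> R) y \<cdot>
      ((Assoc C R R R \<triangleleft> y) \<cdot> AssocI (R \<boxtimes> R) R y) \<cdot> (\<sigma> \<triangleleft> (R \<boxtimes> y))"
    by (simp add: comp_norm coherence_nat)
  also have "\<dots> = (R \<triangleright> snd (U \<star> y)) \<cdot> cosec (R \<boxtimes> y)"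
    by (simp add: pentagon2 cosec_def mten_snd comp_norm)
  finally show ?thesis ..
qed

lemma sg_simps [simp]:
  assumes "modl z"
  shows "sg z \<in> Arr C" "Dom C (sg z) = fst z" "Cod C (sg z) = R \<boxtimes> fst z"
  using assms by (auto simp: sg_def)

text \<open>After precomposition with the action, \<open>sg z\<close> has an expression without the
  unit: \<open>a \<otimes> n\<close> goes to the sum of \<open>c \<otimes> d a n\<close>, which is
  computed from \<open>\<sigma> a\<close> by right linearity. As the action is a split epimorphism,
  the further properties of \<open>sg\<close> are verified through this formula.\<close>

lemma sg_act:
  assumes [simp]: "modl z"
  shows "sg z \<cdot> snd z = (R \<triangleright> snd z) \<cdot> cosec (fst z)"
proof -
  let ?x = "fst z" and ?u = "(\<eta> \<triangleleft> (R \<boxtimes> fst z)) \<cdot> LUnitI (R \<boxtimes> fst z)"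
  have "(\<eta> \<triangleleft> ?x) \<cdot> LUnitI ?x \<cdot> snd z = ((\<eta> \<triangleleft> ?x) \<cdot> (UnitO C \<triangleright> snd z)) \<cdot> LUnitI (R \<boxtimes> ?x)"
    by (simp add: LUnitI_nat comp_assoc)
  also have "(\<eta> \<triangleleft> ?x) \<cdot> (UnitO C \<triangleright> snd z) = (R \<triangleright> snd z) \<cdot> (\<eta> \<triangleleft> (R \<boxtimes> ?x))"
    by (rule whisker_exchange) auto
  finally have "sg z \<cdot> snd z = (R \<triangleright> snd z) \<cdot> (cosec ?x \<cdot> (R \<triangleright> snd z)) \<cdot> ?u"
    by (simp add: sg_def comp_assoc)
  also have "\<dots> = (R \<triangleright> (snd z \<cdot> (R \<triangleright> snd z))) \<cdot> cosec (R \<boxtimes> ?x) \<cdot> ?u"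
    by (simp add: cosec_nat comp_norm)
  also have "\<dots> = (R \<triangleright> snd z) \<cdot> ((R \<triangleright> snd (U \<star> ?x)) \<cdot> cosec (R \<boxtimes> ?x)) \<cdot> ?u"
    by (simp add: module_assoc mten_snd comp_norm)
  also have "\<dots> = (R \<triangleright> snd z) \<cdot> cosec ?x \<cdot> (snd (U \<star> ?x) \<cdot> ?u)"
    by (simp add: cosec_right comp_assoc)
  also have "snd (U \<star> ?x) \<cdot> ?u = Ident C (R \<boxtimes> ?x)"
    using unit_section[of "U \<star> ?x"] by simp
  finally show ?thesis by simp
qed

lemma act_sg:
  assumes [simp]: "modl z"
  shows "snd z \<cdot> sg z = Ident C (fst z)"
proof (rule action_epi[OF _ assms])
  have "(snd z \<cdot> sg z) \<cdot> snd z = (snd z \<cdot> (R \<triangleright> snd z)) \<cdot> cosec (fst z)"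
    by (simp add: comp_assoc sg_act)
  also have "\<dots> = snd z \<cdot> (snd (U \<star> fst z) \<cdot> cosec (fst z))"
    by (simp add: module_assoc mten_snd comp_assoc)
  finally show "(snd z \<cdot> sg z) \<cdot> snd z = Ident C (fst z) \<cdot> snd z"
    by (simp add: act_cosec)
qed auto

lemma sg_lin:
  assumes [simp]: "modl z"
  shows "lin z (sg z) (U \<star> fst z)"
proof (rule lin_epi_cancel[OF act_lin[OF assms]])
  show "lin (U \<star> fst z) (sg z \<cdot> snd z) (U \<star> fst z)"
    unfolding sg_act[OF assms]
    by (rule lin_comp[OF cosec_lin]) (use mten_lin_right[of U "snd z"] in auto)
  show "snd z \<cdot> sg z = Ident C (fst z)" by (rule act_sg) simp
qed auto

lemma sg_nat:
  assumes f: "lin z f w"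
  shows "sg w \<cdot> f = (R \<triangleright> f) \<cdot> sg z"
proof (rule action_epi[OF _ linD(1)[OF f]])
  note [simp] = linD(1-5)[OF f]
  have "(sg w \<cdot> f) \<cdot> snd z = (sg w \<cdot> snd w) \<cdot> (R \<triangleright> f)"
    by (simp add: comp_assoc linD(6)[OF f])
  also have "\<dots> = (R \<triangleright> snd w) \<cdot> (cosec (fst w) \<cdot> (R \<triangleright> f))"
    by (simp add: sg_act comp_assoc)
  also have "\<dots> = (R \<triangleright> (snd w \<cdot> (R \<triangleright> f))) \<cdot> cosec (fst z)"
    by (simp add: cosec_nat comp_norm)
  also have "\<dots> = (R \<triangleright> f) \<cdot> ((R \<triangleright> snd z) \<cdot> cosec (fst z))"
    unfolding linD(6)[OF f, symmetric] by (simp add: comp_norm)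
  also have "\<dots> = ((R \<triangleright> f) \<cdot> sg z) \<cdot> snd z"
    unfolding sg_act[OF linD(1)[OF f], symmetric] by (simp add: comp_assoc)
  finally show "(sg w \<cdot> f) \<cdot> snd z = ((R \<triangleright> f) \<cdot> sg z) \<cdot> snd z" .
qed (use linD(1-5)[OF f] in auto)

text \<open>Makes the idempotent \<open>te\<close> compatible with suspension, so that it acts on
  whole triangles.\<close>

lemma sg_susp:
  assumes [simp]: "modl z"
  shows "TenSusp C R (fst z) \<cdot> sg (mod_susp C A z) = SuspA C (sg z)"
proof (rule action_epi[where z = "mod_susp C A z"])
  let ?x = "fst z" and ?T = "TenSusp C"
  have "(?T R ?x \<cdot> sg (mod_susp C A z)) \<cdot> snd (mod_susp C A z) =
      (?T R ?x \<cdot> (R \<triangleright> SuspA C (snd z))) \<cdot> (R \<triangleright> ?T R ?x) \<cdot> cosec (SuspO C ?x)"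
    by (simp add: comp_assoc sg_act) (simp add: mod_susp_snd comp_norm)
  also have "\<dots> = SuspA C (R \<triangleright> snd z) \<cdot>
      (?T R (R \<boxtimes> ?x) \<cdot> (R \<triangleright> ?T R ?x) \<cdot> Assoc C R R (SuspO C ?x)) \<cdot> (\<sigma> \<triangleleft> SuspO C ?x)"
    by (simp add: TenSusp_nat2 cosec_def comp_assoc)
  also have "\<dots> = SuspA C ((R \<triangleright> snd z) \<cdot> cosec ?x) \<cdot> ?T R ?x"
    by (simp add: TenSusp_nat1 cosec_def comp_assoc SuspA_comp flip: TenSusp_assoc)
  also have "\<dots> = SuspA C (sg z) \<cdot> snd (mod_susp C A z)"
    unfolding sg_act[OF assms, symmetric] by (simp add: mod_susp_snd comp_assoc SuspA_comp)
  finally show "(?T R ?x \<cdot> sg (mod_susp C A z)) \<cdot> snd (mod_susp C A z) =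
      SuspA C (sg z) \<cdot> snd (mod_susp C A z)" .
qed auto

section \<open>The tensor product of modules\<close>

text \<open>The idempotent \<open>m \<otimes> n \<mapsto> \<Sum>\<^sub>i m c\<^sub>i \<otimes> d\<^sub>i n\<close>; its image is the tensor product over \<open>A\<close>, which is
  therefore a split coequaliser.\<close>

definition te :: "('o, 'm) modl \<Rightarrow> ('o, 'm) modl \<Rightarrow> 'm" where
  "te b z = al b (fst z) \<cdot> (fst b \<triangleright> sg z)"

abbreviation tq :: "('o, 'm) modl \<Rightarrow> ('o, 'm) modl \<Rightarrow> 'm" where
  "tq b z \<equiv> ten_proj C A b z"

definition ti :: "('o, 'm) modl \<Rightarrow> ('o, 'm) modl \<Rightarrow> 'm" where
  "ti b z = factor C (tq b z) (te b z)"

abbreviation mt :: "('o, 'm) modl \<Rightarrow> ('o, 'm) modl \<Rightarrow> ('o, 'm) modl" where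
  "mt b z \<equiv> mod_tenO C A b z"

lemma te_simps [simp]:
  assumes "modl b" "modl z"
  shows "te b z \<in> Arr C" "Dom C (te b z) = fst b \<boxtimes> fst z" "Cod C (te b z) = fst b \<boxtimes> fst z"
  using assms by (auto simp: te_def)

text \<open>The sums of \<open>m a c \<otimes> d n\<close> and of \<open>m c \<otimes> d a n\<close>
  agree by left linearity of \<open>sg\<close>; \<open>al_al\<close> merges the two scalars acting
  on \<open>m\<close>.\<close>

lemma te_coequalizes:
  assumes [simp]: "modl b" "modl z"
  shows "te b z \<cdot> al b (fst z) = te b z \<cdot> (fst b \<triangleright> snd z)"
proof -
  let ?x = "fst z" and ?y = "fst b"
  have "te b z \<cdot> al b ?x = al b ?x \<cdot> ((?y \<triangleright> sg z) \<cdot> al b ?x)"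
    by (simp add: te_def comp_assoc)
  also have "(?y \<triangleright> sg z) \<cdot> al b ?x = al b (R \<boxtimes> ?x) \<cdot> (?y \<triangleright> (R \<triangleright> sg z))"
    by (rule al_nat[symmetric]) auto
  also have "al b ?x \<cdot> al b (R \<boxtimes> ?x) \<cdot> (?y \<triangleright> (R \<triangleright> sg z)) =
      (al b ?x \<cdot> (?y \<triangleright> snd (U \<star> ?x))) \<cdot> (?y \<triangleright> (R \<triangleright> sg z))"
    by (simp add: comp_assoc flip: al_al)
  also have "\<dots> = al b ?x \<cdot> (?y \<triangleright> (snd (U \<star> ?x) \<cdot> (R \<triangleright> sg z)))"
    by (simp add: comp_norm)
  also have "\<dots> = te b z \<cdot> (?y \<triangleright> snd z)"
    unfolding linD(6)[OF sg_lin[OF assms(2)], symmetric] by (simp add: te_def comp_norm)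
  finally show ?thesis .
qed

text \<open>A balanced map takes the same value on \<open>m c \<otimes> d n\<close> and
  \<open>m \<otimes> c d n\<close>, and the products \<open>c d\<close> sum to the unit. With
  \<open>te_coequalizes\<close>, balanced maps are exactly those unchanged by \<open>te\<close>,
  which makes the image of \<open>te\<close> a coequaliser.\<close>

lemma te_absorb:
  assumes [simp]: "modl b" "modl z" and t: "t \<in> Arr C" "Dom C t = fst b \<boxtimes> fst z"
    "t \<cdot> al b (fst z) = t \<cdot> (fst b \<triangleright> snd z)"
  shows "t \<cdot> te b z = t"
proof -
  have "t \<cdot> te b z = (t \<cdot> al b (fst z)) \<cdot> (fst b \<triangleright> sg z)"
    using t(1,2) by (simp add: te_def comp_assoc)
  also have "\<dots> = t \<cdot> (fst b \<triangleright> (snd z \<cdot> sg z))"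
    unfolding t(3) using t(1,2) by (simp add: comp_norm)
  also have "\<dots> = t" using t(1,2) by (simp add: act_sg)
  finally show ?thesis .
qed

lemma te_idem: "\<lbrakk>modl b; modl z\<rbrakk> \<Longrightarrow> te b z \<cdot> te b z = te b z"
  by (rule te_absorb) (auto simp: te_coequalizes)

lemma te_lin: "\<lbrakk>modl b; modl z\<rbrakk> \<Longrightarrow> lin (b \<star> fst z) (te b z) (b \<star> fst z)"
  unfolding te_def by (rule lin_comp[OF mten_lin_right al_lin]) auto

lemma te_nat:
  assumes [simp]: "modl b" and f: "lin z f w"
  shows "te b w \<cdot> (fst b \<triangleright> f) = (fst b \<triangleright> f) \<cdot> te b z"
proof -
  note [simp] = linD(1-5)[OF f]
  have "te b w \<cdot> (fst b \<triangleright> f) = al b (fst w) \<cdot> (fst b \<triangleright> (sg w \<cdot> f))"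
    by (simp add: te_def comp_norm)
  also have "\<dots> = (al b (fst w) \<cdot> (fst b \<triangleright> (R \<triangleright> f))) \<cdot> (fst b \<triangleright> sg z)"
    unfolding sg_nat[OF f] by (simp add: comp_norm)
  also have "al b (fst w) \<cdot> (fst b \<triangleright> (R \<triangleright> f)) = (fst b \<triangleright> f) \<cdot> al b (fst z)"
    by (rule al_nat) auto
  finally show ?thesis by (simp add: te_def comp_assoc)
qed

lemma te_susp:
  assumes [simp]: "modl b" "modl z"
  shows "SuspA C (te b z) \<cdot> TenSusp C (fst b) (fst z) =
    TenSusp C (fst b) (fst z) \<cdot> te b (mod_susp C A z)"
proof -
  let ?T = "TenSusp C" and ?x = "fst z" and ?y = "fst b"
  have "SuspA C (te b z) \<cdot> ?T ?y ?x = SuspA C (al b ?x) \<cdot> (?T ?y (R \<boxtimes> ?x) \<cdot> (?y \<triangleright> SuspA C (sg z)))"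
    by (simp add: te_def comp_assoc SuspA_comp TenSusp_nat2)
  also have "\<dots> = (SuspA C (al b ?x) \<cdot> ?T ?y (R \<boxtimes> ?x) \<cdot> (?y \<triangleright> ?T R ?x)) \<cdot>
      (?y \<triangleright> sg (mod_susp C A z))"
    by (simp add: comp_norm flip: sg_susp)
  also have "\<dots> = ?T ?y ?x \<cdot> te b (mod_susp C A z)"
    by (simp add: al_susp te_def comp_assoc)
  finally show ?thesis .
qed

text \<open>The action maps in \<open>ten_proj\<close> start at
  \<open>(x \<otimes> A) \<otimes> y\<close>; precomposing with the inverse associator gives the
  pair starting at \<open>x \<otimes> (A \<otimes> y)\<close>, to which \<open>al\<close> and
  \<open>te\<close> are adapted.\<close>

lemma coequaliser_iff:
  assumes [simp]: "modl b" "modl z"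
  shows "is_coequaliser C ((snd b \<cdot> Braid C (fst b) R) \<triangleleft> fst z)
      ((fst b \<triangleright> snd z) \<cdot> Assoc C (fst b) R (fst z)) q \<longleftrightarrow>
    q \<in> Arr C \<and> Dom C q = fst b \<boxtimes> fst z \<and> q \<cdot> al b (fst z) = q \<cdot> (fst b \<triangleright> snd z) \<and>
    (\<forall>t\<in>Arr C. Dom C t = fst b \<boxtimes> fst z \<and> t \<cdot> al b (fst z) = t \<cdot> (fst b \<triangleright> snd z) \<longrightarrow>
      (\<exists>!u. u \<in> Hom C (Cod C q) (Cod C t) \<and> u \<cdot> q = t))"
proof -
  let ?A = "Assoc C (fst b) R (fst z)" and ?I = "AssocI (fst b) R (fst z)"
  let ?f = "ract b \<triangleleft> fst z" and ?g = "(fst b \<triangleright> snd z) \<cdot> ?A"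
  have eq: "t \<cdot> ?f = t \<cdot> ?g \<longleftrightarrow> t \<cdot> al b (fst z) = t \<cdot> (fst b \<triangleright> snd z)"
    if t: "t \<in> Arr C" "Dom C t = fst b \<boxtimes> fst z" for t
  proof
    assume "t \<cdot> ?f = t \<cdot> ?g"
    then have "(t \<cdot> ?f) \<cdot> ?I = (t \<cdot> ?g) \<cdot> ?I" by simp
    then show "t \<cdot> al b (fst z) = t \<cdot> (fst b \<triangleright> snd z)"
      using t by (simp add: al_def comp_assoc)
  next
    assume "t \<cdot> al b (fst z) = t \<cdot> (fst b \<triangleright> snd z)"
    then have "(t \<cdot> al b (fst z)) \<cdot> ?A = (t \<cdot> (fst b \<triangleright> snd z)) \<cdot> ?A" by simp
    then show "t \<cdot> ?f = t \<cdot> ?g"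
      using t by (simp add: al_def comp_assoc)
  qed
  show ?thesis
    unfolding is_coequaliser_def ract_def[symmetric]
    by (simp add: eq cong: conj_cong)
qed

text \<open>A coequaliser exists, namely the retraction \<open>r\<close> onto the image of
  \<open>te\<close>; hence the arrow picked by \<open>ten_proj\<close> is one too.\<close>

lemma tq_coequaliser:
  assumes [simp]: "modl b" "modl z"
  shows "tq b z \<in> Arr C" "Dom C (tq b z) = fst b \<boxtimes> fst z"
    "tq b z \<cdot> al b (fst z) = tq b z \<cdot> (fst b \<triangleright> snd z)"
    "\<lbrakk>t \<in> Arr C; Dom C t = fst b \<boxtimes> fst z; t \<cdot> al b (fst z) = t \<cdot> (fst b \<triangleright> snd z)\<rbrakk> \<Longrightarrow>
      \<exists>!u. u \<in> Hom C (Cod C (tq b z)) (Cod C t) \<and> u \<cdot> tq b z = t"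
proof -
  let ?P = "is_coequaliser C ((snd b \<cdot> Braid C (fst b) R) \<triangleleft> fst z)
      ((fst b \<triangleright> snd z) \<cdot> Assoc C (fst b) R (fst z))"
  let ?x = "fst b \<boxtimes> fst z" and ?e = "te b z"
  have "\<exists>y\<in>Obj C. \<exists>r\<in>Hom C ?x y. \<exists>s\<in>Hom C y ?x. s \<cdot> r = ?e \<and> r \<cdot> s = Ident C y"
    by (rule idempotent_complete[unfolded idempotent_complete_def, rule_format]) (auto simp: te_idem)
  then obtain y r s where rs: "r \<in> Hom C ?x y" "s \<in> Hom C y ?x" "s \<cdot> r = ?e" "r \<cdot> s = Ident C y"
    by blast
  have [simp]: "r \<in> Arr C" "Dom C r = ?x" "Cod C r = y" "s \<in> Arr C" "Dom C s = y" "Cod C s = ?x"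
    "y \<in> Obj C" using rs by auto
  have re: "r = r \<cdot> ?e"
    unfolding rs(3)[symmetric] using comp_reassoc[OF rs(4), of r] by simp
  have "?P r"
    unfolding coequaliser_iff[OF assms]
  proof (intro conjI ballI impI)
    have "r \<cdot> al b (fst z) = r \<cdot> (?e \<cdot> al b (fst z))" by (subst re) (simp add: comp_assoc)
    also have "\<dots> = (r \<cdot> ?e) \<cdot> (fst b \<triangleright> snd z)" by (simp add: te_coequalizes comp_assoc)
    finally show "r \<cdot> al b (fst z) = r \<cdot> (fst b \<triangleright> snd z)" by (simp flip: re)
  next
    fix t assume t: "t \<in> Arr C" "Dom C t = ?x \<and> t \<cdot> al b (fst z) = t \<cdot> (fst b \<triangleright> snd z)"
    then have te: "t \<cdot> ?e = t" by (intro te_absorb) auto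
    show "\<exists>!u. u \<in> Hom C (Cod C r) (Cod C t) \<and> u \<cdot> r = t"
    proof (rule ex1I[of _ "t \<cdot> s"])
      show "t \<cdot> s \<in> Hom C (Cod C r) (Cod C t) \<and> (t \<cdot> s) \<cdot> r = t"
        using t rs(3) te by (simp add: comp_assoc)
      fix u assume u: "u \<in> Hom C (Cod C r) (Cod C t) \<and> u \<cdot> r = t"
      show "u = t \<cdot> s"
        by (rule section_epi[OF _ rs(4)]) (use t te u rs(3) in \<open>auto simp: comp_assoc\<close>)
    qed
  qed auto
  then have "?P (tq b z)"
    unfolding ten_proj_def Let_def by (rule someI)
  note P = this[unfolded coequaliser_iff[OF assms]]
  show "tq b z \<in> Arr C" "Dom C (tq b z) = fst b \<boxtimes> fst z"
    "tq b z \<cdot> al b (fst z) = tq b z \<cdot> (fst b \<triangleright> snd z)" using P by blast+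
  show "\<exists>!u. u \<in> Hom C (Cod C (tq b z)) (Cod C t) \<and> u \<cdot> tq b z = t"
    if "t \<in> Arr C" "Dom C t = fst b \<boxtimes> fst z" "t \<cdot> al b (fst z) = t \<cdot> (fst b \<triangleright> snd z)" for t
    using P[THEN conjunct2, THEN conjunct2, THEN conjunct2, rule_format, OF that(1)] that(2,3) by blast
qed

lemma tq_simps [simp]:
  assumes "modl b" "modl z"
  shows "tq b z \<in> Arr C" "Dom C (tq b z) = fst b \<boxtimes> fst z"
  using tq_coequaliser[OF assms] by auto

text \<open>Whichever coequaliser was picked, \<open>te\<close> factors through it because
  \<open>te\<close> is balanced, and the factor \<open>ti\<close> is a section of it.\<close>

lemma ti_props:
  assumes [simp]: "modl b" "modl z"
  shows "ti b z \<in> Arr C" "Dom C (ti b z) = Cod C (tq b z)" "Cod C (ti b z) = fst b \<boxtimes> fst z"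
    "ti b z \<cdot> tq b z = te b z" "tq b z \<cdot> ti b z = Ident C (Cod C (tq b z))"
proof -
  have "\<exists>!u. u \<in> Hom C (Cod C (tq b z)) (Cod C (te b z)) \<and> u \<cdot> tq b z = te b z"
    by (rule tq_coequaliser(4)) (auto simp: te_coequalizes)
  then have "ti b z \<in> Hom C (Cod C (tq b z)) (Cod C (te b z)) \<and> ti b z \<cdot> tq b z = te b z"
    unfolding ti_def factor_def by (rule theI')
  then show i: "ti b z \<in> Arr C" "Dom C (ti b z) = Cod C (tq b z)" "Cod C (ti b z) = fst b \<boxtimes> fst z"
    "ti b z \<cdot> tq b z = te b z" by auto
  have q: "tq b z \<cdot> te b z = tq b z" by (rule te_absorb) (auto simp: tq_coequaliser)
  have E: "\<exists>!u. u \<in> Hom C (Cod C (tq b z)) (Cod C (tq b z)) \<and> u \<cdot> tq b z = tq b z"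
    by (rule tq_coequaliser(4)) (auto simp: tq_coequaliser(3))
  show "tq b z \<cdot> ti b z = Ident C (Cod C (tq b z))"
    by (rule trans[OF the1_equality[OF E, symmetric] the1_equality[OF E]])
      (use i q in \<open>auto simp: comp_assoc\<close>)
qed

declare ti_props(1-3) [simp]

lemma tq_te: "\<lbrakk>modl b; modl z\<rbrakk> \<Longrightarrow> tq b z \<cdot> te b z = tq b z"
  by (rule te_absorb) (auto simp: tq_coequaliser)

lemma mt_fst [simp]: "fst (mt b z) = Cod C (tq b z)"
  by (simp add: mod_tenO_def Let_def)

text \<open>\<open>b\<close> governs the balancing and \<open>v\<close>, a module on the same
  object, governs the action on the result. For \<open>mod_tenO\<close> they coincide, whereas in
  extension of scalars along \<open>\<gamma>\<close> the ring balances through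
  \<open>\<gamma>\<close> and acts by its own multiplication.\<close>

lemma ten_action_eq:
  assumes [simp]: "modl b" "modl z" "modl v" and v: "fst v = fst b"
    and e: "lin (v \<star> fst z) (te b z) (v \<star> fst z)"
  shows "modl (Cod C (tq b z), ten_action C R (snd v) (fst b) (fst z) (tq b z))"
    "lin (v \<star> fst z) (tq b z) (Cod C (tq b z), ten_action C R (snd v) (fst b) (fst z) (tq b z))"
    "lin (Cod C (tq b z), ten_action C R (snd v) (fst b) (fst z) (tq b z)) (ti b z) (v \<star> fst z)"
proof -
  note S = split_module[OF e, of "tq b z" "Cod C (tq b z)" "ti b z"]
  have "ten_action C R (snd v) (fst b) (fst z) (tq b z) =
      factor C (R \<triangleright> tq b z) (tq b z \<cdot> snd (v \<star> fst z))"
    by (simp add: ten_action_def mten_snd v)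
  also have "\<dots> = tq b z \<cdot> snd (v \<star> fst z) \<cdot> (R \<triangleright> ti b z)"
    using S(4) by (simp add: v ti_props)
  finally have *: "ten_action C R (snd v) (fst b) (fst z) (tq b z) =
      tq b z \<cdot> snd (v \<star> fst z) \<cdot> (R \<triangleright> ti b z)" .
  show "modl (Cod C (tq b z), ten_action C R (snd v) (fst b) (fst z) (tq b z))"
    "lin (v \<star> fst z) (tq b z) (Cod C (tq b z), ten_action C R (snd v) (fst b) (fst z) (tq b z))"
    "lin (Cod C (tq b z), ten_action C R (snd v) (fst b) (fst z) (tq b z)) (ti b z) (v \<star> fst z)"
    unfolding * using S by (simp_all add: v ti_props)
qed

lemma mt_split:
  assumes "modl b" "modl z"
  shows "modl (mt b z)" "lin (b \<star> fst z) (tq b z) (mt b z)" "lin (mt b z) (ti b z) (b \<star> fst z)"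
  using ten_action_eq[OF assms assms(1) refl te_lin[OF assms]]
  by (simp_all add: mod_tenO_def Let_def)

section \<open>Identification of tensor products over \<open>A\<close> up to linear
  isomorphism\<close>

definition miso :: "('o, 'm) modl \<Rightarrow> ('o, 'm) modl \<Rightarrow> bool" where
  "miso z w \<longleftrightarrow> (\<exists>f g. lin z f w \<and> lin w g z \<and> g \<cdot> f = Ident C (fst z) \<and> f \<cdot> g = Ident C (fst w))"

lemma misoI:
  assumes "lin z f w" "g \<in> Arr C" "Dom C g = fst w" "Cod C g = fst z"
    "g \<cdot> f = Ident C (fst z)" "f \<cdot> g = Ident C (fst w)"
  shows "miso z w"
  unfolding miso_def using assms lin_inverse[OF assms] by blast

lemma miso_sym: "miso z w \<Longrightarrow> miso w z"
  unfolding miso_def by blast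

text \<open>Recognition principle for \<open>b \<otimes>\<^sub>A z\<close>: a balanced split
  epimorphism \<open>q'\<close> is a model of it as soon as \<open>te\<close> does not distinguish
  \<open>i' \<cdot> q'\<close> from the identity. The section \<open>i'\<close> need not be
  linear.\<close>

lemma tensor_unique_iso:
  assumes [simp]: "modl b" "modl z"
    and q': "q' \<in> Arr C" "Dom C q' = fst b \<boxtimes> fst z" "Cod C q' = w"
    and i': "i' \<in> Arr C" "Dom C i' = w" "Cod C i' = fst b \<boxtimes> fst z"
    and co: "q' \<cdot> al b (fst z) = q' \<cdot> (fst b \<triangleright> snd z)"
    and sec: "q' \<cdot> i' = Ident C w" and e: "te b z \<cdot> i' \<cdot> q' = te b z"
  shows "(tq b z \<cdot> i') \<cdot> (q' \<cdot> ti b z) = Ident C (Cod C (tq b z))"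
    "(q' \<cdot> ti b z) \<cdot> (tq b z \<cdot> i') = Ident C w"
proof -
  note [simp] = q' i'
  have "(tq b z \<cdot> i') \<cdot> (q' \<cdot> ti b z) = (tq b z \<cdot> te b z) \<cdot> (i' \<cdot> (q' \<cdot> ti b z))"
    unfolding tq_te[OF assms(1,2)] by (simp add: comp_assoc)
  also have "\<dots> = tq b z \<cdot> ((te b z \<cdot> i' \<cdot> q') \<cdot> ti b z)"
    by (simp add: comp_assoc)
  also have "\<dots> = (tq b z \<cdot> te b z) \<cdot> ti b z" unfolding e by (simp add: comp_assoc)
  also have "\<dots> = Ident C (Cod C (tq b z))" by (simp add: tq_te ti_props)
  finally show "(tq b z \<cdot> i') \<cdot> (q' \<cdot> ti b z) = Ident C (Cod C (tq b z))" .
  have "(q' \<cdot> ti b z) \<cdot> (tq b z \<cdot> i') = q' \<cdot> ((ti b z \<cdot> tq b z) \<cdot> i')"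
    by (simp add: comp_assoc)
  also have "\<dots> = (q' \<cdot> te b z) \<cdot> i'" unfolding ti_props(4)[OF assms(1,2)] by (simp add: comp_assoc)
  also have "q' \<cdot> te b z = q'" by (rule te_absorb) (use co in auto)
  finally show "(q' \<cdot> ti b z) \<cdot> (tq b z \<cdot> i') = Ident C w" by (simp add: sec)
qed

lemma tensor_unique:
  assumes m: "modl b" "modl z" and q': "lin (b \<star> fst z) q' w"
    and i': "i' \<in> Arr C" "Dom C i' = fst w" "Cod C i' = fst b \<boxtimes> fst z"
    and co: "q' \<cdot> al b (fst z) = q' \<cdot> (fst b \<triangleright> snd z)"
    and sec: "q' \<cdot> i' = Ident C (fst w)" and e: "te b z \<cdot> i' \<cdot> q' = te b z"
  shows "miso (mt b z) w"
  by (rule misoI[OF lin_comp[OF mt_split(3)[OF m] q'], of "tq b z \<cdot> i'"])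
    (use tensor_unique_iso[OF m _ _ _ i' co sec e] linD(3-5)[OF q'] m i' in auto)

text \<open>\<open>X\<close> permutes \<open>m \<otimes> (a \<otimes> n)\<close> to
  \<open>n \<otimes> (a \<otimes> m)\<close>. Along it the braiding exchanges the two action maps,
  so balanced maps stay balanced when the factors are swapped.\<close>

lemma Braid_al:
  assumes [simp]: "modl b" "modl z"
  defines "X \<equiv> (fst z \<triangleright> Braid C (fst b) R) \<cdot> Braid C (fst b \<boxtimes> R) (fst z) \<cdot> AssocI (fst b) R (fst z)"
  shows "al z (fst b) \<cdot> X = Braid C (fst b) (fst z) \<cdot> (fst b \<triangleright> snd z)"
    "(fst z \<triangleright> snd b) \<cdot> X = Braid C (fst b) (fst z) \<cdot> al b (fst z)"
proof -
  let ?B = "Braid C" and ?x = "fst z" and ?y = "fst b"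
  have "al z ?y \<cdot> X = (snd z \<triangleleft> ?y) \<cdot> (?B ?x R \<triangleleft> ?y) \<cdot> (AssocI ?x R ?y \<cdot> (?x \<triangleright> ?B ?y R) \<cdot>
      ?B (?y \<boxtimes> R) ?x) \<cdot> AssocI ?y R ?x"
    by (simp add: X_def al_def ract_def comp_norm)
  also have "\<dots> = (snd z \<triangleleft> ?y) \<cdot> ?B ?y (R \<boxtimes> ?x)"
    by (simp add: yang_baxter comp_assoc)
  finally show "al z ?y \<cdot> X = ?B ?y ?x \<cdot> (?y \<triangleright> snd z)" by (simp add: coherence_nat)
  show "(?x \<triangleright> snd b) \<cdot> X = ?B ?y ?x \<cdot> al b ?x"
    by (simp add: X_def al_def ract_def comp_norm coherence_nat coherence_nat')
qed

lemma Braid_coequalizes: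
  assumes [simp]: "modl b" "modl z" and t: "t \<in> Arr C" "Dom C t = fst z \<boxtimes> fst b"
    "t \<cdot> al z (fst b) = t \<cdot> (fst z \<triangleright> snd b)"
  shows "(t \<cdot> Braid C (fst b) (fst z)) \<cdot> al b (fst z) =
    (t \<cdot> Braid C (fst b) (fst z)) \<cdot> (fst b \<triangleright> snd z)"
proof -
  let ?B = "Braid C (fst b) (fst z)"
  let ?X = "(fst z \<triangleright> Braid C (fst b) R) \<cdot> Braid C (fst b \<boxtimes> R) (fst z) \<cdot> AssocI (fst b) R (fst z)"
  note X = Braid_al[OF assms(1,2)]
  have "(t \<cdot> ?B) \<cdot> al b (fst z) = t \<cdot> (?B \<cdot> al b (fst z))" using t(1,2) by (simp add: comp_assoc)
  also have "\<dots> = (t \<cdot> (fst z \<triangleright> snd b)) \<cdot> ?X"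
    unfolding X(2)[symmetric] using t(1,2) by (simp add: comp_assoc)
  also have "\<dots> = t \<cdot> (al z (fst b) \<cdot> ?X)"
    unfolding t(3)[symmetric] using t(1,2) by (simp add: comp_assoc)
  also have "\<dots> = (t \<cdot> ?B) \<cdot> (fst b \<triangleright> snd z)"
    unfolding X(1) using t(1,2) by (simp add: comp_assoc)
  finally show ?thesis .
qed

lemma mt_commute:
  assumes [simp]: "modl b" "modl z"
  shows "miso (mt b z) (mt z b)"
proof (rule tensor_unique[OF assms])
  let ?B = "Braid C" and ?x = "fst z" and ?y = "fst b"
  let ?q = "tq z b \<cdot> ?B ?y ?x" and ?i = "?B ?x ?y \<cdot> ti z b"
  show "?q \<cdot> al b ?x = ?q \<cdot> (?y \<triangleright> snd z)"
    by (rule Braid_coequalizes) (auto simp: tq_coequaliser)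
  show "?q \<cdot> ?i = Ident C (fst (mt z b))"
    by (simp add: comp_assoc ti_props)
  have "(te b z \<cdot> ?B ?x ?y) \<cdot> te z b = te b z \<cdot> ?B ?x ?y"
    by (rule te_absorb) (auto simp: te_coequalizes intro!: Braid_coequalizes)
  then have "((te b z \<cdot> ?B ?x ?y) \<cdot> te z b) \<cdot> ?B ?y ?x = te b z"
    by (simp add: comp_assoc)
  moreover have "te b z \<cdot> ?i \<cdot> ?q = ((te b z \<cdot> ?B ?x ?y) \<cdot> te z b) \<cdot> ?B ?y ?x"
    unfolding ti_props(4)[OF assms(2,1), symmetric] by (simp add: comp_assoc)
  ultimately show "te b z \<cdot> ?i \<cdot> ?q = te b z" by simp
  show "lin (b \<star> ?x) ?q (mt z b)"
  proof (rule linI)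
    have q: "snd (mt z b) \<cdot> (R \<triangleright> tq z b) = tq z b \<cdot> snd (z \<star> ?y)"
      using linD(6)[OF mt_split(2)[of z b]] by simp
    note w = mt_split(1)[OF assms(2,1)]
    have "?q \<cdot> snd (b \<star> ?x) = (tq z b \<cdot> (?x \<triangleright> snd b)) \<cdot> ?B (R \<boxtimes> ?y) ?x \<cdot> AssocI R ?y ?x"
      by (simp add: mten_snd comp_assoc coherence_nat')
    \<comment> \<open>The action on \<open>b \<star> ?x\<close> touches \<open>b\<close>, that on
      \<open>mt z b\<close> touches \<open>z\<close>; balancing moves the scalar across.\<close>
    also have "tq z b \<cdot> (?x \<triangleright> snd b) = tq z b \<cdot> al z ?y" by (simp add: tq_coequaliser(3))
    also have "(tq z b \<cdot> al z ?y) \<cdot> ?B (R \<boxtimes> ?y) ?x \<cdot> AssocI R ?y ?x =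
        tq z b \<cdot> (snd z \<triangleleft> ?y) \<cdot> ((?B ?x R \<triangleleft> ?y) \<cdot> AssocI ?x R ?y \<cdot> ?B (R \<boxtimes> ?y) ?x) \<cdot>
          AssocI R ?y ?x"
      by (simp add: al_def ract_def comp_norm)
    also have "\<dots> = (tq z b \<cdot> snd (z \<star> ?y)) \<cdot> (R \<triangleright> ?B ?y ?x)"
      by (simp add: Braid_tensor_swap mten_snd comp_assoc)
    also have "\<dots> = snd (mt z b) \<cdot> (R \<triangleright> ?q)"
      unfolding q[symmetric] using w by (simp add: comp_norm)
    finally show "?q \<cdot> snd (b \<star> ?x) = snd (mt z b) \<cdot> (R \<triangleright> ?q)" .
  qed (auto simp: mt_split)
qed auto

lemma al_Assoc:
  assumes [simp]: "modl b" "x \<in> Obj C" "y \<in> Obj C"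
  shows "al b (x \<boxtimes> y) \<cdot> (fst b \<triangleright> Assoc C R x y) \<cdot> Assoc C (fst b) (R \<boxtimes> x) y =
    Assoc C (fst b) x y \<cdot> (al b x \<triangleleft> y)"
proof -
  have "Assoc C (fst b) x y \<cdot> (al b x \<triangleleft> y) = (ract b \<triangleleft> (x \<boxtimes> y)) \<cdot>
      (Assoc C (fst b \<boxtimes> R) x y \<cdot> (AssocI (fst b) R x \<triangleleft> y) \<cdot> AssocI (fst b) (R \<boxtimes> x) y) \<cdot>
      Assoc C (fst b) (R \<boxtimes> x) y"
    by (simp add: al_def comp_norm coherence_nat')
  also have "\<dots> = al b (x \<boxtimes> y) \<cdot> (fst b \<triangleright> Assoc C R x y) \<cdot> Assoc C (fst b) (R \<boxtimes> x) y"
    by (simp add: pentagon3 al_def comp_assoc)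
  finally show ?thesis ..
qed

text \<open>Associativity with an object of the base category as third factor: tensoring the
  projection and the section for \<open>b \<otimes>\<^sub>A z\<close> with \<open>y\<close> gives a
  model of \<open>b \<otimes>\<^sub>A (z \<otimes> y)\<close> in the sense of
  \<open>tensor_unique\<close>.\<close>

lemma mt_mten:
  assumes [simp]: "modl b" "modl z" "y \<in> Obj C"
  shows "miso (mt b (z \<star> y)) (mt b z \<star> y)"
proof (rule tensor_unique)
  let ?x = "fst z" and ?b = "fst b"
  let ?q = "(tq b z \<triangleleft> y) \<cdot> AssocI ?b ?x y" and ?i = "Assoc C ?b ?x y \<cdot> (ti b z \<triangleleft> y)"
  \<comment> \<open>An isomorphism that rebrackets the source of the action maps; \<open>?s\<close>
    is its inverse, and identities are checked after precomposition with \<open>?p\<close>.\<close>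
  let ?p = "(?b \<triangleright> Assoc C R ?x y) \<cdot> Assoc C ?b (R \<boxtimes> ?x) y"
  let ?s = "AssocI ?b (R \<boxtimes> ?x) y \<cdot> (?b \<triangleright> AssocI R ?x y)"
  have ps: "?p \<cdot> ?s = Ident C (?b \<boxtimes> (R \<boxtimes> (?x \<boxtimes> y)))" by (simp add: comp_assoc)
  have act: "(?b \<triangleright> snd (z \<star> y)) \<cdot> ?p = Assoc C ?b ?x y \<cdot> ((?b \<triangleright> snd z) \<triangleleft> y)"
    by (simp add: mten_snd comp_norm coherence_nat)
  have co: "al b (fst (z \<star> y)) \<cdot> ?p = Assoc C ?b ?x y \<cdot> (al b ?x \<triangleleft> y)"
    by (simp add: al_Assoc)
  have "lin (b \<star> ?x \<star> y) (tq b z \<triangleleft> y) (mt b z \<star> y)"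
    by (rule mten_lin_left[OF mt_split(2)]) auto
  from lin_comp[OF mten_AssocI_lin this]
  show "lin (b \<star> fst (z \<star> y)) ?q (mt b z \<star> y)" by simp
  show "?q \<cdot> al b (fst (z \<star> y)) = ?q \<cdot> (?b \<triangleright> snd (z \<star> y))"
  proof (rule section_epi[OF _ ps])
    have "(?q \<cdot> al b (fst (z \<star> y))) \<cdot> ?p = ?q \<cdot> (al b (fst (z \<star> y)) \<cdot> ?p)"
      by (rule comp_assoc) (auto simp: mten_fst)
    also have "\<dots> = (tq b z \<cdot> al b ?x) \<triangleleft> y" unfolding co by (simp add: comp_norm)
    also have "\<dots> = ?q \<cdot> ((?b \<triangleright> snd (z \<star> y)) \<cdot> ?p)"
      unfolding act by (simp add: tq_coequaliser(3) comp_norm)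
    also have "\<dots> = (?q \<cdot> (?b \<triangleright> snd (z \<star> y))) \<cdot> ?p"
      by (rule comp_assoc[symmetric]) auto
    finally show "(?q \<cdot> al b (fst (z \<star> y))) \<cdot> ?p = (?q \<cdot> (?b \<triangleright> snd (z \<star> y))) \<cdot> ?p" .
  qed auto
  have "(tq b z \<triangleleft> y) \<cdot> (ti b z \<triangleleft> y) = Ident C (Cod C (tq b z) \<boxtimes> y)"
    by (rule whisker_inverse(2)) (auto simp: ti_props)
  then show "?q \<cdot> ?i = Ident C (fst (mt b z \<star> y))" by (simp add: comp_assoc)
  let ?e = "te b (z \<star> y)"
  have "(?e \<cdot> al b (fst (z \<star> y))) \<cdot> ?p = (?e \<cdot> (?b \<triangleright> snd (z \<star> y))) \<cdot> ?p"
    by (simp only: te_coequalizes[OF assms(1) mten_module[OF assms(2,3)]])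
  moreover have "(?e \<cdot> al b (fst (z \<star> y))) \<cdot> ?p = ?e \<cdot> (al b (fst (z \<star> y)) \<cdot> ?p)"
    "(?e \<cdot> (?b \<triangleright> snd (z \<star> y))) \<cdot> ?p = ?e \<cdot> ((?b \<triangleright> snd (z \<star> y)) \<cdot> ?p)"
    by (intro comp_assoc; auto)+
  ultimately have ee: "?e \<cdot> Assoc C ?b ?x y \<cdot> (al b ?x \<triangleleft> y) =
      ?e \<cdot> Assoc C ?b ?x y \<cdot> ((?b \<triangleright> snd z) \<triangleleft> y)"
    by (simp only: co act)
  have "?e \<cdot> Assoc C ?b ?x y \<cdot> (te b z \<triangleleft> y) =
      (?e \<cdot> Assoc C ?b ?x y \<cdot> (al b ?x \<triangleleft> y)) \<cdot> ((?b \<triangleright> sg z) \<triangleleft> y)"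
    by (simp add: te_def[of b z] comp_norm)
  also have "\<dots> = ?e \<cdot> Assoc C ?b ?x y \<cdot> ((?b \<triangleright> (snd z \<cdot> sg z)) \<triangleleft> y)"
    unfolding ee by (simp add: comp_norm)
  finally have eA: "?e \<cdot> Assoc C ?b ?x y \<cdot> (te b z \<triangleleft> y) = ?e \<cdot> Assoc C ?b ?x y"
    by (simp add: act_sg)
  have "?e \<cdot> ?i \<cdot> ?q = (?e \<cdot> Assoc C ?b ?x y \<cdot> ((ti b z \<cdot> tq b z) \<triangleleft> y)) \<cdot> AssocI ?b ?x y"
    by (simp add: comp_norm)
  also have "\<dots> = (?e \<cdot> Assoc C ?b ?x y) \<cdot> AssocI ?b ?x y"
    by (simp only: ti_props(4)[OF assms(1,2)] eA)
  finally show "?e \<cdot> ?i \<cdot> ?q = ?e" by (simp add: comp_assoc)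
qed auto

text \<open>As \<open>\<gamma>\<close> is invertible, a map is balanced for the twisted modules if
  and only if it is balanced for the original ones, so \<open>tq b z\<close> is a projection for
  both.\<close>

lemma mt_tw:
  assumes \<gamma>: "is_ring_hom C A A \<gamma>" "is_iso C \<gamma>" and [simp]: "modl b" "modl z"
  shows "miso (mt (tw \<gamma> b) (tw \<gamma> z)) (tw \<gamma> (mt b z))"
proof (rule tensor_unique)
  note [simp] = ring_homD(1-3)[OF \<gamma>(1)]
  let ?b = "fst b" and ?x = "fst z"
  have inv: "\<gamma> \<cdot> inv_arr C \<gamma> = Ident C R" and [simp]: "inv_arr C \<gamma> \<in> Arr C"
    "Dom C (inv_arr C \<gamma>) = R" "Cod C (inv_arr C \<gamma>) = R"
    using inv_arr_simps[OF \<gamma>(2)] by auto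
  have rel: "t \<cdot> al (tw \<gamma> b) ?x = t \<cdot> (?b \<triangleright> snd (tw \<gamma> z)) \<longleftrightarrow>
      t \<cdot> al b ?x = t \<cdot> (?b \<triangleright> snd z)" if t: "t \<in> Arr C" "Dom C t = ?b \<boxtimes> ?x" for t
  proof -
    let ?g = "?b \<triangleright> (\<gamma> \<triangleleft> ?x)"
    have 1: "t \<cdot> al (tw \<gamma> b) ?x = (t \<cdot> al b ?x) \<cdot> ?g"
      using t by (simp add: al_tw[OF \<gamma>(1)] comp_assoc)
    have 2: "t \<cdot> (?b \<triangleright> snd (tw \<gamma> z)) = (t \<cdot> (?b \<triangleright> snd z)) \<cdot> ?g"
      using t by (simp add: tw_snd comp_norm)
    have "?g \<cdot> (?b \<triangleright> (inv_arr C \<gamma> \<triangleleft> ?x)) = Ident C (?b \<boxtimes> (R \<boxtimes> ?x))"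
      by (rule whisker_inverse(1)[OF whisker_inverse(2)[OF inv]]) auto
    then have *: "P \<cdot> ?g = Q \<cdot> ?g \<longleftrightarrow> P = Q"
      if "P \<in> Hom C (?b \<boxtimes> (R \<boxtimes> ?x)) w" "Q \<in> Hom C (?b \<boxtimes> (R \<boxtimes> ?x)) w" for P Q w
      using section_epi[of P ?g Q "?b \<triangleright> (inv_arr C \<gamma> \<triangleleft> ?x)" "?b \<boxtimes> (R \<boxtimes> ?x)"] that by auto
    show ?thesis unfolding 1 2
      by (rule *[of _ "Cod C t"]) (use t in auto)
  qed
  show m: "modl (tw \<gamma> b)" "modl (tw \<gamma> z)" using \<gamma>(1) by auto
  show "lin (tw \<gamma> b \<star> fst (tw \<gamma> z)) (tq b z) (tw \<gamma> (mt b z))"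
    using tw_lin[OF \<gamma>(1) mt_split(2)[OF assms(3,4)]] by (simp add: tw_mten[OF \<gamma>(1)])
  show "tq b z \<cdot> al (tw \<gamma> b) (fst (tw \<gamma> z)) = tq b z \<cdot> (fst (tw \<gamma> b) \<triangleright> snd (tw \<gamma> z))"
    using rel[of "tq b z"] by (simp add: tq_coequaliser)
  show "tq b z \<cdot> ti b z = Ident C (fst (tw \<gamma> (mt b z)))" by (simp add: ti_props)
  let ?e = "te (tw \<gamma> b) (tw \<gamma> z)"
  have "?e \<cdot> al b ?x = ?e \<cdot> (?b \<triangleright> snd z)"
    using rel[of ?e] te_coequalizes[OF m] m by simp
  then have "?e \<cdot> te b z = ?e" by (intro te_absorb) (use m in auto)
  then show "?e \<cdot> ti b z \<cdot> tq b z = ?e" by (simp add: ti_props)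
qed auto

text \<open>The isomorphism is induced by \<open>a \<otimes> n \<mapsto> \<delta>(a) n\<close>. It
  is balanced when scalars act on the left factor through \<open>\<gamma>\<close>, since
  \<open>\<delta>(a \<gamma>(a')) n = \<delta>(a) a' n\<close>: extension along
  \<open>\<gamma>\<close> is restriction along its inverse.\<close>

lemma ext_scalars_tw:
  assumes \<gamma>: "is_ring_hom C A A \<gamma>" and \<delta>: "is_ring_hom C A A \<delta>"
    and inv: "\<gamma> \<cdot> \<delta> = Ident C R" "\<delta> \<cdot> \<gamma> = Ident C R" and [simp]: "modl z"
  shows "miso (FObj (ext_scalars C A A \<gamma>) z) (tw \<delta> z)"
proof -
  note [simp] = ring_homD(1-3)[OF \<gamma>] ring_homD(1-3)[OF \<delta>]
  let ?b = "tw \<gamma> U" and ?x = "fst z" and ?w = "tw \<delta> z"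
  have m: "modl ?b" "modl ?w" using \<gamma> \<delta> by auto
  have alb: "al ?b y = snd (U \<star> y) \<cdot> (R \<triangleright> (\<gamma> \<triangleleft> y))" if "y \<in> Obj C" for y
    using al_tw[OF \<gamma>, of U y] that by (simp add: al_U)
  have b: "restrict_scalars C A \<gamma> = ?b" by (simp add: restrict_scalars_def tw_def)
  have Rgd: "(R \<triangleright> (\<gamma> \<triangleleft> ?x)) \<cdot> (R \<triangleright> (\<delta> \<triangleleft> ?x)) = Ident C (R \<boxtimes> (R \<boxtimes> ?x))"
    by (rule whisker_inverse(1)[OF whisker_inverse(2)[OF inv(1)]]) auto
  have Rdg: "(R \<triangleright> (\<delta> \<triangleleft> ?x)) \<cdot> (R \<triangleright> (\<gamma> \<triangleleft> ?x)) = Ident C (R \<boxtimes> (R \<boxtimes> ?x))"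
    by (rule whisker_inverse(1)[OF whisker_inverse(2)[OF inv(2)]]) auto
  \<comment> \<open>\<open>te_lin\<close> gives linearity over the twisted free module; twisting by
    \<open>\<delta>\<close> undoes the twist by \<open>\<gamma>\<close>.\<close>
  have elin: "lin (U \<star> ?x) (te ?b z) (U \<star> ?x)"
  proof -
    have "lin (tw \<delta> (tw \<gamma> (U \<star> ?x))) (te ?b z) (tw \<delta> (tw \<gamma> (U \<star> ?x)))"
      using tw_lin[OF \<delta> te_lin[OF m(1), of z]] by (simp add: tw_mten[OF \<gamma>])
    then show ?thesis by (simp add: tw_tw[OF \<delta> \<gamma>] inv)
  qed
  let ?F = "(Cod C (tq ?b z), ten_action C R \<mu> R ?x (tq ?b z))"
  have F: "lin ?F (ti ?b z) (U \<star> ?x)"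
    using ten_action_eq(3)[OF m(1) assms(5) module_U] elin by simp
  have q': "lin (U \<star> ?x) (snd ?w) ?w" using act_lin[OF m(2)] by simp
  have Rw: "(R \<triangleright> snd z) \<cdot> (R \<triangleright> (\<delta> \<triangleleft> ?x)) = R \<triangleright> snd ?w"
    by (simp add: tw_snd lwhisker_comp)
  have co: "snd ?w \<cdot> al ?b ?x = snd ?w \<cdot> (fst ?b \<triangleright> snd z)"
  proof -
    have "snd ?w \<cdot> al ?b ?x = (snd ?w \<cdot> snd (U \<star> ?x)) \<cdot> (R \<triangleright> (\<gamma> \<triangleleft> ?x))"
      using m by (simp add: alb comp_assoc)
    also have "\<dots> = snd ?w \<cdot> (R \<triangleright> snd z) \<cdot> ((R \<triangleright> (\<delta> \<triangleleft> ?x)) \<cdot> (R \<triangleright> (\<gamma> \<triangleleft> ?x)))"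
      unfolding linD(6)[OF q'] using m by (simp add: comp_assoc flip: Rw)
    finally show ?thesis using m unfolding Rdg by (simp)
  qed
  have e: "te ?b z \<cdot> sg ?w \<cdot> snd ?w = te ?b z"
  proof -
    have "te ?b z \<cdot> sg ?w \<cdot> snd ?w = te ?b z \<cdot> (R \<triangleright> snd ?w) \<cdot> cosec ?x"
      using m by (simp add: sg_act)
    also have "\<dots> = (te ?b z \<cdot> (fst ?b \<triangleright> snd z)) \<cdot> (R \<triangleright> (\<delta> \<triangleleft> ?x)) \<cdot> cosec ?x"
      unfolding Rw[symmetric] using m by (simp add: comp_assoc)
    also have "\<dots> = (te ?b z \<cdot> al ?b ?x) \<cdot> (R \<triangleright> (\<delta> \<triangleleft> ?x)) \<cdot> cosec ?x"
      by (simp only: te_coequalizes[OF m(1) assms(5)])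
    also have "\<dots> = te ?b z \<cdot> snd (U \<star> ?x) \<cdot> ((R \<triangleright> (\<gamma> \<triangleleft> ?x)) \<cdot> (R \<triangleright> (\<delta> \<triangleleft> ?x))) \<cdot> cosec ?x"
      using m by (simp add: alb comp_assoc)
    also have "\<dots> = te ?b z" unfolding Rgd using m by (simp add: act_cosec)
    finally show ?thesis .
  qed
  have "miso ?F ?w"
    by (rule misoI[OF lin_comp[OF F q'], of "tq ?b z \<cdot> sg ?w"])
      (use tensor_unique_iso[OF m(1) assms(5) _ _ _ _ _ _ co act_sg[OF m(2)] e] m in auto)
  then show ?thesis
    by (simp add: ext_scalars_def Let_def b)
qed

text \<open>Tensoring with the unit module is extension of scalars along the identity, and the twist
  by the identity is trivial.\<close>

lemma mt_U: 
  assumes "modl z"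
  shows "miso (mt U z) z"
proof -
  have "is_ring_hom C A A (Ident C R)"
    by (simp add: is_ring_hom_def)
  from ext_scalars_tw[OF this this _ _ assms] assms
  show ?thesis by (simp add: ext_scalars_def Let_def mod_tenO_def restrict_scalars_def)
qed

end

section \<open>The category of modules\<close>

context tt_ring
begin

abbreviation M :: "(('o, 'm) modl, ('o, 'm) modl_arr) tt" where "M \<equiv> ModCat C A"

lemma M_simps [simp]:
  "Obj M = {z. modl z}" "Dom M t = fst t" "Cod M t = snd (snd t)"
  "t \<in> Arr M \<longleftrightarrow> lin (fst t) (und t) (snd (snd t))"
  "Ident M z = (z, Ident C (fst z), z)" "Comp M (w, g, v) (z, f, w') = (z, g \<cdot> f, v)"
  "Add M (z, f, w) (z', g, w') = (z, Add C f g, w)" "ZeroArr M z w = (z, ZeroArr C (fst z) (fst w), w)"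
  "SuspO M z = mod_susp C A z" "TenO M z w = mod_tenO C A z w"
  by (simp_all add: ModCat_def lin_def)

lemma M_HomE:
  assumes "t \<in> Hom M z w"
  obtains f where "t = (z, f, w)" "lin z f w"
  using assms by (cases t) auto

lemma M_exactE:
  assumes "is_exact_triangle M x y z t u v"
  obtains f g h where "t = (x, f, y)" "u = (y, g, z)" "v = (z, h, mod_susp C A x)"
    "lin x f y" "lin y g z" "lin z h (mod_susp C A x)"
    "is_exact_triangle C (fst x) (fst y) (fst z) f g h"
proof -
  have T: "is_triangle M x y z t u v" "(t, u, v) \<in> Tri M"
    using assms by (auto simp: is_exact_triangle_def)
  obtain f where f: "t = (x, f, y)" "lin x f y"
    using T(1) by (cases t) (auto simp: is_triangle_def)
  obtain g where g: "u = (y, g, z)" "lin y g z"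
    using T(1) by (cases u) (auto simp: is_triangle_def)
  obtain h where h: "v = (z, h, mod_susp C A x)" "lin z h (mod_susp C A x)"
    using T(1) by (cases v) (auto simp: is_triangle_def)
  have "(f, g, h) \<in> Tri C" using T(2) f g h by (simp add: ModCat_def)
  then have "is_exact_triangle C (fst x) (fst y) (fst z) f g h"
    using linD[OF f(2)] linD[OF g(2)] linD[OF h(2)]
    by (auto simp: is_exact_triangle_def is_triangle_def)
  then show ?thesis using that f g h by blast
qed

lemma M_exactI:
  assumes "lin x f y" "lin y g z" "lin z h (mod_susp C A x)"
    "is_exact_triangle C (fst x) (fst y) (fst z) f g h"
  shows "is_exact_triangle M x y z (x, f, y) (y, g, z) (z, h, mod_susp C A x)"
  using assms linD[OF assms(1)] linD[OF assms(2)]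
  by (auto simp: is_exact_triangle_def is_triangle_def ModCat_def lin_def)

lemma M_category: "category M"
proof
  fix f assume "f \<in> Arr M"
  then show "Dom M f \<in> Obj M" "Cod M f \<in> Obj M" by (auto dest: linD)
next
  fix x assume "x \<in> Obj M"
  then show "Ident M x \<in> Hom M x x" by (simp add: lin_Ident)
next
  fix f g x y z assume "f \<in> Hom M x y" "g \<in> Hom M y z"
  then show "Comp M g f \<in> Hom M x z" by (elim M_HomE) (auto intro: lin_comp)
next
  fix f g h w x y z assume "f \<in> Hom M w x" "g \<in> Hom M x y" "h \<in> Hom M y z"
  then obtain f' g' h' where *: "f = (w, f', x)" "g = (x, g', y)" "h = (y, h', z)"
    "lin w f' x" "lin x g' y" "lin y h' z" by (metis M_HomE)
  show "Comp M (Comp M h g) f = Comp M h (Comp M g f)"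
    using linD(3-5)[OF *(4)] linD(3-5)[OF *(5)] linD(3-5)[OF *(6)] by (simp add: * comp_assoc)
next
  fix f x y assume "f \<in> Hom M x y"
  then obtain f' where *: "f = (x, f', y)" "lin x f' y" by (rule M_HomE)
  show "Comp M (Ident M y) f = f" "Comp M f (Ident M x) = f"
    using linD(3-5)[OF *(2)] by (simp_all add: *(1))
qed

lemma M_preadditive: "preadditive_category M"
proof (rule preadditive_category.intro[OF M_category], rule preadditive_category_axioms.intro)
  fix x y assume "x \<in> Obj M" "y \<in> Obj M"
  then have [simp]: "modl x" "modl y" by auto
  show "comm_group (hom_group M x y)"
  proof (rule comm_groupI)
    show "\<one>\<^bsub>hom_group M x y\<^esub> \<in> carrier (hom_group M x y)"
      using lin_zero[of x y] by (simp add: hom_group_def)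
  next
    fix f assume "f \<in> carrier (hom_group M x y)"
    then have "f \<in> Hom M x y" by (simp only: hom_group_def partial_object.simps)
    then obtain f' where f: "f = (x, f', y)" "lin x f' y" by (rule M_HomE)
    show "\<one>\<^bsub>hom_group M x y\<^esub> \<otimes>\<^bsub>hom_group M x y\<^esub> f = f"
      using linD(3-5)[OF f(2)] by (simp add: hom_group_def f(1))
    show "\<exists>g\<in>carrier (hom_group M x y). g \<otimes>\<^bsub>hom_group M x y\<^esub> f = \<one>\<^bsub>hom_group M x y\<^esub>"
      by (rule bexI[of _ "(x, neg_arr C f', y)"])
        (use lin_neg[OF f(2)] linD(3-5)[OF f(2)] in \<open>auto simp: hom_group_def f(1)\<close>)
    fix g assume "g \<in> carrier (hom_group M x y)"
    then have "g \<in> Hom M x y" by (simp only: hom_group_def partial_object.simps)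
    then obtain g' where g: "g = (x, g', y)" "lin x g' y" by (rule M_HomE)
    show "f \<otimes>\<^bsub>hom_group M x y\<^esub> g \<in> carrier (hom_group M x y)"
      by (simp add: hom_group_def f(1) g(1) lin_Add[OF f(2) g(2)])
    show "f \<otimes>\<^bsub>hom_group M x y\<^esub> g = g \<otimes>\<^bsub>hom_group M x y\<^esub> f"
      using linD(3-5)[OF f(2)] linD(3-5)[OF g(2)]
      by (simp add: hom_group_def f(1) g(1) Add_commute[of f' "fst x" "fst y" g'])
    fix h assume "h \<in> carrier (hom_group M x y)"
    then have "h \<in> Hom M x y" by (simp only: hom_group_def partial_object.simps)
    then obtain h' where h: "h = (x, h', y)" "lin x h' y" by (rule M_HomE)
    show "f \<otimes>\<^bsub>hom_group M x y\<^esub> g \<otimes>\<^bsub>hom_group M x y\<^esub> h =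
        f \<otimes>\<^bsub>hom_group M x y\<^esub> (g \<otimes>\<^bsub>hom_group M x y\<^esub> h)"
      using linD(3-5)[OF f(2)] linD(3-5)[OF g(2)] linD(3-5)[OF h(2)]
      by (simp add: hom_group_def f(1) g(1) h(1) Add_assoc[of f' "fst x" "fst y" g' h'])
  qed
next
  fix f f' g x y z assume "f \<in> Hom M x y" "f' \<in> Hom M x y" "g \<in> Hom M y z"
  then obtain a a' b where *: "f = (x, a, y)" "f' = (x, a', y)" "g = (y, b, z)"
    "lin x a y" "lin x a' y" "lin y b z" by (metis M_HomE)
  show "Comp M g (Add M f f') = Add M (Comp M g f) (Comp M g f')"
    using linD(3-5)[OF *(4)] linD(3-5)[OF *(5)] linD(3-5)[OF *(6)] by (simp add: * comp_Add)
next
  fix f g g' x y z assume "f \<in> Hom M x y" "g \<in> Hom M y z" "g' \<in> Hom M y z"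
  then obtain a b b' where *: "f = (x, a, y)" "g = (y, b, z)" "g' = (y, b', z)"
    "lin x a y" "lin y b z" "lin y b' z" by (metis M_HomE)
  show "Comp M (Add M g g') f = Add M (Comp M g f) (Comp M g' f)"
    using linD(3-5)[OF *(4)] linD(3-5)[OF *(5)] linD(3-5)[OF *(6)] by (simp add: * Add_comp)
qed

lemma M_zero_iff: "is_zero_obj M z \<longleftrightarrow> modl z \<and> is_zero_obj C (fst z)"
  unfolding preadditive_category.zero_obj_iff[OF M_preadditive] zero_obj_iff by auto

lemma zero_module:
  assumes z: "is_zero_obj C x"
  shows "modl (x, ZeroArr C (R \<boxtimes> x) x)"
proof (rule moduleI)
  have [simp]: "x \<in> Obj C" and i: "Ident C x = ZeroArr C x x" using z by (auto simp: zero_obj_iff)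
  have "LUnit C x = Ident C x \<cdot> LUnit C x" by simp
  then have "LUnit C x = ZeroArr C (UnitO C \<boxtimes> x) x" by (simp add: i)
  then show "ZeroArr C (R \<boxtimes> x) x \<cdot> (\<eta> \<triangleleft> x) = LUnit C x" by simp
qed (use z in \<open>auto simp: zero_obj_iff\<close>)

text \<open>A triangle of modules is exact when its underlying triangle is, so split triangles and
  suspension triangles lift once their arrows are seen to be linear; idempotents split by
  \<open>split_module\<close>.\<close>

lemma M_thick_setting: "thick_setting M"
proof (rule thick_setting.intro[OF M_preadditive], unfold_locales)
  obtain o' where o': "is_zero_obj C o'" using zero_obj_exists by blast
  define z where "z = (o', ZeroArr C (R \<boxtimes> o') o')"
  have z: "modl z" "is_zero_obj C (fst z)" "is_zero_obj M z"
    using zero_module[OF o'] o' by (auto simp: z_def M_zero_iff)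
  show "\<exists>z. is_zero_obj M z" using z by blast
  show "\<exists>z f g h. is_zero_obj M z \<and> is_exact_triangle M x z (SuspO M x) f g h" if "x \<in> Obj M" for x
  proof -
    have x [simp]: "modl x" using that by simp
    have "is_exact_triangle C (fst x) (fst z) (fst (mod_susp C A x)) (ZeroArr C (fst x) (fst z))
        (ZeroArr C (fst z) (fst (mod_susp C A x))) (neg_arr C (SuspA C (Ident C (fst x))))"
      using rotate[OF Ident_triangle[OF _ z(2), of "fst x"]] by simp
    then have "is_exact_triangle M x z (mod_susp C A x) (x, ZeroArr C (fst x) (fst z), z)
        (z, ZeroArr C (fst z) (fst (mod_susp C A x)), mod_susp C A x)
        (mod_susp C A x, neg_arr C (SuspA C (Ident C (fst x))), mod_susp C A x)"
      by (intro M_exactI lin_zero lin_neg lin_susp lin_Ident z) auto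
    then show ?thesis using z(3) unfolding M_simps by blast
  qed
next
  show "idempotent_complete M"
    unfolding idempotent_complete_def
  proof (intro ballI impI)
    fix v e assume e: "v \<in> Obj M" "e \<in> Hom M v v" "Comp M e e = e"
    obtain f where f: "e = (v, f, v)" "lin v f v" using e(2) by (rule M_HomE)
    then have ff: "f \<cdot> f = f" using e(3) by simp
    note [simp] = linD(1-5)[OF f(2)]
    have "\<exists>y\<in>Obj C. \<exists>r\<in>Hom C (fst v) y. \<exists>s\<in>Hom C y (fst v). s \<cdot> r = f \<and> r \<cdot> s = Ident C y"
      by (rule idempotent_complete[unfolded idempotent_complete_def, rule_format]) (auto simp: ff)
    then obtain y r s where rs: "r \<in> Hom C (fst v) y" "s \<in> Hom C y (fst v)" "s \<cdot> r = f"
      "r \<cdot> s = Ident C y" by blast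
    define w where "w = (y, r \<cdot> snd v \<cdot> (R \<triangleright> s))"
    have w: "modl w" "lin v r w" "lin w s v"
      using split_module[OF f(2), of r y s] rs by (auto simp: w_def)
    show "\<exists>y\<in>Obj M. \<exists>r\<in>Hom M v y. \<exists>s\<in>Hom M y v. Comp M s r = e \<and> Comp M r s = Ident M y"
      by (rule bexI[of _ w], rule bexI[of _ "(v, r, w)"], rule bexI[of _ "(w, s, v)"])
        (use w rs in \<open>auto simp: f(1) w_def\<close>)
  qed
next
  fix x y z i j p q
  assume "i \<in> Hom M x z" "j \<in> Hom M y z" "p \<in> Hom M z x" "q \<in> Hom M z y"
    and eq: "Comp M p i = Ident M x" "Comp M q j = Ident M y" "Comp M p j = ZeroArr M y x"
      "Comp M q i = ZeroArr M x y" "Add M (Comp M i p) (Comp M j q) = Ident M z"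
  then obtain i' j' p' q' where *: "i = (x, i', z)" "j = (y, j', z)" "p = (z, p', x)" "q = (z, q', y)"
    "lin x i' z" "lin y j' z" "lin z p' x" "lin z q' y" by (metis M_HomE)
  note [simp] = linD(1-5)[OF *(5)] linD(1-5)[OF *(6)] linD(1-5)[OF *(7)] linD(1-5)[OF *(8)]
  have "is_exact_triangle C (fst x) (fst z) (fst y) i' q' (ZeroArr C (fst y) (fst (mod_susp C A x)))"
    using split_triangle[of i' "fst x" "fst z" j' "fst y" p' q'] eq by (simp add: *(1-4))
  then have "is_exact_triangle M x z y (x, i', z) (z, q', y)
      (y, ZeroArr C (fst y) (fst (mod_susp C A x)), mod_susp C A x)"
    by (intro M_exactI lin_zero *) auto
  then show "is_exact_triangle M x z y i q (ZeroArr M y (SuspO M x))" by (simp add: *(1-4))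
qed

lemma M_retract:
  assumes "thick M J" "lin y s x" "lin x r y" "r \<cdot> s = Ident C (fst y)" "x \<in> J"
  shows "y \<in> J"
  by (rule thick_setting.retract_closed[OF M_thick_setting assms(1), of "(y, s, x)" _ x "(x, r, y)"])
    (use assms in auto)

lemma M_thickI:
  assumes "\<And>z. z \<in> J \<Longrightarrow> modl z"
    and "\<And>z. \<lbrakk>modl z; is_zero_obj C (fst z)\<rbrakk> \<Longrightarrow> z \<in> J"
    and ret: "\<And>x y r s. \<lbrakk>x \<in> J; lin y s x; lin x r y; r \<cdot> s = Ident C (fst y)\<rbrakk> \<Longrightarrow> y \<in> J"
    and tri: "\<And>x y z f g h. \<lbrakk>lin x f y; lin y g z; lin z h (mod_susp C A x);
        is_exact_triangle C (fst x) (fst y) (fst z) f g h\<rbrakk> \<Longrightarrow>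
        (x \<in> J \<and> y \<in> J \<longrightarrow> z \<in> J) \<and> (y \<in> J \<and> z \<in> J \<longrightarrow> x \<in> J) \<and> (x \<in> J \<and> z \<in> J \<longrightarrow> y \<in> J)"
  shows "thick M J"
proof (rule thick_setting.thickI[OF M_thick_setting])
  show "J \<subseteq> Obj M" using assms(1) by auto
  show "z \<in> J" if "is_zero_obj M z" for z using that assms(2) by (simp add: M_zero_iff)
  show "y \<in> J" if "x \<in> J" "s \<in> Hom M y x" "r \<in> Hom M x y" "Comp M r s = Ident M y" for x y r s
    using that(2,3)
  proof (elim M_HomE)
    fix f g assume "s = (y, f, x)" "lin y f x" "r = (x, g, y)" "lin x g y"
    then show "y \<in> J" using ret[OF that(1), of y f g] that(4) by simp
  qed
  show "(x \<in> J \<and> y \<in> J \<longrightarrow> z \<in> J) \<and> (y \<in> J \<and> z \<in> J \<longrightarrow> x \<in> J) \<and> (x \<in> J \<and> z \<in> J \<longrightarrow> y \<in> J)"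
    if "is_exact_triangle M x y z f g h" for x y z f g h
    using that by (rule M_exactE) (use tri in blast)
qed

lemma M_triangleD:
  assumes "thick M J" "lin x f y" "lin y g z" "lin z h (mod_susp C A x)"
    "is_exact_triangle C (fst x) (fst y) (fst z) f g h"
  shows "(x \<in> J \<and> y \<in> J \<longrightarrow> z \<in> J) \<and> (y \<in> J \<and> z \<in> J \<longrightarrow> x \<in> J) \<and> (x \<in> J \<and> z \<in> J \<longrightarrow> y \<in> J)"
proof -
  have "\<forall>x y z f g h. is_exact_triangle M x y z f g h \<longrightarrow>
        (x \<in> J \<and> y \<in> J \<longrightarrow> z \<in> J) \<and> (y \<in> J \<and> z \<in> J \<longrightarrow> x \<in> J) \<and> (x \<in> J \<and> z \<in> J \<longrightarrow> y \<in> J)"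
    using assms(1) unfolding thick_def triangulated_subcat_def by blast
  from this[rule_format, OF M_exactI[OF assms(2-5)]] show ?thesis by blast
qed

lemma M_thickD:
  assumes "thick M J"
  shows "z \<in> J \<Longrightarrow> modl z" "\<lbrakk>modl z; is_zero_obj C (fst z)\<rbrakk> \<Longrightarrow> z \<in> J"
proof -
  have J: "J \<subseteq> Obj M" "{z. is_zero_obj M z} \<subseteq> J"
    using assms unfolding thick_def triangulated_subcat_def by blast+
  show "z \<in> J \<Longrightarrow> modl z" "\<lbrakk>modl z; is_zero_obj C (fst z)\<rbrakk> \<Longrightarrow> z \<in> J"
    using J by (auto simp: M_zero_iff)
qed

end

section \<open>Thick ideals of modules\<close>

context separable_ring
begin

lemma M_iso: "\<lbrakk>thick M J; miso z w; z \<in> J\<rbrakk> \<Longrightarrow> w \<in> J"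
  unfolding miso_def by (elim exE conjE, rule M_retract) auto

lemma mt_retract:
  assumes b: "modl b" and s: "lin y s x" and r: "lin x r y" and rs: "r \<cdot> s = Ident C (fst y)"
  obtains s' r' where "lin (mt b y) s' (mt b x)" "lin (mt b x) r' (mt b y)"
    "r' \<cdot> s' = Ident C (fst (mt b y))"
proof -
  note m [simp] = b linD(1-5)[OF s] linD(1-5)[OF r]
  let ?b = "fst b"
  let ?s = "tq b x \<cdot> (?b \<triangleright> s) \<cdot> ti b y" and ?r = "tq b y \<cdot> (?b \<triangleright> r) \<cdot> ti b x"
  have "lin (mt b y) ?s (mt b x)"
    by (rule lin_comp[OF lin_comp[OF mt_split(3) mten_lin_right] mt_split(2)]) auto
  moreover have "lin (mt b x) ?r (mt b y)"
    by (rule lin_comp[OF lin_comp[OF mt_split(3) mten_lin_right] mt_split(2)]) auto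
  moreover have "?r \<cdot> ?s = Ident C (fst (mt b y))"
  proof -
    have "?r \<cdot> ?s = tq b y \<cdot> ((?b \<triangleright> r) \<cdot> (ti b x \<cdot> tq b x)) \<cdot> (?b \<triangleright> s) \<cdot> ti b y"
      by (simp add: comp_assoc)
    also have "(?b \<triangleright> r) \<cdot> (ti b x \<cdot> tq b x) = te b y \<cdot> (?b \<triangleright> r)"
      by (simp add: ti_props te_nat[OF b r])
    also have "tq b y \<cdot> (te b y \<cdot> (?b \<triangleright> r)) \<cdot> (?b \<triangleright> s) \<cdot> ti b y =
        (tq b y \<cdot> te b y) \<cdot> (?b \<triangleright> (r \<cdot> s)) \<cdot> ti b y"
      by (simp add: comp_norm)
    also have "\<dots> = Ident C (fst (mt b y))" by (simp add: rs tq_te ti_props)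
    finally show ?thesis .
  qed
  ultimately show ?thesis by (rule that)
qed

lemma mt_zero:
  assumes [simp]: "modl b" "modl z" and z: "is_zero_obj C (fst z)"
  shows "is_zero_obj C (fst (mt b z))"
proof -
  let ?x = "fst b \<boxtimes> fst z" and ?w = "Cod C (tq b z)"
  have "is_zero_obj C ?x" by (rule zero_tensor) (use z in auto)
  then have i: "Ident C ?x = ZeroArr C ?x ?x" by (simp add: zero_obj_iff)
  have "Ident C ?w = tq b z \<cdot> (Ident C ?x \<cdot> ti b z)" by (simp add: ti_props)
  also have "\<dots> = ZeroArr C ?w ?w" unfolding i by simp
  finally show ?thesis by (simp add: zero_obj_iff)
qed

text \<open>By \<open>te_nat\<close> and \<open>te_susp\<close> the idempotents \<open>te\<close>
  form an endomorphism of the exact triangle obtained by tensoring with \<open>fst b\<close>. Its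
  image is the triangle of tensor products over \<open>A\<close>, exact by
  \<open>retract_triangle\<close>.\<close>

lemma mt_triangle:
  assumes b: "modl b" and f: "lin x f y" and g: "lin y g z" and h: "lin z h (mod_susp C A x)"
    and T: "is_exact_triangle C (fst x) (fst y) (fst z) f g h"
  obtains f' g' h' where "lin (mt b x) f' (mt b y)" "lin (mt b y) g' (mt b z)"
    "lin (mt b z) h' (mod_susp C A (mt b x))"
    "is_exact_triangle C (fst (mt b x)) (fst (mt b y)) (fst (mt b z)) f' g' h'"
proof -
  note m [simp] = b linD(1-5)[OF f] linD(1-5)[OF g] linD(3-5)[OF h]
  let ?b = "fst b" and ?T = "TenSusp C (fst b) (fst x)"
  let ?f = "tq b y \<cdot> (?b \<triangleright> f) \<cdot> ti b x" and ?g = "tq b z \<cdot> (?b \<triangleright> g) \<cdot> ti b y"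
    and ?h = "SuspA C (tq b x) \<cdot> (?T \<cdot> (?b \<triangleright> h)) \<cdot> ti b z"
  have lf: "lin (mt b x) ?f (mt b y)" and lg: "lin (mt b y) ?g (mt b z)"
    by (rule lin_comp[OF lin_comp[OF mt_split(3) mten_lin_right] mt_split(2)]; auto)+
  have "lin (b \<star> fst z) (?T \<cdot> (?b \<triangleright> h)) (mod_susp C A (b \<star> fst x))"
    by (rule lin_comp[OF mten_lin_right TenSusp_lin]) auto
  then have lh: "lin (mt b z) ?h (mod_susp C A (mt b x))"
    by (intro lin_comp[OF lin_comp[OF mt_split(3)] lin_susp[OF mt_split(2)]]) auto
  have ef: "te b y \<cdot> (?b \<triangleright> f) = (?b \<triangleright> f) \<cdot> te b x" and eg: "te b z \<cdot> (?b \<triangleright> g) = (?b \<triangleright> g) \<cdot> te b y"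
    by (rule te_nat[OF b f], rule te_nat[OF b g])
  have eh: "SuspA C (te b x) \<cdot> (?T \<cdot> (?b \<triangleright> h)) = (?T \<cdot> (?b \<triangleright> h)) \<cdot> te b z"
  proof -
    have "SuspA C (te b x) \<cdot> (?T \<cdot> (?b \<triangleright> h)) = (SuspA C (te b x) \<cdot> ?T) \<cdot> (?b \<triangleright> h)"
      by (simp add: comp_assoc)
    also have "\<dots> = ?T \<cdot> (te b (mod_susp C A x) \<cdot> (?b \<triangleright> h))"
      unfolding te_susp[OF b m(2)] by (simp add: comp_assoc)
    also have "\<dots> = (?T \<cdot> (?b \<triangleright> h)) \<cdot> te b z" by (simp add: te_nat[OF b h] comp_assoc)
    finally show ?thesis .
  qed
  have [simp]: "modl (mt b x)" "modl (mt b y)" "modl (mt b z)" by (simp_all add: mt_split)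
  have "is_exact_triangle C (fst (mt b x)) (fst (mt b y)) (fst (mt b z)) ?f ?g ?h"
  proof (rule retract_triangle[OF ten_triangle[OF _ T, of ?b], of _ _ _ _ _ _ "ti b x" "ti b y" "ti b z" "tq b x" "tq b y" "tq b z"])
    show "is_triangle C (fst (mt b x)) (fst (mt b y)) (fst (mt b z)) ?f ?g ?h"
      unfolding is_triangle_def
      using linD(3-5)[OF lf] linD(3-5)[OF lg] linD(3-5)[OF lh] by simp
    have iq: "k \<cdot> (te b w \<cdot> ti b w) = k \<cdot> ti b w" if "modl w" "k \<in> Arr C" "Dom C k = ?b \<boxtimes> fst w" for k w
    proof -
      have "te b w \<cdot> ti b w = ti b w \<cdot> (tq b w \<cdot> ti b w)"
        unfolding ti_props(4)[OF b that(1), symmetric] using that by (intro comp_assoc) auto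
      then show ?thesis using that by (simp add: ti_props)
    qed
    have qe: "tq b w \<cdot> (te b w \<cdot> k) = tq b w \<cdot> k" if "modl w" "k \<in> Arr C" "Cod C k = ?b \<boxtimes> fst w" for k w
      using comp_reassoc[OF tq_te[OF b that(1)], of k] that by simp
    have iqk: "ti b w \<cdot> (tq b w \<cdot> k) = te b w \<cdot> k" if "modl w" "k \<in> Arr C" "Cod C k = ?b \<boxtimes> fst w" for k w
      using comp_reassoc[OF ti_props(4)[OF b that(1)], of k] that by simp
    have Siq: "SuspA C (ti b x) \<cdot> (SuspA C (tq b x) \<cdot> k) = SuspA C (te b x) \<cdot> k"
      if "k \<in> Arr C" "Cod C k = SuspO C (?b \<boxtimes> fst x)" for k
      by (rule comp_reassoc) (use that in \<open>auto simp: ti_props simp flip: SuspA_comp\<close>)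
    show "ti b y \<cdot> ?f = (?b \<triangleright> f) \<cdot> ti b x"
      using comp_reassoc[OF ef, of "ti b x"] by (simp add: iqk comp_assoc iq)
    show "ti b z \<cdot> ?g = (?b \<triangleright> g) \<cdot> ti b y"
      using comp_reassoc[OF eg, of "ti b y"] by (simp add: iqk comp_assoc iq)
    show "SuspA C (ti b x) \<cdot> ?h = (?T \<cdot> (?b \<triangleright> h)) \<cdot> ti b z"
    proof -
      have "SuspA C (ti b x) \<cdot> ?h = (SuspA C (te b x) \<cdot> (?T \<cdot> (?b \<triangleright> h))) \<cdot> ti b z"
        by (simp add: Siq comp_assoc)
      also have "\<dots> = (?T \<cdot> (?b \<triangleright> h)) \<cdot> (te b z \<cdot> ti b z)"
        unfolding eh by (simp add: comp_assoc)
      finally show ?thesis by (simp add: iq)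
    qed
    show "tq b y \<cdot> (?b \<triangleright> f) = ?f \<cdot> tq b x"
    proof -
      have "?f \<cdot> tq b x = tq b y \<cdot> ((?b \<triangleright> f) \<cdot> te b x)" by (simp add: comp_assoc ti_props)
      then show ?thesis unfolding ef[symmetric] by (simp add: qe)
    qed
    show "tq b z \<cdot> (?b \<triangleright> g) = ?g \<cdot> tq b y"
    proof -
      have "?g \<cdot> tq b y = tq b z \<cdot> ((?b \<triangleright> g) \<cdot> te b y)" by (simp add: comp_assoc ti_props)
      then show ?thesis unfolding eg[symmetric] by (simp add: qe)
    qed
    show "SuspA C (tq b x) \<cdot> (?T \<cdot> (?b \<triangleright> h)) = ?h \<cdot> tq b z"
    proof -
      have "?h \<cdot> tq b z = SuspA C (tq b x) \<cdot> ((?T \<cdot> (?b \<triangleright> h)) \<cdot> te b z)"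
        by (simp add: comp_assoc ti_props)
      also have "\<dots> = (SuspA C (tq b x) \<cdot> SuspA C (te b x)) \<cdot> (?T \<cdot> (?b \<triangleright> h))"
        unfolding eh[symmetric] by (simp add: comp_assoc)
      also have "SuspA C (tq b x) \<cdot> SuspA C (te b x) = SuspA C (tq b x)"
        using tq_te[OF b m(2)] by (simp flip: SuspA_comp)
      finally show ?thesis ..
    qed
  qed (simp_all add: ti_props)
  with lf lg lh show ?thesis by (rule that)
qed

lemma miso_mten:
  assumes "miso z w" "y \<in> Obj C"
  shows "miso (z \<star> y) (w \<star> y)"
proof -
  obtain f g where fg: "lin z f w" "lin w g z" "g \<cdot> f = Ident C (fst z)" "f \<cdot> g = Ident C (fst w)"
    using assms(1) unfolding miso_def by blast
  show ?thesis
    by (rule misoI[OF mten_lin_left[OF fg(1) assms(2)], of "g \<triangleleft> y"])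
      (use assms(2) linD(1-5)[OF fg(1)] linD(1-5)[OF fg(2)] fg(3,4)
        in \<open>auto simp flip: rwhisker_comp\<close>)
qed

lemma miso_trans: "\<lbrakk>miso x y; miso y z\<rbrakk> \<Longrightarrow> miso x z"
proof -
  assume "miso x y" "miso y z"
  then obtain f g f' g' where 1: "lin x f y" "lin y g x" "g \<cdot> f = Ident C (fst x)" "f \<cdot> g = Ident C (fst y)"
    and 2: "lin y f' z" "lin z g' y" "g' \<cdot> f' = Ident C (fst y)" "f' \<cdot> g' = Ident C (fst z)"
    unfolding miso_def by metis
  note [simp] = linD(1-5)[OF 1(1)] linD(3-5)[OF 1(2)] linD(1-5)[OF 2(1)] linD(3-5)[OF 2(2)]
  show "miso x z"
    by (rule misoI[OF lin_comp[OF 1(1) 2(1)], of "g \<cdot> g'"])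
      (simp_all add: comp_assoc comp_reassoc[OF 2(3)] comp_reassoc[OF 1(4)] 1 2)
qed

text \<open>Associativity \<open>mt_mten\<close> with the unit module in the middle, which
  commutativity and \<open>mt_U\<close> then remove.\<close>

lemma mt_free:
  assumes "modl z" "y \<in> Obj C"
  shows "miso (mt z (U \<star> y)) (z \<star> y)"
  using miso_trans[OF mt_mten miso_mten[OF miso_trans[OF mt_commute mt_U]]] assms by simp

lemma ideal_TenO: "\<lbrakk>thick_ideal M J; modl x; z \<in> J\<rbrakk> \<Longrightarrow> mt x z \<in> J"
  unfolding thick_ideal_def M_simps by blast

text \<open>Every module \<open>x\<close> is a retract of the free module on \<open>fst x\<close>,
  and tensoring over \<open>A\<close> with a free module is tensoring with an object of the base
  category. So ideals can be tested without \<open>\<otimes>\<^sub>A\<close>.\<close>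

lemma ideal_iff:
  "thick_ideal M J \<longleftrightarrow> thick M J \<and> (\<forall>z\<in>J. \<forall>y\<in>Obj C. z \<star> y \<in> J)"
proof safe
  assume J: "thick_ideal M J"
  then show T: "thick M J" by (simp add: thick_ideal_def)
  fix a b y assume z: "(a, b) \<in> J" and y: "y \<in> Obj C"
  let ?z = "(a, b)"
  have mz: "modl ?z" using M_thickD[OF T] z by blast
  have "mt (U \<star> y) ?z \<in> J" using ideal_TenO[OF J _ z] y by simp
  then have "mt ?z (U \<star> y) \<in> J" by (rule M_iso[OF T mt_commute, rotated 2]) (use mz y in auto)
  then show "?z \<star> y \<in> J" using M_iso[OF T mt_free[OF mz y]] by blast
next
  assume T: "thick M J" and *: "\<forall>z\<in>J. \<forall>y\<in>Obj C. z \<star> y \<in> J"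
  have "mt x z \<in> J" if x: "modl x" and z: "z \<in> J" for x z
  proof -
    have mz: "modl z" using M_thickD[OF T] z by blast
    have "mt z (U \<star> fst x) \<in> J"
      using M_iso[OF T miso_sym[OF mt_free[OF mz, of "fst x"]]] * z x by auto
    moreover obtain s r where "lin (mt z x) s (mt z (U \<star> fst x))" "lin (mt z (U \<star> fst x)) r (mt z x)"
      "r \<cdot> s = Ident C (fst (mt z x))"
      using mt_retract[OF mz sg_lin[OF x] act_lin[OF x] act_sg[OF x]] by metis
    ultimately have "mt z x \<in> J" using M_retract[OF T] by blast
    then show ?thesis by (rule M_iso[OF T mt_commute[OF mz x]])
  qed
  then show "thick_ideal M J" using T by (auto simp: thick_ideal_def)
qed

lemma ideal_mt:
  assumes "thick_ideal M J" "z \<in> J" "modl x"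
  shows "mt x z \<in> J" "mt z x \<in> J"
proof -
  have T: "thick M J" using assms by (simp add: thick_ideal_def)
  show 1: "mt x z \<in> J" using ideal_TenO assms by blast
  show "mt z x \<in> J"
    by (rule M_iso[OF T mt_commute 1]) (use assms M_thickD[OF T] in auto)
qed

text \<open>The ideal quotient of \<open>J\<close> by \<open>b\<close>, to be played off against a
  maximal ideal in \<open>phi_surj\<close>. Closure under triangles uses exactness of
  \<open>\<otimes>\<^sub>A\<close>.\<close>

lemma ideal_quotient:
  assumes J: "thick_ideal M J" and b: "modl b"
  shows "thick_ideal M {z. modl z \<and> mt b z \<in> J}"
  unfolding ideal_iff
proof (intro conjI ballI)
  have T: "thick M J" using J by (simp add: thick_ideal_def)
  show "thick M {z. modl z \<and> mt b z \<in> J}"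
  proof (rule M_thickI)
    fix z assume "modl z" "is_zero_obj C (fst z)"
    then show "z \<in> {z. modl z \<and> mt b z \<in> J}"
      using M_thickD(2)[OF T mt_split(1)[OF b] mt_zero[OF b]] by blast
  next
    fix x y r s assume x: "x \<in> {z. modl z \<and> mt b z \<in> J}" and sr: "lin y s x" "lin x r y"
      "r \<cdot> s = Ident C (fst y)"
    obtain s' r' where "lin (mt b y) s' (mt b x)" "lin (mt b x) r' (mt b y)"
      "r' \<cdot> s' = Ident C (fst (mt b y))"
      using mt_retract[OF b sr] by metis
    then have "mt b y \<in> J" using M_retract[OF T] x by blast
    then show "y \<in> {z. modl z \<and> mt b z \<in> J}" using linD(1)[OF sr(1)] by blast
  next
    fix x y z f g h assume tri: "lin x f y" "lin y g z" "lin z h (mod_susp C A x)"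
      "is_exact_triangle C (fst x) (fst y) (fst z) f g h"
    obtain f' g' h' where "lin (mt b x) f' (mt b y)" "lin (mt b y) g' (mt b z)"
      "lin (mt b z) h' (mod_susp C A (mt b x))"
      "is_exact_triangle C (fst (mt b x)) (fst (mt b y)) (fst (mt b z)) f' g' h'"
      using mt_triangle[OF b tri] by metis
    from M_triangleD[OF T this] linD(1,2)[OF tri(1)] linD(2)[OF tri(2)]
    show "(x \<in> {z. modl z \<and> mt b z \<in> J} \<and> y \<in> {z. modl z \<and> mt b z \<in> J} \<longrightarrow>
        z \<in> {z. modl z \<and> mt b z \<in> J}) \<and>
      (y \<in> {z. modl z \<and> mt b z \<in> J} \<and> z \<in> {z. modl z \<and> mt b z \<in> J} \<longrightarrow>
        x \<in> {z. modl z \<and> mt b z \<in> J}) \<and>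
      (x \<in> {z. modl z \<and> mt b z \<in> J} \<and> z \<in> {z. modl z \<and> mt b z \<in> J} \<longrightarrow>
        y \<in> {z. modl z \<and> mt b z \<in> J})" by blast
  qed simp
  fix z y assume z: "z \<in> {z. modl z \<and> mt b z \<in> J}" and y: "y \<in> Obj C"
  then have "mt b z \<star> y \<in> J" using J unfolding ideal_iff by blast
  then have "mt b (z \<star> y) \<in> J"
    by (rule M_iso[OF T miso_sym[OF mt_mten], rotated -1]) (use b z y in auto)
  then show "z \<star> y \<in> {z. modl z \<and> mt b z \<in> J}" using z y by simp
qed

end

section \<open>Quasi-Galois rings\<close>

context tt_ring
begin

text \<open>An inclusion of the decomposition is linear because all its composites with the jointly monic
  linear projections are.\<close>

lemma inclusion_lin:
  assumes [simp]: "modl z" and hom: "\<And>\<gamma>. \<gamma> \<in> \<Gamma> \<Longrightarrow> is_ring_hom C A A \<gamma>"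
    and B: "bisum \<Gamma> (\<lambda>_. fst z) (R \<boxtimes> fst z) (\<lambda>\<gamma>. snd (tw \<gamma> z)) inc" and \<gamma>: "\<gamma> \<in> \<Gamma>"
  shows "lin (tw \<gamma> z) (inc \<gamma>) (U \<star> fst z)"
proof (rule linI)
  have i [simp]: "inc \<gamma> \<in> Arr C" "Dom C (inc \<gamma>) = fst z" "Cod C (inc \<gamma>) = R \<boxtimes> fst z"
    using B \<gamma> by (auto simp: bisum_def)
  show m: "modl (tw \<gamma> z)" using hom \<gamma> by simp
  show "inc \<gamma> \<cdot> snd (tw \<gamma> z) = snd (U \<star> fst z) \<cdot> (R \<triangleright> inc \<gamma>)"
  proof (rule bisum_jointly_monic[OF B])
    fix \<delta> assume \<delta>: "\<delta> \<in> \<Gamma>"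
    have d [simp]: "modl (tw \<delta> z)" using hom \<delta> by simp
    have pi: "snd (tw \<delta> z) \<cdot> inc \<gamma> =
        (if \<delta> = \<gamma> then Ident C (fst z) else ZeroArr C (fst z) (fst z))"
      using B \<delta> \<gamma> by (auto simp: bisum_def)
    have "snd (tw \<delta> z) \<cdot> (snd (U \<star> fst z) \<cdot> (R \<triangleright> inc \<gamma>)) =
        (snd (tw \<delta> z) \<cdot> snd (U \<star> fst z)) \<cdot> (R \<triangleright> inc \<gamma>)"
      by (simp add: comp_assoc)
    also have "\<dots> = snd (tw \<delta> z) \<cdot> (R \<triangleright> (snd (tw \<delta> z) \<cdot> inc \<gamma>))"
      using linD(6)[OF act_lin[OF d]] by (simp add: comp_norm)
    finally have 1: "snd (tw \<delta> z) \<cdot> (snd (U \<star> fst z) \<cdot> (R \<triangleright> inc \<gamma>)) =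
      snd (tw \<delta> z) \<cdot> (R \<triangleright> (snd (tw \<delta> z) \<cdot> inc \<gamma>))" .
    have 2: "snd (tw \<delta> z) \<cdot> (inc \<gamma> \<cdot> snd (tw \<gamma> z)) = (snd (tw \<delta> z) \<cdot> inc \<gamma>) \<cdot> snd (tw \<gamma> z)"
      using m by (simp add: comp_assoc)
    show "snd (tw \<delta> z) \<cdot> (inc \<gamma> \<cdot> snd (tw \<gamma> z)) =
        snd (tw \<delta> z) \<cdot> (snd (U \<star> fst z) \<cdot> (R \<triangleright> inc \<gamma>))"
      unfolding 1 2 pi using m d by simp
  qed (use m in auto)
qed (use B \<gamma> in \<open>auto simp: bisum_def\<close>)

text \<open>The section is the inclusion of the component at the identity, where the projection is
  \<open>\<mu>\<close>. Left linearity comes from \<open>inclusion_lin\<close>; right linearity is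
  checked on components, where associativity of \<open>\<mu>\<close> reduces it to the orthogonality
  relations.\<close>

lemma separable_from_bisum:
  assumes hom: "\<And>\<gamma>. \<gamma> \<in> \<Gamma> \<Longrightarrow> is_ring_hom C A A \<gamma>" and 1: "Ident C R \<in> \<Gamma>"
    and B: "bisum \<Gamma> (\<lambda>_. R) (R \<boxtimes> R) (\<lambda>\<gamma>. \<mu> \<cdot> (\<gamma> \<triangleleft> R)) inc"
  shows "separable_ring C A (inc (Ident C R))"
proof unfold_locales
  let ?s = "inc (Ident C R)"
  have s [simp]: "?s \<in> Arr C" "Dom C ?s = R" "Cod C ?s = R \<boxtimes> R"
    using B 1 by (auto simp: bisum_def)
  show "?s \<in> Hom C R (R \<boxtimes> R)" by simp
  have pi: "\<mu> \<cdot> (\<delta> \<triangleleft> R) \<cdot> ?s = (if \<delta> = Ident C R then Ident C R else ZeroArr C R R)"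
    if "\<delta> \<in> \<Gamma>" for \<delta>
  proof -
    have "(\<mu> \<cdot> (\<delta> \<triangleleft> R)) \<cdot> ?s = (if \<delta> = Ident C R then Ident C R else ZeroArr C R R)"
      using B 1 that unfolding bisum_def by blast
    then show ?thesis using ring_homD(1-3)[OF hom[OF that]] by (simp add: comp_assoc)
  qed
  show "\<mu> \<cdot> ?s = Ident C R" using pi[OF 1] by simp
  have "bisum \<Gamma> (\<lambda>_. fst U) (R \<boxtimes> fst U) (\<lambda>\<gamma>. snd (tw \<gamma> U)) inc"
    using B by (simp add: tw_snd)
  from inclusion_lin[OF module_U hom this 1]
  have "lin U ?s (U \<star> R)" by simp
  from linD(6)[OF this] show "?s \<cdot> \<mu> = (\<mu> \<triangleleft> R) \<cdot> AssocI R R R \<cdot> (R \<triangleright> ?s)"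
    by (simp add: mten_snd comp_assoc)
  show "?s \<cdot> \<mu> = (R \<triangleright> \<mu>) \<cdot> Assoc C R R R \<cdot> (?s \<triangleleft> R)"
  proof (rule bisum_jointly_monic[OF B])
    fix \<delta> assume \<delta>: "\<delta> \<in> \<Gamma>"
    note d [simp] = ring_homD(1-3)[OF hom[OF \<delta>]]
    let ?c = "if \<delta> = Ident C R then Ident C R else ZeroArr C R R"
    have "(\<mu> \<cdot> (\<delta> \<triangleleft> R)) \<cdot> ((R \<triangleright> \<mu>) \<cdot> Assoc C R R R \<cdot> (?s \<triangleleft> R)) =
        \<mu> \<cdot> ((\<delta> \<triangleleft> R) \<cdot> (R \<triangleright> \<mu>)) \<cdot> Assoc C R R R \<cdot> (?s \<triangleleft> R)"
      by (simp add: comp_assoc)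
    also have "(\<delta> \<triangleleft> R) \<cdot> (R \<triangleright> \<mu>) = (R \<triangleright> \<mu>) \<cdot> (\<delta> \<triangleleft> (R \<boxtimes> R))"
      by (rule whisker_exchange) auto
    also have "\<mu> \<cdot> ((R \<triangleright> \<mu>) \<cdot> (\<delta> \<triangleleft> (R \<boxtimes> R))) \<cdot> Assoc C R R R \<cdot> (?s \<triangleleft> R) =
        (\<mu> \<cdot> (R \<triangleright> \<mu>) \<cdot> Assoc C R R R) \<cdot> ((\<delta> \<triangleleft> R) \<triangleleft> R) \<cdot> (?s \<triangleleft> R)"
      by (simp add: comp_assoc coherence_nat')
    also have "\<dots> = \<mu> \<cdot> ((\<mu> \<cdot> (\<delta> \<triangleleft> R) \<cdot> ?s) \<triangleleft> R)"
      unfolding ring_laws(1)[symmetric] by (simp add: comp_norm)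
    also have "\<dots> = \<mu> \<cdot> (?c \<triangleleft> R)" unfolding pi[OF \<delta>] ..
    also have "\<dots> = ?c \<cdot> \<mu>" by simp
    also have "\<dots> = (\<mu> \<cdot> (\<delta> \<triangleleft> R) \<cdot> ?s) \<cdot> \<mu>" unfolding pi[OF \<delta>] ..
    also have "\<dots> = (\<mu> \<cdot> (\<delta> \<triangleleft> R)) \<cdot> (?s \<cdot> \<mu>)" by (simp add: comp_assoc)
    finally show "(\<mu> \<cdot> (\<delta> \<triangleleft> R)) \<cdot> (?s \<cdot> \<mu>) =
        (\<mu> \<cdot> (\<delta> \<triangleleft> R)) \<cdot> ((R \<triangleright> \<mu>) \<cdot> Assoc C R R R \<cdot> (?s \<triangleleft> R))" ..
  qed auto
qed

section \<open>The group of ring automorphisms\<close>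

lemma ring_aut_simps:
  "f \<in> carrier (ring_aut C A) \<longleftrightarrow> is_ring_hom C A A f \<and> is_iso C f"
  "f \<otimes>\<^bsub>ring_aut C A\<^esub> g = f \<cdot> g" "\<one>\<^bsub>ring_aut C A\<^esub> = Ident C R"
  by (simp_all add: ring_aut_def)

lemma ring_hom_comp:
  assumes f: "is_ring_hom C A A f" and g: "is_ring_hom C A A g"
  shows "is_ring_hom C A A (g \<cdot> f)"
proof -
  note [simp] = ring_homD(1-3)[OF f] ring_homD(1-3)[OF g]
  have "(g \<cdot> f) \<cdot> \<mu> = g \<cdot> \<mu> \<cdot> (f \<odot> f)" by (simp add: comp_assoc ring_homD(4)[OF f])
  also have "\<dots> = (g \<cdot> \<mu>) \<cdot> (f \<odot> f)" by (simp add: comp_assoc)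
  also have "\<dots> = \<mu> \<cdot> ((g \<odot> g) \<cdot> (f \<odot> f))" by (simp add: comp_assoc ring_homD(4)[OF g])
  also have "(g \<odot> g) \<cdot> (f \<odot> f) = (g \<cdot> f) \<odot> (g \<cdot> f)"
    by (rule TenA_Comp[symmetric, of _ R R _ R _ R R _ R]) auto
  finally show ?thesis
    by (simp add: is_ring_hom_def comp_assoc ring_homD(5)[OF f] ring_homD(5)[OF g])
qed

lemma ring_hom_inverse:
  assumes f: "is_ring_hom C A A f" and g: "g \<in> Hom C R R" "g \<cdot> f = Ident C R" "f \<cdot> g = Ident C R"
  shows "is_ring_hom C A A g"
proof -
  note [simp] = ring_homD(1-3)[OF f]
  have [simp]: "g \<in> Arr C" "Dom C g = R" "Cod C g = R" using g by auto
  have fg: "(f \<odot> f) \<cdot> (g \<odot> g) = Ident C (R \<boxtimes> R)"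
    using TenA_Comp[of g R R f R g R R f R] g(3) by simp
  have "g \<cdot> \<mu> = g \<cdot> (\<mu> \<cdot> ((f \<odot> f) \<cdot> (g \<odot> g)))" by (simp add: fg)
  also have "\<dots> = g \<cdot> ((f \<cdot> \<mu>) \<cdot> (g \<odot> g))" unfolding ring_homD(4)[OF f] by (simp add: comp_assoc)
  also have "\<dots> = \<mu> \<cdot> (g \<odot> g)" by (simp add: comp_assoc comp_reassoc[OF g(2)])
  finally have "g \<cdot> \<mu> = \<mu> \<cdot> (g \<odot> g)" .
  moreover have "g \<cdot> \<eta> = \<eta>"
    using comp_reassoc[OF g(2), of \<eta>] ring_homD(5)[OF f] by simp
  ultimately show ?thesis by (simp add: is_ring_hom_def)
qed

lemma ring_aut_group: "group (ring_aut C A)"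
proof (rule groupI)
  show "\<one>\<^bsub>ring_aut C A\<^esub> \<in> carrier (ring_aut C A)"
    using is_isoI[of "Ident C R" R R "Ident C R"] by (simp add: ring_aut_simps is_ring_hom_def)
next
  fix f g assume "f \<in> carrier (ring_aut C A)" "g \<in> carrier (ring_aut C A)"
  then have fg: "is_ring_hom C A A f" "is_iso C f" "is_ring_hom C A A g" "is_iso C g"
    by (auto simp: ring_aut_simps)
  note [simp] = ring_homD(1-3)[OF fg(1)] ring_homD(1-3)[OF fg(3)] inv_arr_simps(1-3)[OF fg(2)]
    inv_arr_simps(1-3)[OF fg(4)]
  have "is_iso C (f \<cdot> g)"
    by (rule is_isoI[of _ R R "inv_arr C g \<cdot> inv_arr C f"])
      (simp_all add: comp_assoc inv_arr_simps(4,5)[OF fg(2)] inv_arr_simps(4,5)[OF fg(4)]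
        comp_reassoc[OF inv_arr_simps(4)[OF fg(2)]] comp_reassoc[OF inv_arr_simps(5)[OF fg(4)]])
  then show "f \<otimes>\<^bsub>ring_aut C A\<^esub> g \<in> carrier (ring_aut C A)"
    using ring_hom_comp[OF fg(3,1)] by (simp add: ring_aut_simps)
next
  fix f g h
  assume "f \<in> carrier (ring_aut C A)" "g \<in> carrier (ring_aut C A)" "h \<in> carrier (ring_aut C A)"
  then show "f \<otimes>\<^bsub>ring_aut C A\<^esub> g \<otimes>\<^bsub>ring_aut C A\<^esub> h = f \<otimes>\<^bsub>ring_aut C A\<^esub> (g \<otimes>\<^bsub>ring_aut C A\<^esub> h)"
    unfolding ring_aut_simps(2) by (intro comp_assoc) (auto simp: ring_aut_simps(1) ring_homD(1-3))
next
  fix f assume "f \<in> carrier (ring_aut C A)"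
  then have f: "is_ring_hom C A A f" "is_iso C f" by (auto simp: ring_aut_simps)
  note [simp] = ring_homD(1-3)[OF f(1)] inv_arr_simps(1-3)[OF f(2)]
  have i: "inv_arr C f \<cdot> f = Ident C R" "f \<cdot> inv_arr C f = Ident C R"
    using inv_arr_simps(4,5)[OF f(2)] by auto
  show "\<one>\<^bsub>ring_aut C A\<^esub> \<otimes>\<^bsub>ring_aut C A\<^esub> f = f" by (simp add: ring_aut_simps)
  have "inv_arr C f \<in> carrier (ring_aut C A)"
    using ring_hom_inverse[OF f(1) _ i] is_isoI[of "inv_arr C f" R R f] i
    by (simp add: ring_aut_simps)
  then show "\<exists>g\<in>carrier (ring_aut C A). g \<otimes>\<^bsub>ring_aut C A\<^esub> f = \<one>\<^bsub>ring_aut C A\<^esub>"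
    using i by (auto simp: ring_aut_simps)
qed

end

section \<open>Decomposition of the free module on the object of a module into twists of that
  module\<close>

context separable_ring
begin

text \<open>The decomposition of \<open>A \<otimes> A\<close> tensored with \<open>y\<close>, the
  projections being rewritten as twisted actions of the free module on \<open>y\<close>.\<close>

lemma bisum_free:
  assumes hom: "\<And>\<gamma>. \<gamma> \<in> \<Gamma> \<Longrightarrow> is_ring_hom C A A \<gamma>"
    and B: "bisum \<Gamma> (\<lambda>_. R) (R \<boxtimes> R) (\<lambda>\<gamma>. \<mu> \<cdot> (\<gamma> \<triangleleft> R)) inc" and [simp]: "y \<in> Obj C"
  shows "bisum \<Gamma> (\<lambda>_. R \<boxtimes> y) (R \<boxtimes> (R \<boxtimes> y)) (\<lambda>\<gamma>. snd (tw \<gamma> (U \<star> y)))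
    (\<lambda>\<gamma>. Assoc C R R y \<cdot> (inc \<gamma> \<triangleleft> y))"
  unfolding bisum_def
proof (intro conjI ballI)
  show fin: "finite \<Gamma>" using B by (simp add: bisum_def)
  have h [simp]: "\<gamma> \<in> Arr C" "Dom C \<gamma> = R" "Cod C \<gamma> = R" if "\<gamma> \<in> \<Gamma>" for \<gamma>
    using ring_homD(1-3)[OF hom[OF that]] by auto
  have i [simp]: "inc \<gamma> \<in> Arr C" "Dom C (inc \<gamma>) = R" "Cod C (inc \<gamma>) = R \<boxtimes> R" if "\<gamma> \<in> \<Gamma>" for \<gamma>
    using B that by (auto simp: bisum_def)
  have tw: "snd (tw \<gamma> (U \<star> y)) = ((\<mu> \<cdot> (\<gamma> \<triangleleft> R)) \<triangleleft> y) \<cdot> AssocI R R y" if "\<gamma> \<in> \<Gamma>" for \<gamma>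
    using that by (simp add: tw_snd mten_snd comp_norm coherence_nat)
  show "snd (tw \<gamma> (U \<star> y)) \<in> Hom C (R \<boxtimes> (R \<boxtimes> y)) (R \<boxtimes> y)"
    "Assoc C R R y \<cdot> (inc \<gamma> \<triangleleft> y) \<in> Hom C (R \<boxtimes> y) (R \<boxtimes> (R \<boxtimes> y))" if "\<gamma> \<in> \<Gamma>" for \<gamma>
    using that by (simp_all add: tw)
  show "snd (tw \<gamma> (U \<star> y)) \<cdot> (Assoc C R R y \<cdot> (inc \<delta> \<triangleleft> y)) =
      (if \<gamma> = \<delta> then Ident C (R \<boxtimes> y) else ZeroArr C (R \<boxtimes> y) (R \<boxtimes> y))"
    if "\<gamma> \<in> \<Gamma>" "\<delta> \<in> \<Gamma>" for \<gamma> \<delta>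
  proof -
    have "snd (tw \<gamma> (U \<star> y)) \<cdot> (Assoc C R R y \<cdot> (inc \<delta> \<triangleleft> y)) = ((\<mu> \<cdot> (\<gamma> \<triangleleft> R)) \<cdot> inc \<delta>) \<triangleleft> y"
      using that by (simp add: tw comp_norm)
    also have "(\<mu> \<cdot> (\<gamma> \<triangleleft> R)) \<cdot> inc \<delta> = (if \<gamma> = \<delta> then Ident C R else ZeroArr C R R)"
      using B that unfolding bisum_def by blast
    finally show ?thesis by simp
  qed
  let ?G = "\<lambda>f. Assoc C R R y \<cdot> (f \<triangleleft> y) \<cdot> AssocI R R y" and ?x = "R \<boxtimes> (R \<boxtimes> y)"
  let ?f = "\<lambda>\<gamma>. inc \<gamma> \<cdot> (\<mu> \<cdot> (\<gamma> \<triangleleft> R))"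
  have "finprod (hom_group C ?x ?x) (\<lambda>\<gamma>. (Assoc C R R y \<cdot> (inc \<gamma> \<triangleleft> y)) \<cdot> snd (tw \<gamma> (U \<star> y))) \<Gamma> =
      finprod (hom_group C ?x ?x) (\<lambda>\<gamma>. ?G (?f \<gamma>)) \<Gamma>"
    by (rule finprod_hom_cong) (auto simp: tw comp_norm)
  also have "\<dots> = ?G (finprod (hom_group C (R \<boxtimes> R) (R \<boxtimes> R)) ?f \<Gamma>)"
    by (rule finprod_hom_additive[OF preadditive_category_axioms, of _ _ _ _ _ _ ?G, symmetric])
      (auto simp: fin rwhisker_Add[of _ _ "R \<boxtimes> R" "R \<boxtimes> R"] comp_Add Add_comp)
  also have "finprod (hom_group C (R \<boxtimes> R) (R \<boxtimes> R)) ?f \<Gamma> = Ident C (R \<boxtimes> R)"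
    using B by (simp add: bisum_def)
  finally show "finprod (hom_group C ?x ?x) (\<lambda>\<gamma>. (Assoc C R R y \<cdot> (inc \<gamma> \<triangleleft> y)) \<cdot> snd (tw \<gamma> (U \<star> y))) \<Gamma>
      = Ident C ?x" by simp
qed auto

text \<open>\<open>z\<close> is a retract of the free module on \<open>fst z\<close> by maps that
  stay linear after every twist. Sandwiching the inclusions for the free module between these maps
  transports the decomposition.\<close>

lemma bisum_module:
  assumes hom: "\<And>\<gamma>. \<gamma> \<in> \<Gamma> \<Longrightarrow> is_ring_hom C A A \<gamma>"
    and B: "bisum \<Gamma> (\<lambda>_. R) (R \<boxtimes> R) (\<lambda>\<gamma>. \<mu> \<cdot> (\<gamma> \<triangleleft> R)) inc" and [simp]: "modl z"
  obtains inc' where "bisum \<Gamma> (\<lambda>_. fst z) (R \<boxtimes> fst z) (\<lambda>\<gamma>. snd (tw \<gamma> z)) inc'"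
proof
  let ?x = "fst z" and ?v = "U \<star> fst z"
  define j where "j = (\<lambda>\<gamma>. Assoc C R R ?x \<cdot> (inc \<gamma> \<triangleleft> ?x))"
  have F: "bisum \<Gamma> (\<lambda>_. R \<boxtimes> ?x) (R \<boxtimes> (R \<boxtimes> ?x)) (\<lambda>\<gamma>. snd (tw \<gamma> ?v)) j"
    unfolding j_def by (rule bisum_free[OF hom B]) auto
  have fin: "finite \<Gamma>" using B by (simp add: bisum_def)
  have m [simp]: "modl (tw \<gamma> z)" "modl (tw \<gamma> ?v)" if "\<gamma> \<in> \<Gamma>" for \<gamma> using hom that by auto
  have j [simp]: "j \<gamma> \<in> Arr C" "Dom C (j \<gamma>) = R \<boxtimes> ?x" "Cod C (j \<gamma>) = R \<boxtimes> (R \<boxtimes> ?x)" if "\<gamma> \<in> \<Gamma>" for \<gamma>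
    using F that by (auto simp: bisum_def)
  have n1: "snd (tw \<gamma> z) \<cdot> (R \<triangleright> snd z) = snd z \<cdot> snd (tw \<gamma> ?v)" if "\<gamma> \<in> \<Gamma>" for \<gamma>
    using linD(6)[OF tw_lin[OF hom[OF that] act_lin[of z]]] by simp
  have n2: "snd (tw \<gamma> ?v) \<cdot> (R \<triangleright> sg z) = sg z \<cdot> snd (tw \<gamma> z)" if "\<gamma> \<in> \<Gamma>" for \<gamma>
    using linD(6)[OF tw_lin[OF hom[OF that] sg_lin[of z]]] by simp
  let ?k = "\<lambda>\<gamma>. (R \<triangleright> snd z) \<cdot> j \<gamma> \<cdot> sg z"
  show "bisum \<Gamma> (\<lambda>_. ?x) (R \<boxtimes> ?x) (\<lambda>\<gamma>. snd (tw \<gamma> z)) ?k"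
    unfolding bisum_def
  proof (intro conjI ballI)
    show "snd (tw \<gamma> z) \<cdot> ?k \<delta> = (if \<gamma> = \<delta> then Ident C ?x else ZeroArr C ?x ?x)"
      if "\<gamma> \<in> \<Gamma>" "\<delta> \<in> \<Gamma>" for \<gamma> \<delta>
    proof -
      have "snd (tw \<gamma> z) \<cdot> ?k \<delta> = (snd (tw \<gamma> z) \<cdot> (R \<triangleright> snd z)) \<cdot> j \<delta> \<cdot> sg z"
        using that by (simp add: comp_assoc)
      also have "\<dots> = snd z \<cdot> (snd (tw \<gamma> ?v) \<cdot> j \<delta>) \<cdot> sg z"
        unfolding n1[OF that(1)] using that by (simp add: comp_assoc)
      also have "snd (tw \<gamma> ?v) \<cdot> j \<delta> =
          (if \<gamma> = \<delta> then Ident C (R \<boxtimes> ?x) else ZeroArr C (R \<boxtimes> ?x) (R \<boxtimes> ?x))"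
        using F that unfolding bisum_def by blast
      finally show ?thesis by (simp add: act_sg)
    qed
    let ?H = "\<lambda>x y. hom_group C x y" and ?y = "R \<boxtimes> (R \<boxtimes> ?x)"
    let ?f = "\<lambda>\<gamma>. j \<gamma> \<cdot> snd (tw \<gamma> ?v)"
    have "finprod (?H (R \<boxtimes> ?x) (R \<boxtimes> ?x)) (\<lambda>\<gamma>. ?k \<gamma> \<cdot> snd (tw \<gamma> z)) \<Gamma> =
        finprod (?H (R \<boxtimes> ?x) (R \<boxtimes> ?x)) (\<lambda>\<gamma>. (R \<triangleright> snd z) \<cdot> ?f \<gamma> \<cdot> (R \<triangleright> sg z)) \<Gamma>"
      by (rule finprod_hom_cong) (auto simp: comp_assoc n2)
    also have "\<dots> = (R \<triangleright> snd z) \<cdot> finprod (?H ?y ?y) ?f \<Gamma> \<cdot> (R \<triangleright> sg z)"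
      by (rule finprod_hom_additive[OF preadditive_category_axioms,
            of _ _ _ _ _ _ "\<lambda>h. (R \<triangleright> snd z) \<cdot> h \<cdot> (R \<triangleright> sg z)", symmetric])
        (auto simp: fin comp_Add Add_comp)
    also have "finprod (?H ?y ?y) ?f \<Gamma> = Ident C ?y" using F by (simp add: bisum_def)
    also have "(R \<triangleright> snd z) \<cdot> Ident C ?y \<cdot> (R \<triangleright> sg z) = Ident C (R \<boxtimes> ?x)"
      using whisker_inverse(1)[OF act_sg[of z], of R] by simp
    finally show "finprod (?H (R \<boxtimes> ?x) (R \<boxtimes> ?x)) (\<lambda>\<gamma>. ?k \<gamma> \<cdot> snd (tw \<gamma> z)) \<Gamma> = Ident C (R \<boxtimes> ?x)" .
  qed (use fin in auto)
qed

end

text \<open>The Galois isomorphism has \<open>\<gamma>\<close> on the second factor, while free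
  modules carry their action on the first. Precomposing with the braiding moves
  \<open>\<gamma>\<close> over, and commutativity of the ring absorbs the braiding.\<close>

lemma (in tt_ring) quasi_Galois_bisum:
  assumes "quasi_Galois C A \<Gamma>"
  obtains inc where "bisum \<Gamma> (\<lambda>_. R) (R \<boxtimes> R) (\<lambda>\<gamma>. \<mu> \<cdot> (\<gamma> \<triangleleft> R)) inc"
proof -
  from assms obtain P pr lam where P: "is_product C \<Gamma> (\<lambda>_. R) P pr" and fin: "finite \<Gamma>"
    and sub: "subgroup \<Gamma> (ring_aut C A)"
    and lam: "lam \<in> Hom C (R \<boxtimes> R) P" "is_iso C lam" "\<And>\<gamma>. \<gamma> \<in> \<Gamma> \<Longrightarrow> pr \<gamma> \<cdot> lam = \<mu> \<cdot> (R \<triangleright> \<gamma>)"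
    unfolding quasi_Galois_def by blast
  have hom: "is_ring_hom C A A \<gamma>" if "\<gamma> \<in> \<Gamma>" for \<gamma>
    using subgroup.subset[OF sub] that ring_aut_simps(1) by auto
  have h [simp]: "\<gamma> \<in> Arr C" "Dom C \<gamma> = R" "Cod C \<gamma> = R" if "\<gamma> \<in> \<Gamma>" for \<gamma>
    using ring_homD(1-3)[OF hom[OF that]] by auto
  obtain j where j: "bisum \<Gamma> (\<lambda>_. R) P pr j"
    using product_bisum[OF P fin] by auto
  let ?l = "lam \<cdot> Braid C R R" and ?k = "Braid C R R \<cdot> inv_arr C lam"
  have [simp]: "lam \<in> Arr C" "Dom C lam = R \<boxtimes> R" "Cod C lam = P" "P \<in> Obj C" using lam(1) by auto
  note i = inv_arr_simps[OF lam(2)]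
  note [simp] = i(1-3)
  have jp [simp]: "pr \<gamma> \<in> Arr C" "Dom C (pr \<gamma>) = P" "Cod C (pr \<gamma>) = R"
    "j \<gamma> \<in> Arr C" "Dom C (j \<gamma>) = R" "Cod C (j \<gamma>) = P" if "\<gamma> \<in> \<Gamma>" for \<gamma>
    using j that by (auto simp: bisum_def)
  have kl: "?k \<cdot> ?l = Ident C (R \<boxtimes> R)" and lk: "?l \<cdot> ?k = Ident C P"
    by (simp_all add: comp_assoc comp_reassoc[OF i(4)] i(5))
  have pl: "pr \<gamma> \<cdot> ?l = \<mu> \<cdot> (\<gamma> \<triangleleft> R)" if g: "\<gamma> \<in> \<Gamma>" for \<gamma>
  proof -
    have "pr \<gamma> \<cdot> ?l = \<mu> \<cdot> ((R \<triangleright> \<gamma>) \<cdot> Braid C R R)"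
      using comp_reassoc[OF lam(3)[OF g], of "Braid C R R"] g by (simp add: comp_assoc)
    also have "(R \<triangleright> \<gamma>) \<cdot> Braid C R R = Braid C R R \<cdot> (\<gamma> \<triangleleft> R)"
      using g by (simp add: Braid_nat1)
    also have "\<mu> \<cdot> \<dots> = \<mu> \<cdot> (\<gamma> \<triangleleft> R)"
      using comp_reassoc[OF ring_laws(3), of "\<gamma> \<triangleleft> R"] g by simp
    finally show ?thesis .
  qed
  have "bisum \<Gamma> (\<lambda>_. R) (R \<boxtimes> R) (\<lambda>\<gamma>. \<mu> \<cdot> (\<gamma> \<triangleleft> R)) (\<lambda>\<gamma>. ?k \<cdot> j \<gamma>)"
    unfolding bisum_def
  proof (intro conjI ballI)
    show "(\<mu> \<cdot> (\<gamma> \<triangleleft> R)) \<cdot> (?k \<cdot> j \<delta>) = (if \<gamma> = \<delta> then Ident C R else ZeroArr C R R)"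
      if g: "\<gamma> \<in> \<Gamma>" "\<delta> \<in> \<Gamma>" for \<gamma> \<delta>
    proof -
      have "(\<mu> \<cdot> (\<gamma> \<triangleleft> R)) \<cdot> (?k \<cdot> j \<delta>) = pr \<gamma> \<cdot> ((?l \<cdot> ?k) \<cdot> j \<delta>)"
        unfolding pl[OF g(1), symmetric] using g by (simp add: comp_assoc)
      also have "\<dots> = pr \<gamma> \<cdot> j \<delta>" unfolding lk using g by simp
      also have "\<dots> = (if \<gamma> = \<delta> then Ident C R else ZeroArr C R R)"
        using j g unfolding bisum_def by blast
      finally show ?thesis .
    qed
    let ?x = "R \<boxtimes> R" and ?f = "\<lambda>\<gamma>. j \<gamma> \<cdot> pr \<gamma>"
    have "finprod (hom_group C ?x ?x) (\<lambda>\<gamma>. (?k \<cdot> j \<gamma>) \<cdot> (\<mu> \<cdot> (\<gamma> \<triangleleft> R))) \<Gamma> =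
        finprod (hom_group C ?x ?x) (\<lambda>\<gamma>. ?k \<cdot> ?f \<gamma> \<cdot> ?l) \<Gamma>"
      by (rule finprod_hom_cong) (auto simp: comp_assoc simp flip: pl)
    also have "\<dots> = ?k \<cdot> finprod (hom_group C P P) ?f \<Gamma> \<cdot> ?l"
      by (rule finprod_hom_additive[OF preadditive_category_axioms, of _ _ _ _ _ _ "\<lambda>h. ?k \<cdot> h \<cdot> ?l",
            symmetric]) (auto simp: fin comp_Add Add_comp)
    also have "finprod (hom_group C P P) ?f \<Gamma> = Ident C P" using j by (simp add: bisum_def)
    also have "?k \<cdot> Ident C P \<cdot> ?l = ?k \<cdot> ?l" by simp
    finally show "finprod (hom_group C ?x ?x) (\<lambda>\<gamma>. (?k \<cdot> j \<gamma>) \<cdot> (\<mu> \<cdot> (\<gamma> \<triangleleft> R))) \<Gamma> = Ident C ?x"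
      unfolding kl .
  qed (use fin in auto)
  then show ?thesis by (rule that)
qed

locale galois_ring = separable_ring C A \<sigma>
  for C :: "('o, 'm, 'z) tt_scheme" (structure) and A :: "('o, 'm) ring_obj" and \<sigma> :: 'm +
  fixes \<Gamma> :: "'m set" and inc :: "'m \<Rightarrow> 'm"
  assumes subgroup: "subgroup \<Gamma> (ring_aut C A)"
    and decomposition: "bisum \<Gamma> (\<lambda>_. R) (R \<boxtimes> R) (\<lambda>\<gamma>. \<mu> \<cdot> (\<gamma> \<triangleleft> R)) inc"
begin

lemma finite_group: "finite \<Gamma>"
  using decomposition by (simp add: bisum_def)

lemma group_hom: "\<gamma> \<in> \<Gamma> \<Longrightarrow> is_ring_hom C A A \<gamma>" and group_iso: "\<gamma> \<in> \<Gamma> \<Longrightarrow> is_iso C \<gamma>"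
  using subgroup.subset[OF subgroup] ring_aut_simps(1) by auto

lemma group_one: "Ident C R \<in> \<Gamma>"
  using subgroup.one_closed[OF subgroup] by (simp add: ring_aut_simps)

lemma group_comp: "\<lbrakk>\<gamma> \<in> \<Gamma>; \<delta> \<in> \<Gamma>\<rbrakk> \<Longrightarrow> \<gamma> \<cdot> \<delta> \<in> \<Gamma>"
  using subgroup.m_closed[OF subgroup] by (simp add: ring_aut_simps)

lemma group_inverse:
  assumes "\<gamma> \<in> \<Gamma>"
  obtains \<delta> where "\<delta> \<in> \<Gamma>" "\<gamma> \<cdot> \<delta> = Ident C R" "\<delta> \<cdot> \<gamma> = Ident C R"
proof
  have c: "\<gamma> \<in> carrier (ring_aut C A)" using subgroup.subset[OF subgroup] assms by blast
  show "inv\<^bsub>ring_aut C A\<^esub> \<gamma> \<in> \<Gamma>" by (rule subgroup.m_inv_closed[OF subgroup assms])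
  show "\<gamma> \<cdot> inv\<^bsub>ring_aut C A\<^esub> \<gamma> = Ident C R" "inv\<^bsub>ring_aut C A\<^esub> \<gamma> \<cdot> \<gamma> = Ident C R"
    using group.r_inv[OF ring_aut_group c] group.l_inv[OF ring_aut_group c]
    by (simp_all add: ring_aut_simps)
qed

text \<open>The projection \<open>a \<otimes> n \<mapsto> \<gamma>(a) n\<close> is linear onto
  \<open>tw \<gamma> z\<close>, and so are the inclusions out of the twists; hence the decomposition
  of the underlying object is one of modules.\<close>

lemma M_bisum:
  assumes z: "modl z"
  obtains I where "preadditive_category.bisum M \<Gamma> (\<lambda>\<gamma>. tw \<gamma> z) (U \<star> fst z)
    (\<lambda>\<gamma>. (U \<star> fst z, snd (tw \<gamma> z), tw \<gamma> z)) I"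
proof -
  let ?x = "fst z" and ?v = "U \<star> fst z"
  obtain j where B: "bisum \<Gamma> (\<lambda>_. ?x) (R \<boxtimes> ?x) (\<lambda>\<gamma>. snd (tw \<gamma> z)) j"
    using bisum_module[OF group_hom decomposition z] by blast
  have j: "lin (tw \<gamma> z) (j \<gamma>) ?v" if "\<gamma> \<in> \<Gamma>" for \<gamma>
    by (rule inclusion_lin[OF z group_hom B that])
  have p: "lin ?v (snd (tw \<gamma> z)) (tw \<gamma> z)" if "\<gamma> \<in> \<Gamma>" for \<gamma>
    using act_lin[OF tw_module[OF group_hom[OF that] z]] by simp
  let ?I = "\<lambda>\<gamma>. (tw \<gamma> z, j \<gamma>, ?v)" and ?P = "\<lambda>\<gamma>. (?v, snd (tw \<gamma> z), tw \<gamma> z)"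
  let ?f = "\<lambda>\<gamma>. Comp M (?I \<gamma>) (?P \<gamma>)"
  have v: "modl ?v" using z by simp
  have f: "?f \<gamma> \<in> Hom M ?v ?v" if "\<gamma> \<in> \<Gamma>" for \<gamma>
    using lin_comp[OF p j] that by simp
  let ?s = "finprod (hom_group M ?v ?v) ?f \<Gamma>"
  \<comment> \<open>The sum is computed on underlying arrows, which determine an endomorphism of
    \<open>?v\<close>.\<close>
  have "und ?s = finprod (hom_group C (fst ?v) (fst ?v)) (\<lambda>\<gamma>. und (?f \<gamma>)) \<Gamma>"
  proof (rule preadditive_category.finprod_hom_additive[OF M_preadditive preadditive_category_axioms,
        of _ _ _ _ _ _ und])
    show "?v \<in> Obj M" "?v \<in> Obj M" "fst ?v \<in> Obj C" "fst ?v \<in> Obj C" using v z by auto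
    show "?f \<gamma> \<in> Hom M ?v ?v" if "\<gamma> \<in> \<Gamma>" for \<gamma> by (rule f[OF that])
    show "finite \<Gamma>" by (rule finite_group)
    show "und g \<in> Hom C (fst ?v) (fst ?v)" if "g \<in> Hom M ?v ?v" for g
      using that
    proof (rule M_HomE)
      fix h assume "g = (?v, h, ?v)" "lin ?v h ?v"
      then show ?thesis using linD(3-5)[of ?v h ?v] by simp
    qed
    show "und (Add M g h) = Add C (und g) (und h)" if "g \<in> Hom M ?v ?v" "h \<in> Hom M ?v ?v" for g h
      using that by (elim M_HomE) simp
  qed simp
  also have "\<dots> = Ident C (fst ?v)" using B by (simp add: bisum_def)
  finally have s: "und ?s = Ident C (fst ?v)" .
  have "?s \<in> Hom M ?v ?v"
    by (rule preadditive_category.finprod_hom_closed[OF M_preadditive]) (use v f in auto)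
  then have "?s = Ident M ?v" using s by (elim M_HomE) simp
  then have "preadditive_category.bisum M \<Gamma> (\<lambda>\<gamma>. tw \<gamma> z) ?v ?P ?I"
    unfolding preadditive_category.bisum_def[OF M_preadditive]
  proof (intro conjI ballI)
    fix \<gamma> \<delta> assume g: "\<gamma> \<in> \<Gamma>" "\<delta> \<in> \<Gamma>"
    have "snd (tw \<gamma> z) \<cdot> j \<delta> = (if \<gamma> = \<delta> then Ident C ?x else ZeroArr C ?x ?x)"
      using B g unfolding bisum_def by blast
    then show "Comp M (?P \<gamma>) (?I \<delta>) =
        (if \<gamma> = \<delta> then Ident M (tw \<gamma> z) else ZeroArr M (tw \<delta> z) (tw \<gamma> z))"
      by simp
  qed (use z finite_group j p group_hom in auto)
  then show ?thesis by (rule that)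
qed

text \<open>The descent criterion on which the rest turns: whether all twists of \<open>z\<close>
  lie in \<open>J\<close> is decided by the underlying object of \<open>z\<close>.\<close>

lemma free_mem_iff:
  assumes J: "thick M J" and z: "modl z"
  shows "U \<star> fst z \<in> J \<longleftrightarrow> (\<forall>\<gamma>\<in>\<Gamma>. tw \<gamma> z \<in> J)"
proof -
  obtain I where I: "preadditive_category.bisum M \<Gamma> (\<lambda>\<gamma>. tw \<gamma> z) (U \<star> fst z)
    (\<lambda>\<gamma>. (U \<star> fst z, snd (tw \<gamma> z), tw \<gamma> z)) I"
    using M_bisum[OF z] by blast
  show ?thesis
    using thick_setting.bisum_member[OF M_thick_setting J I]
      thick_setting.bisum_closed[OF M_thick_setting J I] by blast
qed

end

section \<open>Prime ideals\<close>

context separable_ring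
begin

lemma prime_M_iff: "Q \<in> primes M \<longleftrightarrow> thick_ideal M Q \<and> Q \<noteq> {z. modl z} \<and>
    (\<forall>x y. modl x \<longrightarrow> modl y \<longrightarrow> mt x y \<in> Q \<longrightarrow> x \<in> Q \<or> y \<in> Q)"
  unfolding primes_def M_simps by blast

lemma prime_MD:
  assumes "Q \<in> primes M"
  shows "thick_ideal M Q" "thick M Q" "Q \<noteq> {z. modl z}"
    "\<lbrakk>modl x; modl y; mt x y \<in> Q\<rbrakk> \<Longrightarrow> x \<in> Q \<or> y \<in> Q" "z \<in> Q \<Longrightarrow> modl z"
    "\<lbrakk>z \<in> Q; y' \<in> Obj C\<rbrakk> \<Longrightarrow> z \<star> y' \<in> Q"
proof -
  show J: "thick_ideal M Q" "Q \<noteq> {z. modl z}" using assms by (auto simp: prime_M_iff)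
  then show T: "thick M Q" by (simp add: thick_ideal_def)
  show "\<lbrakk>modl x; modl y; mt x y \<in> Q\<rbrakk> \<Longrightarrow> x \<in> Q \<or> y \<in> Q" using assms unfolding prime_M_iff by blast
  show "z \<in> Q \<Longrightarrow> modl z" by (rule M_thickD[OF T])
  show "\<lbrakk>z \<in> Q; y' \<in> Obj C\<rbrakk> \<Longrightarrow> z \<star> y' \<in> Q" using J unfolding ideal_iff by blast
qed

text \<open>An ideal containing \<open>U\<close> contains all free modules, hence their retracts,
  hence every module.\<close>

lemma U_notin_prime:
  assumes Q: "Q \<in> primes M"
  shows "U \<notin> Q"
proof
  assume U: "U \<in> Q"
  have "z \<in> Q" if z: "modl z" for z
  proof -
    have "U \<star> fst z \<in> Q" using prime_MD(6)[OF Q U] z by simp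
    then show ?thesis by (rule M_retract[OF prime_MD(2)[OF Q] sg_lin[OF z] act_lin[OF z] act_sg[OF z]])
  qed
  then show False using prime_MD(3,5)[OF Q] by blast
qed

text \<open>The map induced on spectra by extension of scalars to \<open>A\<close>.\<close>

definition phi :: "('o, 'm) modl set \<Rightarrow> 'o set" where
  "phi Q = {y \<in> Obj C. U \<star> y \<in> Q}"

lemma free_tensor:
  assumes [simp]: "x \<in> Obj C" "y \<in> Obj C"
  shows "miso (mt (U \<star> x) (U \<star> y)) (U \<star> (x \<boxtimes> y))"
proof -
  have "miso (U \<star> x \<star> y) (U \<star> (x \<boxtimes> y))"
    using misoI[OF mten_Assoc_lin[of U x y], of "AssocI R x y"] by simp
  then show ?thesis using miso_trans[OF mt_free[of "U \<star> x" y]] by simp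
qed

lemma free_retract:
  assumes J: "thick M J" and sr: "s \<in> Hom C y x" "r \<in> Hom C x y" "r \<cdot> s = Ident C y"
    and x: "U \<star> x \<in> J"
  shows "U \<star> y \<in> J"
proof -
  have [simp]: "s \<in> Arr C" "r \<in> Arr C" "Dom C s = y" "Cod C s = x" "Dom C r = x" "Cod C r = y"
    using sr by auto
  have "lin (U \<star> y) (fst U \<triangleright> s) (U \<star> x)" "lin (U \<star> x) (fst U \<triangleright> r) (U \<star> y)"
    by (rule mten_lin_right; simp)+
  then show ?thesis
    by (rule M_retract[OF J _ _ _ x]) (use whisker_inverse(1)[OF sr(3)] in simp)
qed

text \<open>Extension of scalars preserves zero objects, retracts and exact triangles;
  \<open>TenSusp_lin\<close> makes the connecting arrow a module map.\<close>

lemma thick_phi: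
  assumes J: "thick M J"
  shows "thick C (phi J)"
proof (rule thickI)
  show "phi J \<subseteq> Obj C" by (auto simp: phi_def)
next
  fix z assume z: "is_zero_obj C z"
  then have [simp]: "z \<in> Obj C" by (simp add: zero_obj_iff)
  have "U \<star> z \<in> J" by (rule M_thickD(2)[OF J]) (use zero_tensor[of R z] z in auto)
  then show "z \<in> phi J" by (simp add: phi_def)
next
  fix x y r s assume "x \<in> phi J" and sr: "s \<in> Hom C y x" "r \<in> Hom C x y" "r \<cdot> s = Ident C y"
  then have "U \<star> y \<in> J" using free_retract[OF J sr] by (simp add: phi_def)
  then show "y \<in> phi J" using sr by (auto simp: phi_def)
next
  fix x y z f g h assume T: "is_exact_triangle C x y z f g h"
  note ob [simp] = triangleD[OF exact_triangleD[OF T]]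
  have mem: "w \<in> phi J \<longleftrightarrow> U \<star> w \<in> J" if "w \<in> Obj C" for w
    using that by (simp add: phi_def)
  have l: "lin (U \<star> x) (R \<triangleright> f) (U \<star> y)" "lin (U \<star> y) (R \<triangleright> g) (U \<star> z)"
    using mten_lin_right[of U f] mten_lin_right[of U g] by auto
  have "lin (U \<star> z) (TenSusp C R x \<cdot> (R \<triangleright> h)) (mod_susp C A (U \<star> x))"
    using lin_comp[OF mten_lin_right[of U h] TenSusp_lin[of U x]] by simp
  then have "(U \<star> x \<in> J \<and> U \<star> y \<in> J \<longrightarrow> U \<star> z \<in> J) \<and> (U \<star> y \<in> J \<and> U \<star> z \<in> J \<longrightarrow> U \<star> x \<in> J) \<and>
      (U \<star> x \<in> J \<and> U \<star> z \<in> J \<longrightarrow> U \<star> y \<in> J)"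
    by (rule M_triangleD[OF J l]) (use ten_triangle[OF _ T, of R] in simp)
  then show "(x \<in> phi J \<and> y \<in> phi J \<longrightarrow> z \<in> phi J) \<and> (y \<in> phi J \<and> z \<in> phi J \<longrightarrow> x \<in> phi J) \<and>
      (x \<in> phi J \<and> z \<in> phi J \<longrightarrow> y \<in> phi J)"
    unfolding mem[OF ob(1)] mem[OF ob(2)] mem[OF ob(3)] .
qed

lemma thick_ideal_phi:
  assumes J: "thick_ideal M J"
  shows "thick_ideal C (phi J)"
proof -
  have T: "thick M J" using J by (simp add: thick_ideal_def)
  have "x \<boxtimes> y \<in> phi J" if x: "x \<in> Obj C" and y: "y \<in> phi J" for x y
  proof -
    have [simp]: "x \<in> Obj C" "y \<in> Obj C" and yJ: "U \<star> y \<in> J" using x y by (auto simp: phi_def)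
    have "mt (U \<star> x) (U \<star> y) \<in> J" by (rule ideal_mt(1)[OF J yJ]) simp
    then show ?thesis using M_iso[OF T free_tensor[of x y]] by (simp add: phi_def)
  qed
  then show ?thesis using thick_phi[OF T] by (auto simp: thick_ideal_def)
qed

text \<open>If the free module on \<open>R\<close> were in \<open>Q\<close>, so would be its retract
  \<open>U\<close>. Primality is pulled back along \<open>free_tensor\<close>.\<close>

lemma phi_supp:
  assumes Q: "Q \<in> primes M"
  shows "phi Q \<in> supp C R"
proof -
  note T = prime_MD(2)[OF Q]
  have R: "R \<notin> phi Q"
  proof
    assume "R \<in> phi Q"
    then have "U \<star> fst U \<in> Q" by (simp add: phi_def)
    then have "U \<in> Q"
      by (rule M_retract[OF T sg_lin[OF module_U] act_lin[OF module_U] act_sg[OF module_U]])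
    then show False using U_notin_prime[OF Q] by simp
  qed
  moreover have "x \<in> phi Q \<or> y \<in> phi Q" if x: "x \<in> Obj C" "y \<in> Obj C" and xy: "x \<boxtimes> y \<in> phi Q" for x y
  proof -
    have "mt (U \<star> x) (U \<star> y) \<in> Q"
      using M_iso[OF T miso_sym[OF free_tensor[OF x]]] xy by (simp add: phi_def)
    then show ?thesis using prime_MD(4)[OF Q] x by (auto simp: phi_def)
  qed
  ultimately show ?thesis
    using thick_ideal_phi[OF prime_MD(1)[OF Q]] ring_simps(1) unfolding supp_def primes_def by blast
qed

lemma thick_idealD:
  assumes "thick_ideal C P"
  shows "thick C P" "\<lbrakk>x \<in> Obj C; y \<in> P\<rbrakk> \<Longrightarrow> x \<boxtimes> y \<in> P" "y \<in> P \<Longrightarrow> y \<in> Obj C"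
  using assms unfolding thick_ideal_def thick_def triangulated_subcat_def by blast+

lemma thick_ideal_right:
  assumes P: "thick_ideal C P" and "x \<in> P" "y \<in> Obj C"
  shows "x \<boxtimes> y \<in> P"
proof (rule iso_closed[OF thick_idealD(1)[OF P]])
  have x: "x \<in> Obj C" using thick_idealD[OF P] assms by blast
  show "y \<boxtimes> x \<in> P" using thick_idealD[OF P] assms by blast
  show "is_iso C (Braid C y x)" "Braid C y x \<in> Hom C (y \<boxtimes> x) (x \<boxtimes> y)"
    using is_isoI[of "Braid C y x" "y \<boxtimes> x" "x \<boxtimes> y" "Braid C x y"] x assms by auto
qed

lemma preimage_ideal:
  assumes P: "thick_ideal C P"
  shows "thick_ideal M {z. modl z \<and> fst z \<in> P}"
  unfolding ideal_iff
proof (intro conjI ballI)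
  note T = thick_idealD(1)[OF P]
  show "thick M {z. modl z \<and> fst z \<in> P}"
  proof (rule M_thickI)
    fix z assume "modl z" "is_zero_obj C (fst z)"
    then show "z \<in> {z. modl z \<and> fst z \<in> P}"
      using T unfolding thick_def triangulated_subcat_def by blast
  next
    fix x y r s assume "x \<in> {z. modl z \<and> fst z \<in> P}" "lin y s x" "lin x r y" "r \<cdot> s = Ident C (fst y)"
    then show "y \<in> {z. modl z \<and> fst z \<in> P}"
      using retract_closed[OF T, of s "fst y" "fst x" r] linD[of y s x] linD[of x r y] by simp
  next
    fix x y z f g h assume "lin x f y" "lin y g z" "lin z h (mod_susp C A x)"
      "is_exact_triangle C (fst x) (fst y) (fst z) f g h"
    moreover from this have "modl x" "modl y" "modl z" by (auto dest: linD)
    ultimately show "(x \<in> {z. modl z \<and> fst z \<in> P} \<and> y \<in> {z. modl z \<and> fst z \<in> P} \<longrightarrow>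
        z \<in> {z. modl z \<and> fst z \<in> P}) \<and>
      (y \<in> {z. modl z \<and> fst z \<in> P} \<and> z \<in> {z. modl z \<and> fst z \<in> P} \<longrightarrow>
        x \<in> {z. modl z \<and> fst z \<in> P}) \<and>
      (x \<in> {z. modl z \<and> fst z \<in> P} \<and> z \<in> {z. modl z \<and> fst z \<in> P} \<longrightarrow>
        y \<in> {z. modl z \<and> fst z \<in> P})"
      using T unfolding thick_def triangulated_subcat_def by blast
  qed simp
qed (use thick_ideal_right[OF P] in auto)

text \<open>Each closure condition has at most two membership premises, and two members of the union
  lie in a common ideal of the chain.\<close>

lemma thick_ideal_chain_Union:
  assumes ch: "subset.chain \<A> \<C>" and ne: "\<C> \<noteq> {}" and id: "\<And>J. J \<in> \<C> \<Longrightarrow> thick_ideal M J"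
  shows "thick_ideal M (\<Union>\<C>)"
  unfolding ideal_iff
proof (intro conjI ballI)
  obtain J0 where J0: "J0 \<in> \<C>" using ne by blast
  have T: "thick M J" if "J \<in> \<C>" for J using id[OF that] by (simp add: thick_ideal_def)
  have two: "\<exists>J\<in>\<C>. x \<in> J \<and> y \<in> J" if "x \<in> \<Union>\<C>" "y \<in> \<Union>\<C>" for x y
  proof -
    from that obtain J J' where J: "J \<in> \<C>" "x \<in> J" "J' \<in> \<C>" "y \<in> J'" by blast
    then have "J \<subseteq> J' \<or> J' \<subseteq> J" using ch by (auto simp: subset_chain_def)
    then show ?thesis using J by blast
  qed
  show "thick M (\<Union>\<C>)"
  proof (rule M_thickI)
    show "modl z" if "z \<in> \<Union>\<C>" for z using that M_thickD(1)[OF T] by blast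
    show "z \<in> \<Union>\<C>" if "modl z" "is_zero_obj C (fst z)" for z
      using M_thickD(2)[OF T[OF J0] that] J0 by blast
    show "y \<in> \<Union>\<C>" if "x \<in> \<Union>\<C>" "lin y s x" "lin x r y" "r \<cdot> s = Ident C (fst y)" for x y r s
      using that M_retract[OF T that(2-4)] by blast
    show "(x \<in> \<Union>\<C> \<and> y \<in> \<Union>\<C> \<longrightarrow> z \<in> \<Union>\<C>) \<and> (y \<in> \<Union>\<C> \<and> z \<in> \<Union>\<C> \<longrightarrow> x \<in> \<Union>\<C>) \<and>
        (x \<in> \<Union>\<C> \<and> z \<in> \<Union>\<C> \<longrightarrow> y \<in> \<Union>\<C>)"
      if tri: "lin x f y" "lin y g z" "lin z h (mod_susp C A x)"
        "is_exact_triangle C (fst x) (fst y) (fst z) f g h" for x y z f g h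
    proof -
      note D = M_triangleD[OF T tri]
      show ?thesis
        using two[of x y] two[of y z] two[of x z] D by blast
    qed
  qed
  show "z \<star> y \<in> \<Union>\<C>" if "z \<in> \<Union>\<C>" "y \<in> Obj C" for z y
    using that id unfolding ideal_iff by blast
qed

text \<open>A prime over \<open>P\<close> is found as an ideal that contains all modules underlying in \<open>P\<close> and is maximal among
  those avoiding the free modules on objects outside \<open>P\<close>.\<close>

lemma phi_surj:
  assumes P: "P \<in> supp C R"
  obtains Q where "Q \<in> primes M" "phi Q = P"
proof -
  have PI: "thick_ideal C P" and RP: "R \<notin> P"
    and pr: "\<And>x y. \<lbrakk>x \<in> Obj C; y \<in> Obj C; x \<boxtimes> y \<in> P\<rbrakk> \<Longrightarrow> x \<in> P \<or> y \<in> P"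
    using P unfolding supp_def primes_def by blast+
  define J0 where "J0 = {z. modl z \<and> fst z \<in> P}"
  define Z where "Z = {J. thick_ideal M J \<and> J0 \<subseteq> J \<and> (\<forall>y\<in>Obj C. U \<star> y \<in> J \<longrightarrow> y \<in> P)}"
  \<comment> \<open>If \<open>A \<otimes> y\<close> lies in the prime \<open>P\<close>, then so does
    \<open>y\<close>, because \<open>A\<close> does not.\<close>
  have "J0 \<in> Z"
    using preimage_ideal[OF PI] pr[of R] RP by (auto simp: Z_def J0_def)
  have "\<exists>Q\<in>Z. \<forall>X\<in>Z. Q \<subseteq> X \<longrightarrow> X = Q"
  proof (rule subset_Zorn_nonempty)
    show "Z \<noteq> {}" using \<open>J0 \<in> Z\<close> by blast
    fix \<C> assume ne: "\<C> \<noteq> {}" and ch: "subset.chain Z \<C>"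
    then have sub: "\<C> \<subseteq> Z" by (simp add: subset_chain_def)
    have "thick_ideal M (\<Union>\<C>)"
      by (rule thick_ideal_chain_Union[OF ch ne]) (use sub in \<open>auto simp: Z_def\<close>)
    then show "\<Union>\<C> \<in> Z" using sub ne unfolding Z_def by blast
  qed
  then obtain Q where QZ: "Q \<in> Z" and max: "\<And>X. \<lbrakk>X \<in> Z; Q \<subseteq> X\<rbrakk> \<Longrightarrow> X = Q" by blast
  have QI: "thick_ideal M Q" and J0Q: "J0 \<subseteq> Q" and av: "\<And>y. \<lbrakk>y \<in> Obj C; U \<star> y \<in> Q\<rbrakk> \<Longrightarrow> y \<in> P"
    using QZ by (auto simp: Z_def)
  have QT: "thick M Q" using QI by (simp add: thick_ideal_def)
  \<comment> \<open>If \<open>a \<otimes>\<^sub>A b\<close> is in \<open>Q\<close> and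
    \<open>b\<close> is not, the ideal quotient of \<open>Q\<close> by \<open>a\<close> is strictly
    larger than \<open>Q\<close>, so by maximality it contains a forbidden free module.\<close>
  have big: "\<exists>y\<in>Obj C. y \<notin> P \<and> mt a (U \<star> y) \<in> Q"
    if a: "modl a" and b: "modl b" "b \<notin> Q" "mt a b \<in> Q" for a b
  proof (rule ccontr)
    assume no: "\<not> ?thesis"
    let ?X = "{z. modl z \<and> mt a z \<in> Q}"
    have QX: "Q \<subseteq> ?X" using ideal_mt(1)[OF QI _ a] M_thickD(1)[OF QT] by blast
    have "?X \<in> Z"
      using ideal_quotient[OF QI a] QX J0Q no unfolding Z_def by blast
    then have "?X = Q" using QX by (rule max)
    then show False using b by blast
  qed
  have "Q \<in> primes M"
    unfolding prime_M_iff
  proof (intro conjI allI impI)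
    show "Q \<noteq> {z. modl z}"
      using av[of R] RP by auto
    fix a b assume a: "modl a" and b: "modl b" and ab: "mt a b \<in> Q"
    show "a \<in> Q \<or> b \<in> Q"
    proof (rule ccontr)
      assume n: "\<not> (a \<in> Q \<or> b \<in> Q)"
      \<comment> \<open>Two applications of \<open>big\<close>, the second after swapping factors,
        replace \<open>b\<close> and then \<open>a\<close> by free modules on objects outside
        \<open>P\<close>. Their product is again forbidden, since \<open>P\<close> is prime.\<close>
      then obtain y where y: "y \<in> Obj C" "y \<notin> P" "mt a (U \<star> y) \<in> Q" using big[OF a b _ ab] by blast
      then have "mt (U \<star> y) a \<in> Q" using M_iso[OF QT mt_commute[OF a]] by simp
      then obtain y' where y': "y' \<in> Obj C" "y' \<notin> P" "mt (U \<star> y) (U \<star> y') \<in> Q"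
        using big[of "U \<star> y" a] a n y by auto
      then have "U \<star> (y \<boxtimes> y') \<in> Q" using M_iso[OF QT free_tensor] y by blast
      then have "y \<boxtimes> y' \<in> P" using av y y' by simp
      then show False using pr y y' by blast
    qed
  qed fact
  moreover have "phi Q = P"
  proof
    show "phi Q \<subseteq> P" using av by (auto simp: phi_def)
    \<comment> \<open>This is what the requirement \<open>J0 \<subseteq> Q\<close> is for.\<close>
    show "P \<subseteq> phi Q"
    proof
      fix y assume y: "y \<in> P"
      then have yO: "y \<in> Obj C" by (rule thick_idealD[OF PI])
      have "R \<boxtimes> y \<in> P" using thick_idealD(2)[OF PI _ y] by simp
      then have "U \<star> y \<in> J0" using yO by (simp add: J0_def)
      then show "y \<in> phi Q" using J0Q yO by (auto simp: phi_def)
    qed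
  qed
  ultimately show ?thesis by (rule that)
qed

text \<open>The witness is the tensor product of the modules \<open>f i\<close>.\<close>

lemma norm_exists:
  assumes "finite I" "\<And>i. i \<in> I \<Longrightarrow> modl (f i)"
  shows "\<exists>n. modl n \<and> (\<forall>J. thick_ideal M J \<longrightarrow> (\<exists>i\<in>I. f i \<in> J) \<longrightarrow> n \<in> J) \<and>
    (\<forall>Q\<in>primes M. n \<in> Q \<longrightarrow> (\<exists>i\<in>I. f i \<in> Q))"
  using assms
proof (induction I rule: finite_induct)
  case empty
  \<comment> \<open>The empty tensor product is the unit module, which lies in no prime.\<close>
  show ?case by (rule exI[of _ U]) (use U_notin_prime in auto)
next
  case (insert j I)
  then obtain n where n: "modl n" "\<And>J. \<lbrakk>thick_ideal M J; \<exists>i\<in>I. f i \<in> J\<rbrakk> \<Longrightarrow> n \<in> J"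
    "\<And>Q. \<lbrakk>Q \<in> primes M; n \<in> Q\<rbrakk> \<Longrightarrow> \<exists>i\<in>I. f i \<in> Q" by auto
  have j: "modl (f j)" using insert.prems by simp
  show ?case
  proof (intro exI[of _ "mt (f j) n"] conjI allI impI ballI)
    show "modl (mt (f j) n)" by (rule mt_split(1)[OF j n(1)])
    show "mt (f j) n \<in> J" if J: "thick_ideal M J" and "\<exists>i\<in>insert j I. f i \<in> J" for J
      using that(2) ideal_mt(2)[OF J _ n(1)] ideal_mt(1)[OF J n(2)[OF J] j] by blast
    show "\<exists>i\<in>insert j I. f i \<in> Q" if Q: "Q \<in> primes M" "mt (f j) n \<in> Q" for Q
      using prime_MD(4)[OF Q(1) j n(1) Q(2)] n(3)[OF Q(1)] by blast
  qed
qed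

end

section \<open>Translates of primes and the fibres of \<open>phi\<close>\<close>

context galois_ring
begin

text \<open>The inverse image of \<open>Q\<close> under the twist. By \<open>Spc_action_eq\<close>
  this is the action of the inverse of \<open>\<gamma>\<close> on a prime \<open>Q\<close>.\<close>

definition twp :: "'m \<Rightarrow> ('o, 'm) modl set \<Rightarrow> ('o, 'm) modl set" where
  "twp \<gamma> Q = {z. modl z \<and> tw \<gamma> z \<in> Q}"

text \<open>Twisting is compatible with triangles, with tensoring by objects and, up to isomorphism,
  with \<open>\<otimes>\<^sub>A\<close>. The translate is proper because \<open>U\<close> is the
  twist by \<open>\<gamma>\<close> of \<open>tw \<delta> U\<close>.\<close>

lemma twp_prime:
  assumes Q: "Q \<in> primes M" and \<gamma>: "\<gamma> \<in> \<Gamma>"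
  shows "twp \<gamma> Q \<in> primes M"
  unfolding prime_M_iff
proof (intro conjI allI impI)
  note T = prime_MD(2)[OF Q] and h = group_hom[OF \<gamma>]
  show "thick_ideal M (twp \<gamma> Q)"
    unfolding ideal_iff
  proof (intro conjI ballI)
    show "thick M (twp \<gamma> Q)"
    proof (rule M_thickI)
      show "z \<in> twp \<gamma> Q" if "modl z" "is_zero_obj C (fst z)" for z
        using M_thickD(2)[OF T, of "tw \<gamma> z"] that h by (simp add: twp_def)
      show "y \<in> twp \<gamma> Q" if "x \<in> twp \<gamma> Q" "lin y s x" "lin x r y" "r \<cdot> s = Ident C (fst y)" for x y r s
        using M_retract[OF T tw_lin[OF h that(2)] tw_lin[OF h that(3)]] that linD(1)[OF that(2)]
        by (simp add: twp_def)
      show "(x \<in> twp \<gamma> Q \<and> y \<in> twp \<gamma> Q \<longrightarrow> z \<in> twp \<gamma> Q) \<and> (y \<in> twp \<gamma> Q \<and> z \<in> twp \<gamma> Q \<longrightarrow> x \<in> twp \<gamma> Q) \<and>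
          (x \<in> twp \<gamma> Q \<and> z \<in> twp \<gamma> Q \<longrightarrow> y \<in> twp \<gamma> Q)"
        if tri: "lin x f y" "lin y g z" "lin z k (mod_susp C A x)"
          "is_exact_triangle C (fst x) (fst y) (fst z) f g k" for x y z f g k
      proof -
        have m: "modl x" "modl y" "modl z" using tri by (auto dest: linD)
        have mem: "w \<in> twp \<gamma> Q \<longleftrightarrow> tw \<gamma> w \<in> Q" if "modl w" for w
          using that by (simp add: twp_def)
        have "lin (tw \<gamma> z) k (mod_susp C A (tw \<gamma> x))"
          using tw_lin[OF h tri(3)] by (simp add: tw_susp[OF h m(1)])
        then have "(tw \<gamma> x \<in> Q \<and> tw \<gamma> y \<in> Q \<longrightarrow> tw \<gamma> z \<in> Q) \<and>
            (tw \<gamma> y \<in> Q \<and> tw \<gamma> z \<in> Q \<longrightarrow> tw \<gamma> x \<in> Q) \<and>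
            (tw \<gamma> x \<in> Q \<and> tw \<gamma> z \<in> Q \<longrightarrow> tw \<gamma> y \<in> Q)"
          by (rule M_triangleD[OF T tw_lin[OF h tri(1)] tw_lin[OF h tri(2)]]) (use tri(4) in simp)
        then show ?thesis unfolding mem[OF m(1)] mem[OF m(2)] mem[OF m(3)] .
      qed
    qed (simp add: twp_def)
    show "z \<star> y \<in> twp \<gamma> Q" if "z \<in> twp \<gamma> Q" "y \<in> Obj C" for z y
      using that prime_MD(6)[OF Q, of "tw \<gamma> z" y] by (simp add: twp_def tw_mten[OF h])
  qed
  obtain \<delta> where \<delta>: "\<delta> \<in> \<Gamma>" "\<gamma> \<cdot> \<delta> = Ident C R" "\<delta> \<cdot> \<gamma> = Ident C R"
    using group_inverse[OF \<gamma>] by blast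
  show "twp \<gamma> Q \<noteq> {z. modl z}"
  proof
    assume all: "twp \<gamma> Q = {z. modl z}"
    have "U \<in> Q"
    proof -
      have "tw \<delta> U \<in> twp \<gamma> Q" using all group_hom[OF \<delta>(1)] by simp
      then show ?thesis by (simp add: twp_def tw_tw[OF h group_hom[OF \<delta>(1)]] \<delta>)
    qed
    then show False using U_notin_prime[OF Q] by simp
  qed
  fix x y assume m: "modl x" "modl y" and xy: "mt x y \<in> twp \<gamma> Q"
  then have "mt (tw \<gamma> x) (tw \<gamma> y) \<in> Q"
    using M_iso[OF T miso_sym[OF mt_tw[OF h group_iso[OF \<gamma>] m]]] by (simp add: twp_def)
  then show "x \<in> twp \<gamma> Q \<or> y \<in> twp \<gamma> Q"
    using prime_MD(4)[OF Q, of "tw \<gamma> x" "tw \<gamma> y"] m h by (simp add: twp_def)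
qed

text \<open>\<open>\<gamma>\<close> itself is a linear isomorphism from \<open>U\<close> to its
  twist, so every free module is isomorphic to its twist.\<close>

lemma phi_twp:
  assumes Q: "Q \<in> primes M" and \<gamma>: "\<gamma> \<in> \<Gamma>"
  shows "phi (twp \<gamma> Q) = phi Q"
proof -
  note T = prime_MD(2)[OF Q] and h = group_hom[OF \<gamma>]
  note [simp] = ring_homD(1-3)[OF h]
  obtain \<delta> where \<delta>: "\<delta> \<in> \<Gamma>" "\<gamma> \<cdot> \<delta> = Ident C R" "\<delta> \<cdot> \<gamma> = Ident C R"
    using group_inverse[OF \<gamma>] by blast
  note [simp] = ring_homD(1-3)[OF group_hom[OF \<delta>(1)]]
  have "\<gamma> \<odot> \<gamma> = (\<gamma> \<triangleleft> R) \<cdot> (R \<triangleright> \<gamma>)"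
    using TenA_Comp[of "Ident C R" R R \<gamma> R \<gamma> R R "Ident C R" R] by simp
  then have "lin U \<gamma> (tw \<gamma> U)"
    by (intro linI) (use h ring_homD(4)[OF h] in \<open>auto simp: tw_snd comp_assoc\<close>)
  then have "miso U (tw \<gamma> U)" by (rule misoI[of _ _ _ \<delta>]) (auto simp: \<delta>)
  then have iso: "miso (U \<star> y) (tw \<gamma> (U \<star> y))" if "y \<in> Obj C" for y
    using miso_mten[of U "tw \<gamma> U" y] that by (simp add: tw_mten[OF h])
  have "U \<star> y \<in> Q \<longleftrightarrow> tw \<gamma> (U \<star> y) \<in> Q" if "y \<in> Obj C" for y
    using M_iso[OF T iso[OF that]] M_iso[OF T miso_sym[OF iso[OF that]]] by blast
  then show ?thesis by (auto simp: phi_def twp_def)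
qed

text \<open>Otherwise pick in each translate of \<open>Q\<close> a module outside \<open>Q'\<close>.
  The tensor product \<open>n\<close> of these modules lies in every translate, so its underlying
  object is in \<open>phi Q = phi Q'\<close>. This puts \<open>n\<close> into \<open>Q'\<close> and,
  \<open>Q'\<close> being prime, one of the chosen modules too.\<close>

lemma twp_subset_of_phi:
  assumes Q: "Q \<in> primes M" "Q' \<in> primes M" and eq: "phi Q = phi Q'"
  shows "\<exists>\<gamma>\<in>\<Gamma>. twp \<gamma> Q \<subseteq> Q'"
proof (rule ccontr)
  assume "\<not> ?thesis"
  then have "\<forall>\<gamma>\<in>\<Gamma>. \<exists>x. x \<in> twp \<gamma> Q \<and> x \<notin> Q'" by blast
  then obtain f where f: "\<And>\<gamma>. \<gamma> \<in> \<Gamma> \<Longrightarrow> f \<gamma> \<in> twp \<gamma> Q \<and> f \<gamma> \<notin> Q'" by metis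
  then have m: "modl (f \<gamma>)" if "\<gamma> \<in> \<Gamma>" for \<gamma> using that by (simp add: twp_def)
  obtain n where n: "modl n" "\<And>J. \<lbrakk>thick_ideal M J; \<exists>i\<in>\<Gamma>. f i \<in> J\<rbrakk> \<Longrightarrow> n \<in> J"
    "\<And>Q. \<lbrakk>Q \<in> primes M; n \<in> Q\<rbrakk> \<Longrightarrow> \<exists>i\<in>\<Gamma>. f i \<in> Q"
    using norm_exists[of \<Gamma> f, OF finite_group m] by metis
  have "\<forall>\<gamma>\<in>\<Gamma>. n \<in> twp \<gamma> Q"
    using n(2)[OF prime_MD(1)[OF twp_prime[OF Q(1)]]] f by blast
  then have "U \<star> fst n \<in> Q"
    unfolding free_mem_iff[OF prime_MD(2)[OF Q(1)] n(1)] by (simp add: twp_def)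
  then have "fst n \<in> phi Q" using n(1) by (simp add: phi_def)
  then have "U \<star> fst n \<in> Q'" unfolding eq by (simp add: phi_def)
  then have "tw (Ident C R) n \<in> Q'"
    unfolding free_mem_iff[OF prime_MD(2)[OF Q(2)] n(1)] using group_one by blast
  then have "n \<in> Q'" using n(1) by simp
  then show False using n(3)[OF Q(2)] f by blast
qed

lemma twp_twp:
  assumes "\<gamma> \<in> \<Gamma>" "\<delta> \<in> \<Gamma>"
  shows "twp \<gamma> (twp \<delta> Q) = twp (\<gamma> \<cdot> \<delta>) Q"
  using group_hom[OF assms(1)] group_hom[OF assms(2)]
  by (auto simp: twp_def tw_tw)

lemma twp_one:
  assumes "Q \<in> primes M"
  shows "twp (Ident C R) Q = Q"
  using prime_MD(5)[OF assms] by (auto simp: twp_def)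

text \<open>Translates under a finite group cannot shrink. Multiplication by \<open>\<gamma>\<close>
  maps \<open>T\<close> injectively into itself, hence onto, so
  \<open>\<gamma> = \<gamma> \<cdot> \<delta>\<close> for some \<open>\<delta>\<close> in
  \<open>T\<close>. Then \<open>\<delta>\<close> is the identity, and its membership in
  \<open>T\<close> reads \<open>Q \<subseteq> twp \<gamma> Q\<close>.\<close>

lemma twp_subset_eq:
  assumes Q: "Q \<in> primes M" and \<gamma>: "\<gamma> \<in> \<Gamma>" and sub: "twp \<gamma> Q \<subseteq> Q"
  shows "twp \<gamma> Q = Q"
proof -
  define T where "T = {\<delta> \<in> \<Gamma>. twp \<delta> Q \<subseteq> twp \<gamma> Q}"
  have mono: "twp \<delta> X \<subseteq> twp \<delta> Y" if "X \<subseteq> Y" for \<delta> X Y using that by (auto simp: twp_def)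
  obtain \<gamma>' where \<gamma>': "\<gamma>' \<in> \<Gamma>" "\<gamma> \<cdot> \<gamma>' = Ident C R" "\<gamma>' \<cdot> \<gamma> = Ident C R"
    using group_inverse[OF \<gamma>] by blast
  have inj: "inj_on (\<lambda>\<delta>. \<gamma> \<cdot> \<delta>) \<Gamma>"
  proof (rule inj_onI)
    fix a b assume ab: "a \<in> \<Gamma>" "b \<in> \<Gamma>" "\<gamma> \<cdot> a = \<gamma> \<cdot> b"
    show "a = b"
      by (rule retraction_mono[OF ab(3) \<gamma>'(3)])
        (use ring_homD(1-3)[OF group_hom] ab \<gamma> \<gamma>' in auto)
  qed
  have "(\<lambda>\<delta>. \<gamma> \<cdot> \<delta>) ` T \<subseteq> T"
  proof
    fix x assume "x \<in> (\<lambda>\<delta>. \<gamma> \<cdot> \<delta>) ` T"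
    then obtain \<delta> where \<delta>: "\<delta> \<in> \<Gamma>" "twp \<delta> Q \<subseteq> twp \<gamma> Q" "x = \<gamma> \<cdot> \<delta>" by (auto simp: T_def)
    have "twp x Q = twp \<gamma> (twp \<delta> Q)" using twp_twp[OF \<gamma> \<delta>(1)] \<delta>(3) by simp
    also have "\<dots> \<subseteq> twp \<gamma> Q" by (rule mono) (use \<delta>(2) sub in blast)
    finally show "x \<in> T" using group_comp[OF \<gamma> \<delta>(1)] \<delta>(3) by (simp add: T_def)
  qed
  moreover have "finite T" "inj_on (\<lambda>\<delta>. \<gamma> \<cdot> \<delta>) T"
    using finite_group inj by (auto simp: T_def intro: inj_on_subset)
  ultimately have "(\<lambda>\<delta>. \<gamma> \<cdot> \<delta>) ` T = T" by (intro endo_inj_surj)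
  moreover have "\<gamma> \<in> T" using \<gamma> by (simp add: T_def)
  ultimately obtain \<delta> where \<delta>: "\<delta> \<in> T" "\<gamma> \<cdot> \<delta> = \<gamma>" by (metis imageE)
  have "\<delta> = Ident C R"
    by (rule inj_onD[OF inj]) (use \<delta> group_one ring_homD(1-3)[OF group_hom[OF \<gamma>]] in \<open>auto simp: T_def\<close>)
  then show ?thesis using \<delta>(1) sub twp_one[OF Q] by (auto simp: T_def)
qed

text \<open>The inclusions obtained in both directions combine to \<open>twp (\<gamma> \<cdot>
  \<delta>) Q' \<subseteq> twp \<gamma> Q \<subseteq> Q'\<close>, and the outer terms agree by
  \<open>twp_subset_eq\<close>.\<close>

lemma phi_eq_iff:
  assumes Q: "Q \<in> primes M" "Q' \<in> primes M"
  shows "phi Q = phi Q' \<longleftrightarrow> (\<exists>\<gamma>\<in>\<Gamma>. Q' = twp \<gamma> Q)"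
proof
  assume eq: "phi Q = phi Q'"
  obtain \<gamma> where \<gamma>: "\<gamma> \<in> \<Gamma>" "twp \<gamma> Q \<subseteq> Q'" using twp_subset_of_phi[OF Q eq] by blast
  obtain \<delta> where \<delta>: "\<delta> \<in> \<Gamma>" "twp \<delta> Q' \<subseteq> Q" using twp_subset_of_phi[OF Q(2,1) eq[symmetric]] by blast
  have "twp (\<gamma> \<cdot> \<delta>) Q' = twp \<gamma> (twp \<delta> Q')" using twp_twp \<gamma> \<delta> by simp
  also have "\<dots> \<subseteq> twp \<gamma> Q" using \<delta>(2) by (auto simp: twp_def)
  finally have 1: "twp (\<gamma> \<cdot> \<delta>) Q' \<subseteq> twp \<gamma> Q" .
  then have "twp (\<gamma> \<cdot> \<delta>) Q' = Q'"
    by (intro twp_subset_eq[OF Q(2) group_comp]) (use \<gamma> \<delta> in auto)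
  then show "\<exists>\<gamma>\<in>\<Gamma>. Q' = twp \<gamma> Q" using 1 \<gamma> by blast
next
  assume "\<exists>\<gamma>\<in>\<Gamma>. Q' = twp \<gamma> Q"
  then show "phi Q = phi Q'" using phi_twp[OF Q(1)] by auto
qed

lemma Spc_action_eq:
  assumes Q: "Q \<in> primes M" and \<gamma>: "\<gamma> \<in> \<Gamma>"
    and \<delta>: "\<delta> \<in> \<Gamma>" "\<gamma> \<cdot> \<delta> = Ident C R" "\<delta> \<cdot> \<gamma> = Ident C R"
  shows "Spc_action C A \<gamma> Q = twp \<delta> Q"
proof -
  note T = prime_MD(2)[OF Q]
  have "FObj (ext_scalars C A A \<gamma>) z \<in> Q \<longleftrightarrow> tw \<delta> z \<in> Q" if "modl z" for z
  proof -
    have "miso (FObj (ext_scalars C A A \<gamma>) z) (tw \<delta> z)"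
      by (rule ext_scalars_tw) (use group_hom \<gamma> \<delta> that in auto)
    then show ?thesis using M_iso[OF T] miso_sym by blast
  qed
  then show ?thesis by (auto simp: Spc_action_def Spc_map_def twp_def)
qed

text \<open>The action is by twists along inverses; over the whole group the two families of
  translates coincide.\<close>

lemma orbit_eq:
  assumes Q: "Q \<in> primes M"
  shows "orbit (ring_aut C A\<lparr>carrier := \<Gamma>\<rparr>) (Spc_action C A) Q = {twp \<gamma> Q | \<gamma>. \<gamma> \<in> \<Gamma>}"
proof -
  have "{Spc_action C A \<gamma> Q | \<gamma>. \<gamma> \<in> \<Gamma>} = {twp \<gamma> Q | \<gamma>. \<gamma> \<in> \<Gamma>}"
  proof (intro equalityI subsetI)
    fix X assume "X \<in> {Spc_action C A \<gamma> Q | \<gamma>. \<gamma> \<in> \<Gamma>}"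
    then obtain \<gamma> where \<gamma>: "\<gamma> \<in> \<Gamma>" "X = Spc_action C A \<gamma> Q" by blast
    obtain \<delta> where \<delta>: "\<delta> \<in> \<Gamma>" "\<gamma> \<cdot> \<delta> = Ident C R" "\<delta> \<cdot> \<gamma> = Ident C R"
      using group_inverse[OF \<gamma>(1)] .
    have "X = twp \<delta> Q" unfolding \<gamma>(2) by (rule Spc_action_eq[OF Q \<gamma>(1) \<delta>])
    then show "X \<in> {twp \<gamma> Q | \<gamma>. \<gamma> \<in> \<Gamma>}" using \<delta>(1) by blast
  next
    fix X assume "X \<in> {twp \<gamma> Q | \<gamma>. \<gamma> \<in> \<Gamma>}"
    then obtain \<gamma> where \<gamma>: "\<gamma> \<in> \<Gamma>" "X = twp \<gamma> Q" by blast
    obtain \<delta> where \<delta>: "\<delta> \<in> \<Gamma>" "\<gamma> \<cdot> \<delta> = Ident C R" "\<delta> \<cdot> \<gamma> = Ident C R"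
      using group_inverse[OF \<gamma>(1)] .
    have "X = Spc_action C A \<delta> Q"
      unfolding \<gamma>(2) by (rule Spc_action_eq[OF Q \<delta>(1) \<gamma>(1) \<delta>(3,2), symmetric])
    then show "X \<in> {Spc_action C A \<gamma> Q | \<gamma>. \<gamma> \<in> \<Gamma>}" using \<delta>(1) by blast
  qed
  then show ?thesis by (simp add: orbit_def)
qed

lemma orbit_eq_iff:
  assumes Q: "Q \<in> primes M" "Q' \<in> primes M"
  shows "orbit (ring_aut C A\<lparr>carrier := \<Gamma>\<rparr>) (Spc_action C A) Q =
    orbit (ring_aut C A\<lparr>carrier := \<Gamma>\<rparr>) (Spc_action C A) Q' \<longleftrightarrow> phi Q = phi Q'"
proof
  assume "orbit (ring_aut C A\<lparr>carrier := \<Gamma>\<rparr>) (Spc_action C A) Q =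
    orbit (ring_aut C A\<lparr>carrier := \<Gamma>\<rparr>) (Spc_action C A) Q'"
  then have "{twp \<gamma> Q | \<gamma>. \<gamma> \<in> \<Gamma>} = {twp \<gamma> Q' | \<gamma>. \<gamma> \<in> \<Gamma>}" by (simp add: orbit_eq Q)
  moreover have "Q' \<in> {twp \<gamma> Q' | \<gamma>. \<gamma> \<in> \<Gamma>}"
    by (rule CollectI, rule exI[of _ "Ident C R"]) (simp add: twp_one[OF Q(2)] group_one)
  ultimately have "Q' \<in> {twp \<gamma> Q | \<gamma>. \<gamma> \<in> \<Gamma>}" by simp
  then show "phi Q = phi Q'" unfolding phi_eq_iff[OF Q] by blast
next
  have sub: "{twp \<gamma> X | \<gamma>. \<gamma> \<in> \<Gamma>} \<subseteq> {twp \<gamma> Y | \<gamma>. \<gamma> \<in> \<Gamma>}"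
    if "\<delta> \<in> \<Gamma>" "X = twp \<delta> Y" for X Y \<delta>
    using that twp_twp group_comp by blast
  assume eq: "phi Q = phi Q'"
  obtain \<gamma> \<delta> where "\<gamma> \<in> \<Gamma>" "Q' = twp \<gamma> Q" "\<delta> \<in> \<Gamma>" "Q = twp \<delta> Q'"
    using phi_eq_iff[OF Q] phi_eq_iff[OF Q(2,1)] eq by metis
  then have "{twp \<gamma> Q | \<gamma>. \<gamma> \<in> \<Gamma>} = {twp \<gamma> Q' | \<gamma>. \<gamma> \<in> \<Gamma>}" using sub by (intro equalityI)
  then show "orbit (ring_aut C A\<lparr>carrier := \<Gamma>\<rparr>) (Spc_action C A) Q =
    orbit (ring_aut C A\<lparr>carrier := \<Gamma>\<rparr>) (Spc_action C A) Q'" by (simp add: orbit_eq Q)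
qed

end

section \<open>Topology\<close>

lemma Spc_basic: "primes D - supp D x = {P \<in> primes D. x \<in> P}"
  by (auto simp: supp_def)

lemma Spc_generated:
  "Spc D = topology_generated_by ((\<lambda>x. {P \<in> primes D. x \<in> P}) ` Obj D)"
  unfolding Spc_def Spc_basic Setcompr_eq_image ..

lemma openin_Spc_basic:
  assumes "x \<in> Obj D"
  shows "openin (Spc D) {P \<in> primes D. x \<in> P}"
  unfolding Spc_generated by (rule topology_generated_by_Basis, rule imageI, rule assms)

lemma topspace_Spc:
  assumes "is_zero_obj D z"
  shows "topspace (Spc D) = primes D"
proof -
  have "z \<in> Obj D" using assms unfolding is_zero_obj_def by blast
  moreover have "z \<in> P" if "P \<in> primes D" for P
    using that assms unfolding primes_def thick_ideal_def thick_def triangulated_subcat_def by blast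
  ultimately show ?thesis
    unfolding Spc_generated topology_generated_by_topspace by blast
qed

text \<open>A finite set of objects stands in for its direct sum in describing a basic open
  set.\<close>

lemma openin_Spc_finite:
  assumes z: "is_zero_obj D z" and "finite F" "F \<subseteq> Obj D"
  shows "openin (Spc D) {P \<in> primes D. F \<subseteq> P}"
  using assms(2,3)
proof (induction F rule: finite_induct)
  case empty
  then show ?case using openin_topspace[of "Spc D"] by (simp add: topspace_Spc[OF z])
next
  case (insert x F)
  have "{P \<in> primes D. insert x F \<subseteq> P} = {P \<in> primes D. x \<in> P} \<inter> {P \<in> primes D. F \<subseteq> P}" by blast
  then show ?case using insert openin_Spc_basic[of x D] by (simp add: openin_Int)
qed

text \<open>Induction over the generation of the topology; \<open>X\<close> is a finite set because
  intersecting open sets unites their conditions.\<close>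

lemma Spc_neighbourhood:
  assumes "openin (Spc D) W" "Q \<in> W"
  obtains X where "finite X" "X \<subseteq> Q" "\<And>Q'. \<lbrakk>Q' \<in> primes D; X \<subseteq> Q'\<rbrakk> \<Longrightarrow> Q' \<in> W"
proof -
  have "generate_topology_on ((\<lambda>x. {P \<in> primes D. x \<in> P}) ` Obj D) W"
    using assms(1) unfolding Spc_generated openin_topology_generated_by_iff .
  then have "\<forall>Q\<in>W. \<exists>X. finite X \<and> X \<subseteq> Q \<and> (\<forall>Q'\<in>primes D. X \<subseteq> Q' \<longrightarrow> Q' \<in> W)"
  proof (induction rule: generate_topology_on.induct)
    case (Int a b)
    show ?case
    proof
      fix Q assume Q: "Q \<in> a \<inter> b"
      obtain X where "finite X" "X \<subseteq> Q" "\<forall>Q'\<in>primes D. X \<subseteq> Q' \<longrightarrow> Q' \<in> a"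
        using bspec[OF Int.IH(1) IntD1[OF Q]] by blast
      moreover obtain Y where "finite Y" "Y \<subseteq> Q" "\<forall>Q'\<in>primes D. Y \<subseteq> Q' \<longrightarrow> Q' \<in> b"
        using bspec[OF Int.IH(2) IntD2[OF Q]] by blast
      ultimately show "\<exists>X. finite X \<and> X \<subseteq> Q \<and> (\<forall>Q'\<in>primes D. X \<subseteq> Q' \<longrightarrow> Q' \<in> a \<inter> b)"
        by (intro exI[of _ "X \<union> Y"]) auto
    qed
  next
    case (UN K)
    show ?case
    proof
      fix Q assume "Q \<in> \<Union>K"
      then obtain k where k: "k \<in> K" "Q \<in> k" by blast
      obtain X where "finite X \<and> X \<subseteq> Q \<and> (\<forall>Q'\<in>primes D. X \<subseteq> Q' \<longrightarrow> Q' \<in> k)"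
        using bspec[OF UN.IH[OF k(1)] k(2)] by (rule exE)
      then show "\<exists>X. finite X \<and> X \<subseteq> Q \<and> (\<forall>Q'\<in>primes D. X \<subseteq> Q' \<longrightarrow> Q' \<in> \<Union>K)"
        using k(1) by (intro exI[of _ X]) auto
    qed
  next
    case (Basis s)
    then obtain x where "s = {P \<in> primes D. x \<in> P}" by (rule imageE)
    then show ?case by (intro ballI exI[of _ "{x}"]) auto
  qed simp
  from bspec[OF this assms(2)] obtain X
    where "finite X \<and> X \<subseteq> Q \<and> (\<forall>Q'\<in>primes D. X \<subseteq> Q' \<longrightarrow> Q' \<in> W)" by (rule exE)
  then show ?thesis by (intro that[of X]) auto
qed

section \<open>The orbit space as a quotient of the spectrum of modules\<close>

context galois_ring
begin

lemma topspace_Spc_C [simp]: "topspace (Spc C) = primes C"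
proof -
  obtain z where "is_zero_obj C z" using zero_obj_exists by (rule exE)
  then show ?thesis by (rule topspace_Spc)
qed

lemma topspace_Spc_M [simp]: "topspace (Spc M) = primes M"
proof -
  obtain z where "is_zero_obj M z" using thick_setting.zero_obj_ex[OF M_thick_setting] by (rule exE)
  then show ?thesis by (rule topspace_Spc)
qed

lemma phi_continuous: "continuous_map (Spc M) (subtopology (Spc C) (supp C R)) phi"
  unfolding continuous_map_in_subtopology
proof
  show "continuous_map (Spc M) (Spc C) phi"
    unfolding Spc_generated[of C]
  proof (rule continuous_on_generated_topo)
    fix S assume "S \<in> (\<lambda>x. {P \<in> primes C. x \<in> P}) ` Obj C"
    then obtain y where y: "y \<in> Obj C" "S = {P \<in> primes C. y \<in> P}" by blast
    have "phi -` S \<inter> topspace (Spc M) = {Q \<in> primes M. U \<star> y \<in> Q}"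
      using y phi_supp by (auto simp: phi_def supp_def)
    then show "openin (Spc M) (phi -` S \<inter> topspace (Spc M))"
      using openin_Spc_basic[of "U \<star> y" M] y by simp
  next
    have "phi ` topspace (Spc M) \<subseteq> topspace (Spc C)" using phi_supp by (auto simp: supp_def)
    then show "phi ` topspace (Spc M) \<subseteq> \<Union>((\<lambda>x. {P \<in> primes C. x \<in> P}) ` Obj C)"
      unfolding Spc_generated[of C] topology_generated_by_topspace .
  qed
  show "phi \<in> topspace (Spc M) \<rightarrow> supp C R" using phi_supp by auto
qed

text \<open>The point is that \<open>V\<close> is open when its preimage \<open>?W\<close> is.
  Around \<open>phi Q\<close> an open set inside \<open>V\<close> is cut out by the underlying
  objects of the tensor products \<open>n f\<close>, one for each choice \<open>f\<close> of an
  element from every finite set \<open>X \<gamma>\<close>.\<close>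

lemma phi_quotient: "quotient_map (Spc M) (subtopology (Spc C) (supp C R)) phi"
  unfolding quotient_map_def
proof (intro conjI allI impI)
  let ?Y = "subtopology (Spc C) (supp C R)"
  have Y: "topspace ?Y = supp C R" by (auto simp: supp_def)
  have "supp C R \<subseteq> phi ` primes M"
  proof
    fix P assume "P \<in> supp C R"
    then show "P \<in> phi ` primes M" by (rule phi_surj) auto
  qed
  then show "phi ` topspace (Spc M) = topspace ?Y"
    unfolding Y topspace_Spc_M using phi_supp by blast
  fix V assume V: "V \<subseteq> topspace ?Y"
  let ?W = "{Q \<in> topspace (Spc M). phi Q \<in> V}"
  show "openin (Spc M) ?W = openin ?Y V"
  proof
    assume "openin ?Y V"
    then show "openin (Spc M) ?W" by (rule openin_continuous_map_preimage[OF phi_continuous])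
  next
    assume W: "openin (Spc M) ?W"
    show "openin ?Y V"
      unfolding openin_subopen[of ?Y V]
    proof
      fix P assume P: "P \<in> V"
      then obtain Q where Q: "Q \<in> primes M" "phi Q = P" using phi_surj V unfolding Y by blast
      \<comment> \<open>\<open>?W\<close> is a union of fibres of \<open>phi\<close>, so it contains
        all translates of \<open>Q\<close>, each with a basic neighbourhood.\<close>
      have "\<forall>\<gamma>\<in>\<Gamma>. \<exists>X. finite X \<and> X \<subseteq> twp \<gamma> Q \<and> (\<forall>Q'\<in>primes M. X \<subseteq> Q' \<longrightarrow> Q' \<in> ?W)"
      proof
        fix \<gamma> assume \<gamma>: "\<gamma> \<in> \<Gamma>"
        then have "twp \<gamma> Q \<in> ?W" using phi_twp[OF Q(1)] twp_prime[OF Q(1)] Q P by simp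
        with W show "\<exists>X. finite X \<and> X \<subseteq> twp \<gamma> Q \<and> (\<forall>Q'\<in>primes M. X \<subseteq> Q' \<longrightarrow> Q' \<in> ?W)"
          by (rule Spc_neighbourhood) blast
      qed
      from bchoice[OF this] obtain X where X0: "\<forall>\<gamma>\<in>\<Gamma>. finite (X \<gamma>) \<and> X \<gamma> \<subseteq> twp \<gamma> Q \<and>
          (\<forall>Q'\<in>primes M. X \<gamma> \<subseteq> Q' \<longrightarrow> Q' \<in> ?W)" by (rule exE)
      have X: "finite (X \<gamma>)" "X \<gamma> \<subseteq> twp \<gamma> Q" "\<lbrakk>Q' \<in> primes M; X \<gamma> \<subseteq> Q'\<rbrakk> \<Longrightarrow> Q' \<in> ?W"
        if "\<gamma> \<in> \<Gamma>" for \<gamma> Q'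
        using bspec[OF X0 that] by blast+
      \<comment> \<open>A prime containing every \<open>n f\<close> contains some
        \<open>X \<gamma>\<close> entirely, for otherwise some \<open>f\<close> takes all its values
        outside it. Running over all choice functions thus turns a disjunction over
        \<open>\<gamma>\<close> into a finite conjunction.\<close>
      let ?F = "PiE \<Gamma> X"
      have fin: "finite ?F" using finite_group X(1) by (intro finite_PiE) auto
      have mod: "modl (f \<gamma>)" if "f \<in> ?F" "\<gamma> \<in> \<Gamma>" for f \<gamma>
        using X(2) PiE_mem[OF that] that(2) by (auto simp: twp_def)
      have "\<forall>f\<in>?F. \<exists>n. modl n \<and> (\<forall>J. thick_ideal M J \<longrightarrow> (\<exists>\<gamma>\<in>\<Gamma>. f \<gamma> \<in> J) \<longrightarrow> n \<in> J) \<and>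
          (\<forall>Q\<in>primes M. n \<in> Q \<longrightarrow> (\<exists>\<gamma>\<in>\<Gamma>. f \<gamma> \<in> Q))"
        using norm_exists[OF finite_group] mod by simp
      from bchoice[OF this] obtain n where n0: "\<forall>f\<in>?F. modl (n f) \<and>
          (\<forall>J. thick_ideal M J \<longrightarrow> (\<exists>\<gamma>\<in>\<Gamma>. f \<gamma> \<in> J) \<longrightarrow> n f \<in> J) \<and>
          (\<forall>Q\<in>primes M. n f \<in> Q \<longrightarrow> (\<exists>\<gamma>\<in>\<Gamma>. f \<gamma> \<in> Q))" by (rule exE)
      have n: "modl (n f)" "\<lbrakk>thick_ideal M J; \<exists>\<gamma>\<in>\<Gamma>. f \<gamma> \<in> J\<rbrakk> \<Longrightarrow> n f \<in> J"
        "\<lbrakk>Q \<in> primes M; n f \<in> Q\<rbrakk> \<Longrightarrow> \<exists>\<gamma>\<in>\<Gamma>. f \<gamma> \<in> Q" if "f \<in> ?F" for f J Q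
        using bspec[OF n0 that] by blast+
      let ?N = "(\<lambda>f. fst (n f)) ` ?F" and ?O = "{P \<in> primes C. (\<lambda>f. fst (n f)) ` ?F \<subseteq> P}"
      obtain o' where o': "is_zero_obj C o'" using zero_obj_exists by blast
      have "openin (Spc C) ?O"
        by (rule openin_Spc_finite[OF o']) (use fin n(1) in auto)
      then have 1: "openin ?Y (supp C R \<inter> ?O)" by (rule openin_subtopology_Int2)
      \<comment> \<open>\<open>n f\<close> has a factor in each translate of \<open>Q\<close>, hence
        lies in all of them; \<open>free_mem_iff\<close> descends this to the underlying
        object.\<close>
      have "fst (n f) \<in> phi Q" if f: "f \<in> ?F" for f
      proof -
        have "n f \<in> twp \<gamma> Q" if "\<gamma> \<in> \<Gamma>" for \<gamma>
          using n(2)[OF f prime_MD(1)[OF twp_prime[OF Q(1) that]]] X(2)[OF that] PiE_mem[OF f that] that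
          by blast
        then have "\<forall>\<gamma>\<in>\<Gamma>. tw \<gamma> (n f) \<in> Q" by (simp add: twp_def)
        then show ?thesis
          unfolding free_mem_iff[OF prime_MD(2)[OF Q(1)] n(1)[OF f], symmetric]
          using n(1)[OF f] by (simp add: phi_def)
      qed
      then have 2: "P \<in> supp C R \<inter> ?O" using Q(2) P V unfolding Y by (auto simp: supp_def)
      have 3: "supp C R \<inter> ?O \<subseteq> V"
      proof
        fix P' assume P': "P' \<in> supp C R \<inter> ?O"
        then obtain Q' where Q': "Q' \<in> primes M" "phi Q' = P'" using phi_surj by blast
        have mem: "n f \<in> Q'" if f: "f \<in> ?F" for f
        proof -
          have "U \<star> fst (n f) \<in> Q'" using P' f Q'(2) by (auto simp: phi_def)
          then have "tw (Ident C R) (n f) \<in> Q'"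
            unfolding free_mem_iff[OF prime_MD(2)[OF Q'(1)] n(1)[OF f]] using group_one by blast
          then show ?thesis using n(1)[OF f] by simp
        qed
        have "\<exists>\<gamma>\<in>\<Gamma>. X \<gamma> \<subseteq> Q'"
        proof (rule ccontr)
          assume "\<not> ?thesis"
          then have "\<forall>\<gamma>\<in>\<Gamma>. \<exists>x. x \<in> X \<gamma> \<and> x \<notin> Q'" by blast
          then obtain f where f: "\<And>\<gamma>. \<gamma> \<in> \<Gamma> \<Longrightarrow> f \<gamma> \<in> X \<gamma> \<and> f \<gamma> \<notin> Q'" by metis
          then have F: "restrict f \<Gamma> \<in> ?F" by simp
          show False using n(3)[OF F Q'(1) mem[OF F]] f by auto
        qed
        then obtain \<gamma> where \<gamma>: "\<gamma> \<in> \<Gamma>" "X \<gamma> \<subseteq> Q'" by blast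
        then show "P' \<in> V" using X(3)[OF \<gamma>(1) Q'(1) \<gamma>(2)] Q'(2) by simp
      qed
      show "\<exists>T. openin ?Y T \<and> P \<in> T \<and> T \<subseteq> V" using 1 2 3 by blast
    qed
  qed
qed

text \<open>\<open>phi\<close> and the orbit map are quotient maps out of the same space with the
  same fibres, so the induced map \<open>g\<close> is a bijective quotient map, that is, a
  homeomorphism.\<close>

lemma homeomorphic_orbit_space:
  "subtopology (Spc C) (supp C R) homeomorphic_space orbit_space C A \<Gamma>"
proof -
  let ?Y = "subtopology (Spc C) (supp C R)"
  let ?orb = "orbit (ring_aut C A\<lparr>carrier := \<Gamma>\<rparr>) (Spc_action C A)"
  have Y: "topspace ?Y = supp C R" by (auto simp: supp_def)
  have top: "topspace (orbit_space C A \<Gamma>) = ?orb ` primes M"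
  proof
    show "topspace (orbit_space C A \<Gamma>) \<subseteq> ?orb ` primes M"
      using openin_topspace[of "orbit_space C A \<Gamma>"]
      unfolding orbit_space_def openin_quotient_topology by simp
    have "openin (orbit_space C A \<Gamma>) (?orb ` primes M)"
      unfolding orbit_space_def openin_quotient_topology
    proof
      have "{Q \<in> topspace (Spc M). ?orb Q \<in> ?orb ` primes M} = topspace (Spc M)" by auto
      then show "openin (Spc M) {Q \<in> topspace (Spc M). ?orb Q \<in> ?orb ` primes M}"
        by (simp only: openin_topspace)
    qed simp
    then show "?orb ` primes M \<subseteq> topspace (orbit_space C A \<Gamma>)" by (rule openin_subset)
  qed
  have orb: "quotient_map (Spc M) (orbit_space C A \<Gamma>) ?orb"
    unfolding quotient_map_def top
  proof (intro conjI allI impI)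
    show "?orb ` topspace (Spc M) = ?orb ` primes M" by simp
    fix V assume "V \<subseteq> ?orb ` primes M"
    then show "openin (Spc M) {Q \<in> topspace (Spc M). ?orb Q \<in> V} = openin (orbit_space C A \<Gamma>) V"
      unfolding orbit_space_def openin_quotient_topology by simp
  qed
  \<comment> \<open>Any preimage of \<open>P\<close> under \<open>phi\<close> may be chosen, since
    all of them have the same orbit.\<close>
  define g where "g P = ?orb (SOME Q. Q \<in> primes M \<and> phi Q = P)" for P
  have g: "g (phi Q) = ?orb Q" if Q: "Q \<in> primes M" for Q
  proof -
    have "(SOME Q'. Q' \<in> primes M \<and> phi Q' = phi Q) \<in> primes M \<and>
        phi (SOME Q'. Q' \<in> primes M \<and> phi Q' = phi Q) = phi Q"
      by (rule someI[of _ Q]) (use Q in simp)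
    then show ?thesis unfolding g_def using orbit_eq_iff Q by blast
  qed
  have "quotient_map (Spc M) (orbit_space C A \<Gamma>) (g \<circ> phi)"
    by (rule quotient_map_eq[OF orb]) (use g in auto)
  then have "quotient_map ?Y (orbit_space C A \<Gamma>) g"
    using quotient_map_compose_eq[OF phi_quotient] by blast
  moreover have "inj_on g (topspace ?Y)"
    unfolding Y
  proof (rule inj_onI)
    fix P P' assume P: "P \<in> supp C R" "P' \<in> supp C R" "g P = g P'"
    obtain Q where Q: "Q \<in> primes M" "phi Q = P" using phi_surj[OF P(1)] by blast
    obtain Q' where Q': "Q' \<in> primes M" "phi Q' = P'" using phi_surj[OF P(2)] by blast
    show "P = P'" using P(3) g Q Q' orbit_eq_iff[OF Q(1) Q'(1)] by metis
  qed
  ultimately show ?thesis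
    unfolding homeomorphic_space homeomorphic_map_def by blast
qed

end

theorem theorem9p1:
  fixes K :: "('o, 'm) tt" and A :: "('o, 'm) ring_obj" and \<Gamma> :: "'m set"
  assumes "tt_category K"
    and "quasi_Galois K A \<Gamma>"
  shows "subtopology (Spc K) (supp K (RObj A)) homeomorphic_space orbit_space K A \<Gamma>"
proof -
  have "is_ring K A" and sub: "subgroup \<Gamma> (ring_aut K A)"
    using assms(2) by (auto simp: quasi_Galois_def)
  then interpret tt_ring K A
    using assms(1) by (intro tt_ring.intro tt_ring_axioms.intro)
  obtain inc where B: "bisum \<Gamma> (\<lambda>_. R) (TenO K R R)
      (\<lambda>\<gamma>. Comp K \<mu> (TenA K \<gamma> (Ident K R))) inc"
    using quasi_Galois_bisum[OF assms(2)] by blast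
  have hom: "is_ring_hom K A A \<gamma>" if "\<gamma> \<in> \<Gamma>" for \<gamma>
    using subgroup.subset[OF sub] that ring_aut_simps(1) by auto
  have "Ident K R \<in> \<Gamma>" using subgroup.one_closed[OF sub] by (simp add: ring_aut_simps)
  then interpret separable_ring K A "inc (Ident K R)"
  proof (rule separable_from_bisum[rotated])
    show "bisum \<Gamma> (\<lambda>_. R) (TenO K R R) (\<lambda>\<gamma>. Comp K \<mu> (TenA K \<gamma> (Ident K R))) inc" by (rule B)
  qed (rule hom)
  interpret galois_ring K A "inc (Ident K R)" \<Gamma> inc
    by (rule galois_ring.intro[OF separable_ring_axioms], rule galois_ring_axioms.intro)
      (fact sub B)+
  show ?thesis by (rule homeomorphic_orbit_space)
qed

end
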